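(* Let $G(\lambda)\in\mathbb F(\lambda)^{m\times m}$ and let $\mathbb L_2(\lambda)$ be an $\mathbb M_2$-strong linearization of $G(\lambda)$ as in the context. (a) If $\begin{bmatrix}H_1(\lambda)\\H_2(\lambda)\end{bmatrix}$ ($H_1$ with $n$ rows) is a right minimal basis of $\mathbb L_2(\lambda)$, then $(w^T\otimes I_m)H_2(\lambda)$ is a right minimal basis of $G(\lambda)$ and $H_1(\lambda)=-S^{-1}(\lambda I_n-A)^{-1}B(w^T\otimes I_m)H_2(\lambda)$. (b) If $H(\lambda)$ is a right minimal basis of $G(\lambda)$, then $\begin{bmatrix}H_1(\lambda)\\H_2(\lambda)\end{bmatrix}$ is a right minimal basis of $\mathbb L_2(\lambda)$, where $H_1(\lambda)=-S^{-1}(\lambda I_n-A)^{-1}BH(\lambda)$ and $H_2(\lambda)=\begin{bmatrix}w^T\otimes I_m\\ J^{\mathcal B}\end{bmatrix}^{-1}\begin{bmatrix}H(\lambda)\\ -\widehat N_2(\lambda)m^D_\Phi(\lambda)^{\mathcal B}H(\lambda)\end{bmatrix}$, with $\widehat N_2(\lambda)=Q(\lambda)^T\otimes I_m$ and $Q(\lambda)=\begin{bmatrix}M_\Phi(\lambda)\\ e_k^T\end{bmatrix}^{-1}\begin{bmatrix}I_{k-1}\\0\end{bmatrix}$. (c) $\begin{bmatrix}H_1(\lambda)\\H_2(\lambda)\\\vdots\\H_{k+1}(\lambda)\end{bmatrix}$ ($H_1$ with $n$ rows, the others with $m$ rows) is a left minimal basis of $\mathbb L_2(\lambda)$ if and only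 if $H_{k+1}(\lambda)$ is a left minimal basis of $G(\lambda)$, $H_1(\lambda)=(C(\lambda I_n-A)^{-1}T^{-1})^TH_{k+1}(\lambda)$ and $H_i(\lambda)=\phi_{k-i+1}(\lambda)H_{k+1}(\lambda)$ for $i=2,\dots,k$. (d) If $\varepsilon_1\le\dots\le\varepsilon_l$ are the right minimal indices of $G(\lambda)$, then they are also the right minimal indices of $\mathbb L_2(\lambda)$. (e) If $\eta_1\le\dots\le\eta_l$ are the left minimal indices of $G(\lambda)$, then $\eta_1+k-1\le\dots\le\eta_l+k-1$ are the left minimal indices of $\mathbb L_2(\lambda)$.
   Context: $\mathbb F$ is an arbitrary field. Let $\{\phi_j(\lambda)\}_{j\ge0}$ be a polynomial basis of $\mathbb F[\lambda]$ with $\deg\phi_j=j$ satisfying $\alpha_j\phi_{j+1}(\lambda)=(\lambda-\beta_j)\phi_j(\lambda)-\gamma_j\phi_{j-1}(\lambda)$, $\alpha_j\ne0$, $\phi_{-1}=0$, $\phi_0=1$. Let $G=D+C(\lambda I_n-A)^{-1}B$ with $D$ the polynomial part, $\deg D\ge2$, and $C(\lambda I_n-A)^{-1}B$ a minimal order state-space realization of the strictly proper part. Write $D=\sum_{j=0}^kD_j\phi_j$, $D_k\ne0$. Define $m^D_\Phi(\lambda)=\big[\tfrac{\lambda-\beta_{k-1}}{\alpha_{k-1}}D_k+D_{k-1}\ \ D_{k-2}-\tfrac{\gamma_{k-1}}{\alpha_{k-1}}D_k\ \ D_{k-3}\ \cdots\ D_1\ \ D_0\big]$ ($m\times km$) and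 $M_\Phi(\lambda)\in\mathbb F[\lambda]^{(k-1)\times k}$ whose row $i$ has entries $-\alpha_{k-1-i}$, $\lambda-\beta_{k-1-i}$, $-\gamma_{k-1-i}$ in columns $i,i+1,i+2$ (last row: $-\alpha_0$, $\lambda-\beta_0$ in columns $k-1,k$), zeros elsewhere. $e_k$ is the last column of $I_k$. For a $km\times lm$ pencil $Q=\sum_{i=1}^k\sum_{j=1}^le_ie_j^T\otimes Q_{ij}$ with $m\times m$ blocks $Q_{ij}$, its block transpose is $Q^{\mathcal B}=\sum_{i,j}e_je_i^T\otimes Q_{ij}$ (blocks transposed in position but not internally). Let $w\in\mathbb F^k$, $J\in\mathbb F^{km\times(k-1)m}$ with $\begin{bmatrix}w^T\otimes I_m\\ J^{\mathcal B}\end{bmatrix}$ nonsingular, and $T,S\in\mathbb F^{n\times n}$ nonsingular. The $\mathbb M_2$-strong linearization is $\mathbb L_2(\lambda)=\begin{bmatrix}T(\lambda I_n-A)S & TB & 0_{n\times(k-1)m}\\ \begin{bmatrix}0_{(k-1)m\times n}\\ -CS\end{bmatrix} & m^D_\Phi(\lambda)^{\mathcal B} & M_\Phi(\lambda)^T\otimes I_m\end{bmatrix}\begin{bmatrix}I_n&0\\0&w^T\otimes I_m\\0&J^{\mathcal B}\end{bmatrix}$. A right (left) minimal basis of a rational matrix $G$ is a polynomial matrix whose columns form a minimal basis (polynomial basis of least total degree) of $\mathcal N_r(G)=\{x:Gx=0\}$ ($\mathcal N_\ell(G)=\{x:x^TG=0\}$); minimal indices are the degrees of its vectors. *)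

theory Defs
  imports "Jordan_Normal_Form.Char_Poly" "Jordan_Normal_Form.Gauss_Jordan_Elimination"
          "HOL-Computational_Algebra.Fraction_Field"
begin

definition ratf :: "'a::field poly \<Rightarrow> 'a poly fract" where
  "ratf p = Fract p 1"

definition const_pm :: "'a::field mat \<Rightarrow> 'a poly mat" where
  "const_pm X = map_mat (\<lambda>a. [:a:]) X"

definition rat_pm :: "'a::field poly mat \<Rightarrow> 'a poly fract mat" where
  "rat_pm X = map_mat ratf X"

definition rat_cm :: "'a::field mat \<Rightarrow> 'a poly fract mat" where
  "rat_cm X = rat_pm (const_pm X)"

definition minv :: "'b::field mat \<Rightarrow> 'b mat" where
  "minv X = the (mat_inverse X)"

definition lamI_minus :: "'a::field mat \<Rightarrow> 'a poly mat" where
  "lamI_minus A = char_poly_matrix A"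

definition kron :: "'b::semiring_1 mat \<Rightarrow> 'b mat \<Rightarrow> 'b mat" where
  "kron X Y = mat (dim_row X * dim_row Y) (dim_col X * dim_col Y)
     (\<lambda>(i,j). X $$ (i div dim_row Y, j div dim_col Y) * Y $$ (i mod dim_row Y, j mod dim_col Y))"

text \<open>Block transpose of a (k m) x (l m) matrix with m x m blocks: block (i,j) moves to
  position (j,i), blocks are not transposed internally.\<close>
definition block_transpose :: "nat \<Rightarrow> 'b mat \<Rightarrow> 'b mat" where
  "block_transpose m Q = mat (dim_col Q) (dim_row Q)
     (\<lambda>(r,c). Q $$ ((c div m) * m + r mod m, (r div m) * m + c mod m))"

definition row_block :: "'b mat \<Rightarrow> nat \<Rightarrow> nat \<Rightarrow> 'b mat" where
  "row_block X a b = mat b (dim_col X) (\<lambda>(i,j). X $$ (a + i, j))"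

definition row_of_vec :: "'b vec \<Rightarrow> 'b mat" where
  "row_of_vec w = mat 1 (dim_vec w) (\<lambda>(i,j). w $ j)"

text \<open>alpha_j phi_{j+1} = (lambda - beta_j) phi_j - gamma_j phi_{j-1}, phi_{-1} = 0, phi_0 = 1.\<close>
fun phi :: "(nat \<Rightarrow> 'a::field) \<Rightarrow> (nat \<Rightarrow> 'a) \<Rightarrow> (nat \<Rightarrow> 'a) \<Rightarrow> nat \<Rightarrow> 'a poly" where
  "phi al be ga 0 = 1"
| "phi al be ga (Suc 0) = Polynomial.smult (1 / al 0) [:- be 0, 1:]"
| "phi al be ga (Suc (Suc j)) =
     Polynomial.smult (1 / al (Suc j)) ([:- be (Suc j), 1:] * phi al be ga (Suc j) - Polynomial.smult (ga (Suc j)) (phi al be ga j))"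

definition Dpoly :: "(nat \<Rightarrow> 'a::field) \<Rightarrow> (nat \<Rightarrow> 'a) \<Rightarrow> (nat \<Rightarrow> 'a) \<Rightarrow> nat \<Rightarrow> nat \<Rightarrow> (nat \<Rightarrow> 'a mat) \<Rightarrow> 'a poly mat" where
  "Dpoly al be ga m k D = mat m m (\<lambda>(i,b). \<Sum>j\<le>k. Polynomial.smult (D j $$ (i,b)) (phi al be ga j))"

definition mD_Phi :: "(nat \<Rightarrow> 'a::field) \<Rightarrow> (nat \<Rightarrow> 'a) \<Rightarrow> (nat \<Rightarrow> 'a) \<Rightarrow> nat \<Rightarrow> nat \<Rightarrow> (nat \<Rightarrow> 'a mat) \<Rightarrow> 'a poly mat" where
  "mD_Phi al be ga m k D = mat m (k * m) (\<lambda>(i,c).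
     let j = c div m; b = c mod m in
     if j = 0 then Polynomial.smult (D k $$ (i,b)) (Polynomial.smult (1 / al (k-1)) [:- be (k-1), 1:]) + [:D (k-1) $$ (i,b):]
     else if j = 1 then [:D (k-2) $$ (i,b) - (ga (k-1) / al (k-1)) * D k $$ (i,b):]
     else [:D (k-1-j) $$ (i,b):])"

definition M_Phi :: "(nat \<Rightarrow> 'a::field) \<Rightarrow> (nat \<Rightarrow> 'a) \<Rightarrow> (nat \<Rightarrow> 'a) \<Rightarrow> nat \<Rightarrow> 'a poly mat" where
  "M_Phi al be ga k = mat (k-1) k (\<lambda>(r,c). let t = k - 2 - r in
     if c = r then [:- al t:] else if c = r + 1 then [:- be t, 1:]
     else if c = r + 2 then [:- ga t:] else 0)"

definition ekT :: "nat \<Rightarrow> 'b::zero_neq_one mat" where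
  "ekT k = mat 1 k (\<lambda>(i,j). if j = k - 1 then 1 else 0)"

definition transfer :: "'a::field mat \<Rightarrow> 'a mat \<Rightarrow> 'a mat \<Rightarrow> 'a poly fract mat" where
  "transfer A B C = rat_cm C * minv (rat_pm (lamI_minus A)) * rat_cm B"

definition is_realization :: "nat \<Rightarrow> nat \<Rightarrow> 'a::field mat \<Rightarrow> 'a mat \<Rightarrow> 'a mat \<Rightarrow> 'a poly fract mat \<Rightarrow> bool" where
  "is_realization m n A B C R \<longleftrightarrow> A \<in> carrier_mat n n \<and> B \<in> carrier_mat n m \<and> C \<in> carrier_mat m n
     \<and> transfer A B C = R"

definition is_minimal_realization :: "nat \<Rightarrow> nat \<Rightarrow> 'a::field mat \<Rightarrow> 'a mat \<Rightarrow> 'a mat \<Rightarrow> bool" where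
  "is_minimal_realization m n A B C \<longleftrightarrow> is_realization m n A B C (transfer A B C) \<and>
     (\<forall>n' (A'::'a mat) B' C'. is_realization m n' A' B' C' (transfer A B C) \<longrightarrow> n \<le> n')"

definition Gmat :: "(nat \<Rightarrow> 'a::field) \<Rightarrow> (nat \<Rightarrow> 'a) \<Rightarrow> (nat \<Rightarrow> 'a) \<Rightarrow> nat \<Rightarrow> nat \<Rightarrow> (nat \<Rightarrow> 'a mat)
   \<Rightarrow> 'a mat \<Rightarrow> 'a mat \<Rightarrow> 'a mat \<Rightarrow> 'a poly fract mat" where
  "Gmat al be ga m k D A B C = rat_pm (Dpoly al be ga m k D) + transfer A B C"

definition wI :: "nat \<Rightarrow> 'a::field vec \<Rightarrow> 'a mat" where
  "wI m w = kron (row_of_vec w) (1\<^sub>m m)"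

definition WJ :: "nat \<Rightarrow> 'a::field vec \<Rightarrow> 'a mat \<Rightarrow> 'a mat" where
  "WJ m w J = wI m w @\<^sub>r block_transpose m J"

definition L2 :: "(nat \<Rightarrow> 'a::field) \<Rightarrow> (nat \<Rightarrow> 'a) \<Rightarrow> (nat \<Rightarrow> 'a) \<Rightarrow> nat \<Rightarrow> nat \<Rightarrow> nat \<Rightarrow> (nat \<Rightarrow> 'a mat)
   \<Rightarrow> 'a mat \<Rightarrow> 'a mat \<Rightarrow> 'a mat \<Rightarrow> 'a mat \<Rightarrow> 'a mat \<Rightarrow> 'a vec \<Rightarrow> 'a mat \<Rightarrow> 'a poly mat" where
  "L2 al be ga m n k D A B C T S w J =
     four_block_mat
       (const_pm T * lamI_minus A * const_pm S)
       (four_block_mat (const_pm (T * B)) (0\<^sub>m n ((k-1) * m)) (0\<^sub>m 0 m) (0\<^sub>m 0 ((k-1) * m)))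
       (0\<^sub>m ((k-1) * m) n @\<^sub>r const_pm (- (C * S)))
       (four_block_mat (block_transpose m (mD_Phi al be ga m k D))
                       (kron (transpose_mat (M_Phi al be ga k)) (1\<^sub>m m))
                       (0\<^sub>m 0 m) (0\<^sub>m 0 ((k-1) * m)))
   * four_block_mat (1\<^sub>m n) (0\<^sub>m n (k * m)) (0\<^sub>m (k * m) n) (const_pm (WJ m w J))"

definition right_null :: "'b::field mat \<Rightarrow> 'b vec set" where
  "right_null X = {x. x \<in> carrier_vec (dim_col X) \<and> X *\<^sub>v x = 0\<^sub>v (dim_row X)}"

definition left_null :: "'b::field mat \<Rightarrow> 'b vec set" where
  "left_null X = {x. x \<in> carrier_vec (dim_row X) \<and> transpose_mat X *\<^sub>v x = 0\<^sub>v (dim_col X)}"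

definition poly_basis_of :: "nat \<Rightarrow> 'a::field poly fract vec set \<Rightarrow> 'a poly mat \<Rightarrow> bool" where
  "poly_basis_of p V H \<longleftrightarrow> dim_row H = p \<and>
     (\<forall>j < dim_col H. col (rat_pm H) j \<in> V) \<and>
     (\<forall>c \<in> carrier_vec (dim_col H). rat_pm H *\<^sub>v c = 0\<^sub>v p \<longrightarrow> c = 0\<^sub>v (dim_col H)) \<and>
     (\<forall>x \<in> V. \<exists>c \<in> carrier_vec (dim_col H). x = rat_pm H *\<^sub>v c)"

definition col_degree :: "'a::zero poly mat \<Rightarrow> nat \<Rightarrow> nat" where
  "col_degree H j = Max (insert 0 {degree (H $$ (i,j)) | i. i < dim_row H})"

definition col_degrees :: "'a::zero poly mat \<Rightarrow> nat list" where
  "col_degrees H = map (col_degree H) [0..<dim_col H]"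

definition total_degree :: "'a::zero poly mat \<Rightarrow> nat" where
  "total_degree H = sum_list (col_degrees H)"

definition minimal_basis_of :: "nat \<Rightarrow> 'a::field poly fract vec set \<Rightarrow> 'a poly mat \<Rightarrow> bool" where
  "minimal_basis_of p V H \<longleftrightarrow> poly_basis_of p V H \<and>
     (\<forall>H'. poly_basis_of p V H' \<longrightarrow> total_degree H \<le> total_degree H')"

definition right_minimal_basis :: "'a::field poly fract mat \<Rightarrow> 'a poly mat \<Rightarrow> bool" where
  "right_minimal_basis X H \<longleftrightarrow> minimal_basis_of (dim_col X) (right_null X) H"

definition left_minimal_basis :: "'a::field poly fract mat \<Rightarrow> 'a poly mat \<Rightarrow> bool" where
  "left_minimal_basis X H \<longleftrightarrow> minimal_basis_of (dim_row X) (left_null X) H"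

definition right_minimal_indices :: "'a::field poly fract mat \<Rightarrow> nat list \<Rightarrow> bool" where
  "right_minimal_indices X es \<longleftrightarrow> (\<exists>H. right_minimal_basis X H \<and> sort (col_degrees H) = es)"

definition left_minimal_indices :: "'a::field poly fract mat \<Rightarrow> nat list \<Rightarrow> bool" where
  "left_minimal_indices X es \<longleftrightarrow> (\<exists>H. left_minimal_basis X H \<and> sort (col_degrees H) = es)"

end

theory Submission
  imports Defs
begin

text \<open>A vector of the right null space of the linearization is determined by its component
  $y = (w^T \otimes I) x_2$, which runs through the right null space of $G$; on the left the last block plays
  this role. The point is that these isomorphisms respect polynomial vectors and shift their degree by a
  constant. Polynomiality of the state component $(\lambda I - A)^{-1} B y$ follows from minimality: its
  strictly proper part is $(\lambda I - A)^{-1} r$ with $r$ constant and $C (\lambda I - A)^{-1} r = 0$, and a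
  nonzero such $r$ could be split off the state space. For the degrees, the remaining components solve
  equations $(\lambda I - K) z = g$ with $g$ of degree at most that of $y$, so $z$ has no larger degree; on the
  left the components are the multiples $\phi_j y$, which gives the shift $k - 1$. Since all bases of a null
  space have the same number of elements, minimality of the total degree is carried over.\<close>

section \<open>Polynomial and rational matrices\<close>

text \<open>The obstacle is the degree bound on the right. The explicit lift of y contains
  \<open>Q\<close> and \<open>mD_Phi\<close>, and the degrees in \<open>Q\<close> grow with k, so
  multiplying out gives far too weak a bound. Instead z = Nhat mB y is characterized by Mtp z + (e_k
  \<otimes> I) D y = mB y. Without its first block row this is a pencil lambda I - K applied to z,
  and its right-hand side is harmless as soon as D y has degree at most that of y. For general y
  this fails, since D raises degrees; it holds here because G y = 0 forces D y = - C u, where u =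
  (lambda I - A)^{-1} B y is polynomial and of degree at most that of y. Hence the state component
  is settled before z. The reverse bound holds because y arises from x_2 by a constant matrix. Both
  null spaces rest on one unimodular matrix: M_Phi over e_k^T has the inverse [Q Phi], with Phi the
  column of basis polynomials. Transposed, it splits the lower block row into a part that determines
  the remaining unknowns and a part that says G y = 0. On the left, everything is a right null space
  of a transpose, and the dual realization (A^T, C^T, B^T) is again minimal.\<close>

interpretation ratf: inj_comm_ring_hom "ratf :: 'a::field poly \<Rightarrow> 'a poly fract"
  by unfold_locales (auto simp: ratf_def Zero_fract_def One_fract_def eq_fract)

interpretation poly_const: inj_comm_ring_hom "\<lambda>a::'a::field. [:a:]"
  by unfold_locales auto

abbreviation rat_vec :: "'a::field poly vec \<Rightarrow> 'a poly fract vec" where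
  "rat_vec \<equiv> map_vec ratf"

lemma rat_pm_dim [simp]: "dim_row (rat_pm X) = dim_row X" "dim_col (rat_pm X) = dim_col X"
  by (auto simp: rat_pm_def)

lemma const_pm_dim [simp]: "dim_row (const_pm X) = dim_row X" "dim_col (const_pm X) = dim_col X"
  by (auto simp: const_pm_def)

lemma rat_cm_dim [simp]: "dim_row (rat_cm X) = dim_row X" "dim_col (rat_cm X) = dim_col X"
  by (auto simp: rat_cm_def)

lemma rat_pm_carrier [simp]: "rat_pm X \<in> carrier_mat a b \<longleftrightarrow> X \<in> carrier_mat a b"
  by (metis carrier_matD carrier_matI rat_pm_dim)

lemma const_pm_carrier [simp]: "const_pm X \<in> carrier_mat a b \<longleftrightarrow> X \<in> carrier_mat a b"
  by (metis carrier_matD carrier_matI const_pm_dim)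

lemma rat_cm_carrier [simp]: "rat_cm X \<in> carrier_mat a b \<longleftrightarrow> X \<in> carrier_mat a b"
  by (metis carrier_matD carrier_matI rat_cm_dim)

lemma rat_pm_index [simp]: "i < dim_row X \<Longrightarrow> j < dim_col X \<Longrightarrow> rat_pm X $$ (i,j) = ratf (X $$ (i,j))"
  by (auto simp: rat_pm_def)

lemma const_pm_index [simp]: "i < dim_row X \<Longrightarrow> j < dim_col X \<Longrightarrow> const_pm X $$ (i,j) = [:X $$ (i,j):]"
  by (auto simp: const_pm_def)

lemma rat_cm_index [simp]:
  "i < dim_row X \<Longrightarrow> j < dim_col X \<Longrightarrow> rat_cm X $$ (i,j) = ratf [:X $$ (i,j):]"
  by (auto simp: rat_cm_def)

lemma rat_pm_mult:
  "X \<in> carrier_mat a b \<Longrightarrow> Y \<in> carrier_mat b c \<Longrightarrow> rat_pm (X * Y) = rat_pm X * rat_pm Y"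
  unfolding rat_pm_def by (rule ratf.mat_hom_mult)

lemma const_pm_mult:
  "X \<in> carrier_mat a b \<Longrightarrow> Y \<in> carrier_mat b c \<Longrightarrow> const_pm (X * Y) = const_pm X * const_pm Y"
  unfolding const_pm_def by (rule poly_const.mat_hom_mult)

lemma rat_cm_mult:
  "X \<in> carrier_mat a b \<Longrightarrow> Y \<in> carrier_mat b c \<Longrightarrow> rat_cm (X * Y) = rat_cm X * rat_cm Y"
  unfolding rat_cm_def by (subst const_pm_mult, auto intro!: rat_pm_mult)

lemma rat_pm_mult_vec:
  "X \<in> carrier_mat a b \<Longrightarrow> v \<in> carrier_vec b \<Longrightarrow> rat_vec (X *\<^sub>v v) = rat_pm X *\<^sub>v rat_vec v"
  unfolding rat_pm_def by (rule ratf.mult_mat_vec_hom)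

lemma rat_pm_inj: "rat_pm X = rat_pm Y \<longleftrightarrow> X = Y"
proof
  assume eq: "rat_pm X = rat_pm Y"
  then have d: "dim_row X = dim_row Y" "dim_col X = dim_col Y"
    by (metis rat_pm_dim(1), metis rat_pm_dim(2))
  have "X $$ (i,j) = Y $$ (i,j)" if "i < dim_row Y" "j < dim_col Y" for i j
    using arg_cong[OF eq, of "\<lambda>Z. Z $$ (i,j)"] that d by auto
  with d show "X = Y" by (intro eq_matI) auto
qed simp

lemma rat_vec_inj: "rat_vec v = rat_vec u \<longleftrightarrow> v = u"
  by (metis ratf.vec_hom_inj)

lemma rat_vec_zero [simp]: "rat_vec (0\<^sub>v a) = 0\<^sub>v a"
  by (rule ratf.vec_hom_zero)

lemma rat_vec_eq_zero: "rat_vec v = 0\<^sub>v a \<longleftrightarrow> v = 0\<^sub>v a"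
  using rat_vec_inj[of v "0\<^sub>v a"] by simp

lemma rat_pm_one [simp]: "rat_pm (1\<^sub>m a) = 1\<^sub>m a"
  unfolding rat_pm_def by (rule ratf.mat_hom_one)

lemma rat_cm_one [simp]: "rat_cm (1\<^sub>m a) = 1\<^sub>m a"
  by (rule eq_matI) auto

lemma rat_pm_zero [simp]: "rat_pm (0\<^sub>m a b) = 0\<^sub>m a b"
  by (rule eq_matI) auto

lemma rat_cm_zero [simp]: "rat_cm (0\<^sub>m a b) = 0\<^sub>m a b"
  by (rule eq_matI) auto

lemma rat_pm_transpose: "rat_pm (transpose_mat X) = transpose_mat (rat_pm X)"
  by (rule eq_matI) auto

lemma rat_cm_transpose: "rat_cm (transpose_mat X) = transpose_mat (rat_cm X)"
  by (rule eq_matI) auto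

lemma rat_pm_append_rows:
  "X \<in> carrier_mat a c \<Longrightarrow> Y \<in> carrier_mat b c \<Longrightarrow> rat_pm (X @\<^sub>r Y) = rat_pm X @\<^sub>r rat_pm Y"
  by (rule eq_matI) (auto simp: append_rows_def)

lemma rat_cm_append_rows:
  "X \<in> carrier_mat a c \<Longrightarrow> Y \<in> carrier_mat b c \<Longrightarrow> rat_cm (X @\<^sub>r Y) = rat_cm X @\<^sub>r rat_cm Y"
  by (rule eq_matI) (auto simp: append_rows_def)

lemma rat_vec_append: "rat_vec (u @\<^sub>v v) = rat_vec u @\<^sub>v rat_vec v"
  by (rule eq_vecI) auto

lemma col_rat_pm: "j < dim_col X \<Longrightarrow> col (rat_pm X) j = rat_vec (col X j)"
  by (rule eq_vecI) auto

lemma det_rat_pm: "det (rat_pm X) = ratf (det X)"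
  unfolding rat_pm_def by (rule ratf.hom_det)

lemma append_rows_mult_vec:
  assumes "X \<in> carrier_mat a c" "Y \<in> carrier_mat b c" "v \<in> carrier_vec c"
  shows "(X @\<^sub>r Y) *\<^sub>v v = X *\<^sub>v v @\<^sub>v Y *\<^sub>v v"
  by (rule mat_mult_append[OF assms])

lemma append_rows_mult:
  assumes "X \<in> carrier_mat a c" "Y \<in> carrier_mat b c" "Z \<in> carrier_mat c d"
  shows "(X @\<^sub>r Y) * Z = X * Z @\<^sub>r Y * Z"
proof -
  \<comment> \<open>A vertical stack is a four-block matrix with two blocks of width zero, so the
    four-block product rule applies.\<close>
  have "four_block_mat X (0\<^sub>m a 0) Y (0\<^sub>m b 0) * four_block_mat Z (0\<^sub>m c 0) (0\<^sub>m 0 d) (0\<^sub>m 0 0)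
    = four_block_mat (X * Z) (0\<^sub>m a 0) (Y * Z) (0\<^sub>m b 0)"
    using assms by (subst mult_four_block_mat[OF assms(1) _ assms(2) _ assms(3)]) auto
  moreover have "four_block_mat Z (0\<^sub>m c 0) (0\<^sub>m 0 d) (0\<^sub>m 0 0) = Z"
    using assms by (intro eq_matI) auto
  ultimately show ?thesis using assms by (simp add: append_rows_def)
qed

lemma append_rows_eq:
  assumes "X \<in> carrier_mat a c" "X' \<in> carrier_mat a c" "Y \<in> carrier_mat b c" "Y' \<in> carrier_mat b c"
  shows "X @\<^sub>r Y = X' @\<^sub>r Y' \<longleftrightarrow> X = X' \<and> Y = Y'"
proof
  assume eq: "X @\<^sub>r Y = X' @\<^sub>r Y'"
  have "X $$ (i,j) = X' $$ (i,j)" if "i < a" "j < c" for i j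
    using arg_cong[OF eq, of "\<lambda>Z. Z $$ (i,j)"] that assms by (auto simp: append_rows_def)
  moreover have "Y $$ (i,j) = Y' $$ (i,j)" if "i < b" "j < c" for i j
    using arg_cong[OF eq, of "\<lambda>Z. Z $$ (a+i,j)"] that assms by (auto simp: append_rows_def)
  ultimately show "X = X' \<and> Y = Y'" using assms by (auto intro!: eq_matI)
qed simp

lemma beside_mult_vec:
  assumes "X \<in> carrier_mat a b" "Y \<in> carrier_mat a c" "u \<in> carrier_vec b" "v \<in> carrier_vec c"
  shows "four_block_mat X Y (0\<^sub>m 0 b) (0\<^sub>m 0 c) *\<^sub>v (u @\<^sub>v v) = X *\<^sub>v u + Y *\<^sub>v v"
  using four_block_mat_mult_vec[OF assms(1,2) _ _ assms(3,4), of "0\<^sub>m 0 b" 0 "0\<^sub>m 0 c"] assms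
  by (auto intro!: eq_vecI)

section \<open>Inverses, determinants and unimodular matrices\<close>

lemma inverse_unique_mat:
  assumes "X \<in> carrier_mat a a" "Y \<in> carrier_mat a a" "Z \<in> carrier_mat a a"
    "X * Y = 1\<^sub>m a" "Z * X = 1\<^sub>m a"
  shows "Y = (Z :: 'b::semiring_1 mat)"
proof -
  have "Y = (Z * X) * Y" using assms by simp
  also have "\<dots> = Z * (X * Y)" using assms by (intro assoc_mult_mat)
  finally show ?thesis using assms by simp
qed

text \<open>\<open>minv\<close> unwraps an option returned by Gauss-Jordan elimination and means the
  inverse only where that succeeds; a nonzero determinant is the guarantee used throughout.\<close>

lemma minv_det:
  assumes X: "X \<in> carrier_mat a a" and d: "det X \<noteq> (0::'b::field)"
  shows "minv X \<in> carrier_mat a a" "X * minv X = 1\<^sub>m a" "minv X * X = 1\<^sub>m a"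
proof -
  \<comment> \<open>The \<open>()\<close> fills the extension field of the record that represents
    the matrix ring.\<close>
  from det_non_zero_imp_unit[OF X d, of "()"] mat_inverse(1)[OF X, of "()"]
  obtain Y where "mat_inverse X = Some Y" by (cases "mat_inverse X") auto
  with mat_inverse(2)[OF X this]
  show "minv X \<in> carrier_mat a a" "X * minv X = 1\<^sub>m a" "minv X * X = 1\<^sub>m a"
    by (auto simp: minv_def)
qed

lemma det_nonzeroI:
  assumes "X \<in> carrier_mat a a" "Y \<in> carrier_mat a a" "X * Y = 1\<^sub>m a"
  shows "det X \<noteq> (0::'b::field)"
  using det_mult[OF assms(1,2)] assms(3) by auto

lemma minv_eqI:
  assumes "X \<in> carrier_mat a a" "Y \<in> carrier_mat a a" "X * Y = 1\<^sub>m a"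
  shows "minv X = (Y :: 'b::field mat)"
proof -
  have d: "det X \<noteq> 0" by (rule det_nonzeroI[OF assms])
  show ?thesis using inverse_unique_mat[OF assms(1,2) minv_det(1)[OF assms(1) d] assms(3)]
      minv_det(3)[OF assms(1) d] by simp
qed

lemma invertible_det:
  assumes "X \<in> carrier_mat a a" "invertible_mat X"
  shows "det X \<noteq> (0::'b::field)"
proof -
  from assms obtain Y where Y: "X * Y = 1\<^sub>m (dim_row X)" "Y * X = 1\<^sub>m (dim_row Y)"
    by (auto simp: invertible_mat_def inverts_mat_def)
  have "Y \<in> carrier_mat a a"
    using assms(1) arg_cong[OF Y(1), of dim_col] arg_cong[OF Y(2), of dim_col] by auto
  then show ?thesis using det_nonzeroI[OF assms(1), of Y] Y assms(1) by auto
qed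

lemma minv_transpose:
  assumes X: "X \<in> carrier_mat a a" and d: "det X \<noteq> (0::'b::field)"
  shows "minv (transpose_mat X) = transpose_mat (minv X)"
proof (rule minv_eqI)
  show "transpose_mat X * transpose_mat (minv X) = 1\<^sub>m a"
    using transpose_mult[OF minv_det(1)[OF X d] X] minv_det(3)[OF X d] by simp
qed (use X minv_det(1)[OF X d] in auto)

lemma minv_rat_cm:
  assumes X: "X \<in> carrier_mat a a" and d: "det X \<noteq> 0"
  shows "minv (rat_cm X) = rat_cm (minv X)"
  by (rule minv_eqI[of _ a])
    (use X minv_det[OF X d] in \<open>auto simp: rat_cm_mult[symmetric]\<close>)

text \<open>The adjugate is polynomial, and dividing it by a nonzero constant determinant leaves it
  polynomial. This is how \<open>Q\<close> is seen to have polynomial entries.\<close>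

lemma minv_rat_pm_unimodular:
  assumes X: "X \<in> carrier_mat a a" and d: "det X = [:d:]" "d \<noteq> 0"
  shows "\<exists>Y \<in> carrier_mat a a. minv (rat_pm X) = rat_pm Y"
proof
  show Y: "[:1/d:] \<cdot>\<^sub>m adj_mat X \<in> carrier_mat a a" using adj_mat(1)[OF X] by auto
  have "X * ([:1/d:] \<cdot>\<^sub>m adj_mat X) = [:1/d:] \<cdot>\<^sub>m (X * adj_mat X)"
    using X adj_mat(1)[OF X] by (rule mult_smult_distrib)
  also have "\<dots> = 1\<^sub>m a" using d unfolding adj_mat(2)[OF X] by (auto intro!: eq_matI)
  finally show "minv (rat_pm X) = rat_pm ([:1/d:] \<cdot>\<^sub>m adj_mat X)"
    using X Y by (intro minv_eqI[of _ a]) (auto simp: rat_pm_mult[OF X Y, symmetric])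
qed

text \<open>Same convention as \<open>col_degree\<close>. The zero vector gets degree 0, like a
  nonzero constant one, which is why a degree shift can later be claimed for nonzero vectors
  only.\<close>

definition vec_degree :: "'a::zero poly vec \<Rightarrow> nat" where
  "vec_degree v = Max (insert 0 {degree (v $ i) | i. i < dim_vec v})"

lemma vec_degree_le_iff: "vec_degree v \<le> d \<longleftrightarrow> (\<forall>i < dim_vec v. degree (v $ i) \<le> d)"
  unfolding vec_degree_def by (subst Max_le_iff) auto

lemma degree_le_vec_degree: "i < dim_vec v \<Longrightarrow> degree (v $ i) \<le> vec_degree v"
  using vec_degree_le_iff by blast

lemma col_degree_vec: "j < dim_col H \<Longrightarrow> col_degree H j = vec_degree (col H j)"
proof -
  assume "j < dim_col H"
  then have "(\<lambda>i. degree (H $$ (i,j))) ` {i. i < dim_row H}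
      = (\<lambda>i. degree (col H j $ i)) ` {i. i < dim_vec (col H j)}"
    by (intro image_cong) auto
  then show ?thesis by (simp only: image_Collect col_degree_def vec_degree_def)
qed

lemma vec_degree_append_le_iff:
  "vec_degree (u @\<^sub>v v) \<le> d \<longleftrightarrow> vec_degree u \<le> d \<and> vec_degree v \<le> d"
proof -
  have "(\<forall>i < dim_vec u + dim_vec v. degree ((u @\<^sub>v v) $ i) \<le> d) \<longleftrightarrow>
     (\<forall>i < dim_vec u. degree (u $ i) \<le> d) \<and> (\<forall>i < dim_vec v. degree (v $ i) \<le> d)" (is "?l \<longleftrightarrow> ?r")
  proof
    assume l: ?l
    have "degree (u $ i) \<le> d" if "i < dim_vec u" for i using l[rule_format, of i] that by auto
    moreover have "degree (v $ i) \<le> d" if "i < dim_vec v" for i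
      using l[rule_format, of "dim_vec u + i"] that by auto
    ultimately show ?r by blast
  qed auto
  then show ?thesis by (simp add: vec_degree_le_iff)
qed

lemma vec_degree_const_mult:
  assumes "X \<in> carrier_mat a b" "v \<in> carrier_vec b"
  shows "vec_degree (const_pm X *\<^sub>v v) \<le> vec_degree v"
  unfolding vec_degree_le_iff
proof (intro allI impI)
  fix i assume "i < dim_vec (const_pm X *\<^sub>v v)"
  then have i: "i < a" using assms by auto
  have "degree (\<Sum>j = 0..<b. [:X $$ (i,j):] * v $ j) \<le> vec_degree v"
    using assms by (intro degree_sum_le) (auto intro!: degree_le_vec_degree order_trans[OF degree_smult_le])
  then show "degree ((const_pm X *\<^sub>v v) $ i) \<le> vec_degree v"
    using i assms by (auto simp: scalar_prod_def)
qed

text \<open>Comparing coefficients from the top: the leading term of an unknown is visible in its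
  own equation because the diagonal entries are monic of degree one.\<close>
lemma vec_degree_pencil:
  fixes Z :: "'a::field poly mat"
  assumes Z: "Z \<in> carrier_mat a a" and x: "x \<in> carrier_vec a"
    and lin: "\<And>i j. i < a \<Longrightarrow> j < a \<Longrightarrow> Z $$ (i,j) = (if i = j then [:0,1:] else 0) + [:c i j:]"
  shows "vec_degree x \<le> vec_degree (Z *\<^sub>v x)"
proof -
  define d where "d = vec_degree (Z *\<^sub>v x)"
  have step: "coeff (x $ i) N = - (\<Sum>j = 0..<a. c i j * coeff (x $ j) (Suc N))"
    if "d < Suc N" "i < a" for N i
  proof -
    have "(Z *\<^sub>v x) $ i = (\<Sum>j = 0..<a. ((if i = j then [:0,1:] else 0) + [:c i j:]) * x $ j)"
      using Z x that(2) by (auto simp: scalar_prod_def lin intro!: sum.cong)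
    also have "\<dots> = (\<Sum>j = 0..<a. (if i = j then [:0,1:] * x $ j else 0)) + (\<Sum>j = 0..<a. [:c i j:] * x $ j)"
      unfolding sum.distrib[symmetric] by (rule sum.cong) (auto simp: algebra_simps)
    also have "(\<Sum>j = 0..<a. (if i = j then [:0,1:] * x $ j else 0)) = pCons 0 (x $ i)"
      using that(2) by (subst sum.delta') auto
    finally have "coeff ((Z *\<^sub>v x) $ i) (Suc N) = coeff (x $ i) N + (\<Sum>j = 0..<a. c i j * coeff (x $ j) (Suc N))"
      by (simp add: coeff_sum)
    moreover have "coeff ((Z *\<^sub>v x) $ i) (Suc N) = 0"
      using degree_le_vec_degree[of i "Z *\<^sub>v x"] that Z unfolding d_def by (intro coeff_eq_0) auto
    ultimately show ?thesis by (simp add: eq_neg_iff_add_eq_0)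
  qed
  have "coeff (x $ i) N = 0" if "d < N" "i < a" for i N
  proof (cases "N \<le> Suc (vec_degree x)")
    case True
    then show ?thesis using that
    \<comment> \<open>Downward induction from just above the degree of \<open>x\<close>, where all
      coefficients vanish: each coefficient \<open>N\<close> is a combination of coefficients
      \<open>Suc N\<close>, already known to be zero.\<close>
    proof (induction arbitrary: i rule: inc_induct)
      case base
      then show ?case using degree_le_vec_degree[of i x] x by (intro coeff_eq_0) auto
    next
      case (step N)
      then show ?case using \<open>\<And>N i. d < Suc N \<Longrightarrow> i < a \<Longrightarrow> _\<close>[of N i] by auto
    qed
  next
    case False
    then show ?thesis using degree_le_vec_degree[of i x] x that by (intro coeff_eq_0) auto
  qed
  then show ?thesis
    using x unfolding vec_degree_le_iff d_def[symmetric] by (auto intro!: degree_le)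
qed

lemma lamI_minus_index:
  "A \<in> carrier_mat a a \<Longrightarrow> i < a \<Longrightarrow> j < a \<Longrightarrow>
     lamI_minus A $$ (i,j) = (if i = j then [:0,1:] else 0) + [:- A $$ (i,j):]"
  by (auto simp: lamI_minus_def char_poly_matrix_def)

lemma lamI_minus_carrier [simp]: "A \<in> carrier_mat a a \<Longrightarrow> lamI_minus A \<in> carrier_mat a a"
  by (auto simp: lamI_minus_def)

lemma vec_degree_lamI_minus:
  assumes "A \<in> carrier_mat a a" "x \<in> carrier_vec a"
  shows "vec_degree x \<le> vec_degree (lamI_minus A *\<^sub>v x)"
  by (rule vec_degree_pencil[OF _ assms(2), of _ "\<lambda>i j. - A $$ (i,j)"]) (use assms(1) in \<open>auto simp: lamI_minus_index\<close>)

lemma det_lamI_minus: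
  assumes "A \<in> carrier_mat a a" shows "det (rat_pm (lamI_minus A)) \<noteq> 0"
proof -
  have "det (lamI_minus A) \<noteq> 0"
    using degree_monic_char_poly[OF assms] unfolding char_poly_def lamI_minus_def by auto
  then show ?thesis by (simp add: det_rat_pm)
qed

lemma lamI_minus_transpose:
  "A \<in> carrier_mat a a \<Longrightarrow> lamI_minus (transpose_mat A) = transpose_mat (lamI_minus A)"
  by (rule eq_matI) (auto simp: lamI_minus_def char_poly_matrix_def)

section \<open>Transfer of minimal bases\<close>

lemma zero_mat_mult_vec:
  "v \<in> carrier_vec b \<Longrightarrow> 0\<^sub>m a b *\<^sub>v v = (0\<^sub>v a :: 'b::semiring_0 vec)"
  by (rule eq_vecI) (auto simp: scalar_prod_def)

lemma mat_mult_zero_vec: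
  "X \<in> carrier_mat a b \<Longrightarrow> X *\<^sub>v 0\<^sub>v b = (0\<^sub>v a :: 'b::semiring_0 vec)"
  by (rule eq_vecI) (auto simp: scalar_prod_def)

lemma mat_mult_smult_vec:
  "X \<in> carrier_mat a b \<Longrightarrow> v \<in> carrier_vec b \<Longrightarrow> X *\<^sub>v (c \<cdot>\<^sub>v v) = c \<cdot>\<^sub>v (X *\<^sub>v v :: 'b::comm_ring_1 vec)"
  by (rule eq_vecI) auto

lemma smult_mat_mult_vec:
  "X \<in> carrier_mat a b \<Longrightarrow> v \<in> carrier_vec b \<Longrightarrow> (c \<cdot>\<^sub>m X) *\<^sub>v v = c \<cdot>\<^sub>v (X *\<^sub>v v :: 'b::comm_ring_1 vec)"
  by (rule eq_vecI) auto

lemma right_null_carrier: "x \<in> right_null X \<Longrightarrow> x \<in> carrier_vec (dim_col X)"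
  by (auto simp: right_null_def)

lemma left_null_eq: "left_null X = right_null (transpose_mat X)"
  by (auto simp: left_null_def right_null_def)

text \<open>Reduces all left statements to right null spaces, so that the transfer of bases is
  proved only once.\<close>

lemma left_minimal_basis_eq: "left_minimal_basis X H = right_minimal_basis (transpose_mat X) H"
  by (simp add: left_minimal_basis_def right_minimal_basis_def left_null_eq)

lemma right_null_mult_vec:
  assumes K: "K \<in> carrier_mat (dim_col X) l" and col: "\<And>j. j < l \<Longrightarrow> col K j \<in> right_null X"
    and c: "c \<in> carrier_vec l"
  shows "K *\<^sub>v c \<in> right_null X"
proof -
  have "X * K = 0\<^sub>m (dim_row X) l"
  proof (rule eq_matI)
    fix i j assume ij: "i < dim_row (0\<^sub>m (dim_row X) l)" "j < dim_col (0\<^sub>m (dim_row X) l)"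
    then have "X *\<^sub>v col K j = 0\<^sub>v (dim_row X)" using col[of j] by (auto simp: right_null_def)
    from arg_cong[OF this, of "\<lambda>v. v $ i"] ij K
    show "(X * K) $$ (i,j) = 0\<^sub>m (dim_row X) l $$ (i,j)" by auto
  qed (use K in auto)
  then have "X *\<^sub>v (K *\<^sub>v c) = 0\<^sub>v (dim_row X)"
    using assoc_mult_mat_vec[of X "dim_row X" "dim_col X" K l c] K c
      zero_mat_mult_vec[OF c, of "dim_row X"] by auto
  then show ?thesis using K c by (auto simp: right_null_def)
qed

section \<open>The number of elements of a basis\<close>

lemma wide_matrix_kernel:
  fixes M :: "'b::field mat"
  assumes M: "M \<in> carrier_mat a b" and ab: "a < b"
  shows "\<exists>c \<in> carrier_vec b. c \<noteq> 0\<^sub>v b \<and> M *\<^sub>v c = 0\<^sub>v a"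
proof -
  \<comment> \<open>Padding with zero rows makes the matrix square. Its last row is zero, so no
    inverse can produce the 1 in the last diagonal position, and the determinant vanishes.\<close>
  let ?N = "M @\<^sub>r 0\<^sub>m (b - a) b"
  have N: "?N \<in> carrier_mat b b" using carrier_append_rows[OF M, of "0\<^sub>m (b-a) b" "b-a"] ab by simp
  have "row ?N (b - 1) = 0\<^sub>v b"
    using M ab by (intro eq_vecI) (auto simp: append_rows_def)
  then have "(?N * minv ?N) $$ (b - 1, b - 1) = 0" if "det ?N \<noteq> 0"
  proof -
    have "col (minv ?N) (b - 1) \<in> carrier_vec b" using minv_det(1)[OF N that] by (intro carrier_vecI) simp
    then show ?thesis using \<open>row ?N (b - 1) = _\<close> N minv_det(1)[OF N that] ab by simp
  qed
  then have "det ?N = 0"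
    using minv_det(2)[OF N] ab by auto
  then obtain c where c: "c \<in> carrier_vec b" "c \<noteq> 0\<^sub>v b" "?N *\<^sub>v c = 0\<^sub>v b"
    using det_0_iff_vec_prod_zero_field[OF N] by auto
  have "M *\<^sub>v c @\<^sub>v 0\<^sub>m (b - a) b *\<^sub>v c = 0\<^sub>v a @\<^sub>v 0\<^sub>v (b - a)"
  proof -
    have "0\<^sub>v a @\<^sub>v 0\<^sub>v (b - a) = (0\<^sub>v b :: 'b vec)" using ab by (intro eq_vecI) auto
    then show ?thesis using append_rows_mult_vec[OF M, of "0\<^sub>m (b-a) b" "b-a" c] c by simp
  qed
  then have "M *\<^sub>v c = 0\<^sub>v a" using append_vec_eq[OF mult_mat_vec_carrier[OF M c(1)] zero_carrier_vec[of a]] by blast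
  with c show ?thesis by blast
qed

lemma poly_basis_carrier: "poly_basis_of p V H \<Longrightarrow> rat_pm H \<in> carrier_mat p (dim_col H)"
  unfolding poly_basis_of_def by (intro carrier_matI) simp_all

text \<open>Exchange argument: the columns of \<open>H\<close> are combinations of those of
  \<open>H'\<close>, and with more columns than \<open>H'\<close> the coefficient matrix would have
  a kernel vector, a dependence in \<open>H\<close>. Equal size matters because the total degree
  shifts by a constant per column.\<close>

lemma poly_basis_dim_le:
  assumes H: "poly_basis_of p V H" and H': "poly_basis_of p V H'"
  shows "dim_col H \<le> dim_col H'"
proof (rule ccontr)
  assume "\<not> ?thesis"
  then have lt: "dim_col H' < dim_col H" by simp
  have "\<forall>j. j < dim_col H \<longrightarrow> (\<exists>c. c \<in> carrier_vec (dim_col H') \<and> col (rat_pm H) j = rat_pm H' *\<^sub>v c)"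
    using H H' by (fastforce simp: poly_basis_of_def)
  then obtain f where f: "\<And>j. j < dim_col H \<Longrightarrow> f j \<in> carrier_vec (dim_col H')"
    "\<And>j. j < dim_col H \<Longrightarrow> col (rat_pm H) j = rat_pm H' *\<^sub>v f j" by metis
  define M where "M = mat (dim_col H') (dim_col H) (\<lambda>(i,j). f j $ i)"
  have M: "M \<in> carrier_mat (dim_col H') (dim_col H)" by (simp add: M_def)
  have dims: "dim_row H = p" "dim_row H' = p" using H H' by (auto simp: poly_basis_of_def)
  have colM: "col M j = f j" if "j < dim_col H" for j
    using that f(1)[OF that] by (intro eq_vecI) (auto simp: M_def)
  have eq: "rat_pm H = rat_pm H' * M"
  proof (rule eq_matI)
    fix i j assume "i < dim_row (rat_pm H' * M)" "j < dim_col (rat_pm H' * M)"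
    then have ij: "i < p" "j < dim_col H" using dims M by auto
    from arg_cong[OF f(2)[OF ij(2)], of "\<lambda>v. v $ i"] ij dims colM[OF ij(2)] M
    show "rat_pm H $$ (i,j) = (rat_pm H' * M) $$ (i,j)" by auto
  qed (use dims M in auto)
  from wide_matrix_kernel[OF M lt] obtain c where c: "c \<in> carrier_vec (dim_col H)"
    "c \<noteq> 0\<^sub>v (dim_col H)" "M *\<^sub>v c = 0\<^sub>v (dim_col H')" by blast
  have "rat_pm H *\<^sub>v c = rat_pm H' *\<^sub>v (M *\<^sub>v c)"
    unfolding eq by (rule assoc_mult_mat_vec[OF poly_basis_carrier[OF H'] M c(1)])
  also have "\<dots> = 0\<^sub>v p" using mat_mult_zero_vec[OF poly_basis_carrier[OF H']] unfolding c(3) .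
  finally show False using H c unfolding poly_basis_of_def by blast
qed

lemma poly_basis_dim_eq:
  "poly_basis_of p V H \<Longrightarrow> poly_basis_of p V H' \<Longrightarrow> dim_col H = dim_col H'"
  using poly_basis_dim_le by (metis order_antisym)

lemma poly_basis_col_nonzero:
  assumes H: "poly_basis_of p V H" and j: "j < dim_col H"
  shows "col H j \<noteq> 0\<^sub>v p"
proof
  assume "col H j = 0\<^sub>v p"
  then have "rat_pm H *\<^sub>v unit_vec (dim_col H) j = 0\<^sub>v p"
    using col_mult2[OF poly_basis_carrier[OF H] one_carrier_mat j] col_rat_pm[OF j] j
      right_mult_one_mat[OF poly_basis_carrier[OF H]] by simp
  then have "unit_vec (dim_col H) j = (0\<^sub>v (dim_col H) :: 'a poly fract vec)"
    using H by (auto simp: poly_basis_of_def)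
  then show False using j by (metis index_unit_vec(1) index_zero_vec(1) zero_neq_one)
qed

text \<open>\<open>E\<close> and \<open>P\<close> are inverse to each other on the null spaces, so
  independence and spanning transfer by linear algebra over the rational functions; that the image
  is again polynomial is the separate hypothesis \<open>poly\<close>. The form is symmetric enough
  to be used with \<open>E\<close> and \<open>P\<close> exchanged.\<close>

lemma poly_basis_map:
  fixes X Y E P :: "'a::field poly fract mat"
  assumes dim: "dim_col X = p" "dim_col Y = q" "E \<in> carrier_mat q p" "P \<in> carrier_mat p q"
    and E_null: "\<And>x. x \<in> right_null X \<Longrightarrow> E *\<^sub>v x \<in> right_null Y"
    and P_null: "\<And>y. y \<in> right_null Y \<Longrightarrow> P *\<^sub>v y \<in> right_null X"
    and PE: "\<And>x. x \<in> right_null X \<Longrightarrow> P *\<^sub>v (E *\<^sub>v x) = x"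
    and EP: "\<And>y. y \<in> right_null Y \<Longrightarrow> E *\<^sub>v (P *\<^sub>v y) = y"
    and poly: "\<And>h. rat_vec h \<in> right_null X \<Longrightarrow> \<exists>g. rat_vec g = E *\<^sub>v rat_vec h"
    and H: "poly_basis_of p (right_null X) H"
  shows "\<exists>H'. rat_pm H' = E * rat_pm H \<and> poly_basis_of q (right_null Y) H'"
proof -
  let ?l = "dim_col H"
  have Hc: "rat_pm H \<in> carrier_mat p ?l" by (rule poly_basis_carrier[OF H])
  have colH: "rat_vec (col H j) \<in> right_null X" "col (rat_pm H) j \<in> right_null X" if "j < ?l" for j
    using H that col_rat_pm[OF that] by (auto simp: poly_basis_of_def)
  then have "\<forall>j. j < ?l \<longrightarrow> (\<exists>g. rat_vec g = E *\<^sub>v rat_vec (col H j))" using poly by blast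
  then obtain f where f: "\<And>j. j < ?l \<Longrightarrow> rat_vec (f j) = E *\<^sub>v rat_vec (col H j)" by metis
  have fdim: "dim_vec (f j) = q" if "j < ?l" for j
    using arg_cong[OF f[OF that], of dim_vec] dim by simp
  define H' where "H' = mat q ?l (\<lambda>(i,j). f j $ i)"
  have eq: "rat_pm H' = E * rat_pm H"
  proof (rule eq_matI)
    fix i j assume "i < dim_row (E * rat_pm H)" "j < dim_col (E * rat_pm H)"
    then have ij: "i < q" "j < ?l" using dim by auto
    have "rat_pm H' $$ (i,j) = rat_vec (f j) $ i" using ij fdim by (simp add: H'_def)
    also have "\<dots> = (E *\<^sub>v col (rat_pm H) j) $ i" using f[OF ij(2)] col_rat_pm[OF ij(2)] by simp
    also have "\<dots> = (E * rat_pm H) $$ (i,j)" using ij dim by simp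
    finally show "rat_pm H' $$ (i,j) = (E * rat_pm H) $$ (i,j)" .
  qed (use dim in \<open>auto simp: H'_def\<close>)
  have H'vec: "rat_pm H' *\<^sub>v c = E *\<^sub>v (rat_pm H *\<^sub>v c)" if "c \<in> carrier_vec ?l" for c
    unfolding eq using dim Hc that by (intro assoc_mult_mat_vec)
  have null: "rat_pm H *\<^sub>v c \<in> right_null X" if "c \<in> carrier_vec ?l" for c
    using right_null_mult_vec[OF Hc[folded dim(1)] colH(2) that] .
  have "poly_basis_of q (right_null Y) H'"
    unfolding poly_basis_of_def
  proof (intro conjI allI impI ballI)
    show "dim_row H' = q" by (simp add: H'_def)
    have dl: "dim_col H' = ?l" by (simp add: H'_def)
    show "col (rat_pm H') j \<in> right_null Y" if "j < dim_col H'" for j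
    proof -
      have "col (rat_pm H') j = E *\<^sub>v col (rat_pm H) j"
        unfolding eq using col_mult2[OF dim(3) Hc] that dl by simp
      then show ?thesis using E_null colH(2) that dl by auto
    qed
    show "c = 0\<^sub>v (dim_col H')" if "c \<in> carrier_vec (dim_col H')" "rat_pm H' *\<^sub>v c = 0\<^sub>v q" for c
    proof -
      have c: "c \<in> carrier_vec ?l" using that dl by simp
      have "rat_pm H *\<^sub>v c = P *\<^sub>v 0\<^sub>v q"
        using PE[OF null[OF c]] H'vec[OF c] that(2) by simp
      also have "\<dots> = 0\<^sub>v p" using dim by (intro eq_vecI) auto
      finally show ?thesis using H c dl by (auto simp: poly_basis_of_def)
    qed
    show "\<exists>c\<in>carrier_vec (dim_col H'). y = rat_pm H' *\<^sub>v c" if "y \<in> right_null Y" for y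
    proof -
      from P_null[OF that] H obtain c where c: "c \<in> carrier_vec ?l" "P *\<^sub>v y = rat_pm H *\<^sub>v c"
        by (auto simp: poly_basis_of_def)
      then have "y = rat_pm H' *\<^sub>v c" using EP[OF that] H'vec by auto
      then show ?thesis using c dl by auto
    qed
  qed
  with eq show ?thesis by blast
qed

text \<open>Degrees are controlled for \<open>E\<close> only. From \<open>P\<close> it suffices that
  polynomial vectors stay polynomial, because every polynomial null vector of \<open>Y\<close> is
  the \<open>E\<close>-image of its \<open>P\<close>-image and so inherits the shift by
  \<open>s\<close>.\<close>

locale null_transfer =
  fixes X Y E P :: "'a::field poly fract mat" and p q s :: nat
  assumes dim: "dim_col X = p" "dim_col Y = q" "E \<in> carrier_mat q p" "P \<in> carrier_mat p q"
    and E_null: "\<And>x. x \<in> right_null X \<Longrightarrow> E *\<^sub>v x \<in> right_null Y"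
    and P_null: "\<And>y. y \<in> right_null Y \<Longrightarrow> P *\<^sub>v y \<in> right_null X"
    and PE: "\<And>x. x \<in> right_null X \<Longrightarrow> P *\<^sub>v (E *\<^sub>v x) = x"
    and EP: "\<And>y. y \<in> right_null Y \<Longrightarrow> E *\<^sub>v (P *\<^sub>v y) = y"
    and E_poly: "\<And>h. h \<in> carrier_vec p \<Longrightarrow> rat_vec h \<in> right_null X \<Longrightarrow> h \<noteq> 0\<^sub>v p \<Longrightarrow>
      \<exists>g. rat_vec g = E *\<^sub>v rat_vec h \<and> vec_degree g = vec_degree h + s"
    and P_poly: "\<And>g. g \<in> carrier_vec q \<Longrightarrow> rat_vec g \<in> right_null Y \<Longrightarrow> \<exists>h. rat_vec h = P *\<^sub>v rat_vec g"
begin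

lemma lift_basis:
  assumes "poly_basis_of p (right_null X) H"
  shows "\<exists>H'. rat_pm H' = E * rat_pm H \<and> poly_basis_of q (right_null Y) H'"
proof (rule poly_basis_map[OF dim E_null P_null PE EP _ assms])
  fix h assume h: "rat_vec h \<in> right_null X"
  then have hc: "h \<in> carrier_vec p" using right_null_carrier[OF h] dim by auto
  show "\<exists>g. rat_vec g = E *\<^sub>v rat_vec h"
  \<comment> \<open>The zero vector is excluded from \<open>E_poly\<close> and needs its own
    witness.\<close>
  proof (cases "h = 0\<^sub>v p")
    case True
    then have "rat_vec (0\<^sub>v q) = E *\<^sub>v rat_vec h" using dim by (auto intro!: eq_vecI)
    then show ?thesis by blast
  qed (use E_poly[OF hc h] in blast)
qed

lemma lower_basis:
  assumes "poly_basis_of q (right_null Y) H"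
  shows "\<exists>H'. rat_pm H' = P * rat_pm H \<and> poly_basis_of p (right_null X) H'"
proof (rule poly_basis_map[OF dim(2,1,4,3) P_null E_null EP PE _ assms])
  fix h assume h: "rat_vec h \<in> right_null Y"
  then have hc: "h \<in> carrier_vec q" using right_null_carrier[OF h] dim by auto
  show "\<exists>g. rat_vec g = P *\<^sub>v rat_vec h" by (rule P_poly[OF hc h])
qed

lemma EP_mat:
  assumes H: "poly_basis_of q (right_null Y) H"
  shows "E * (P * rat_pm H) = rat_pm H"
proof (rule mat_col_eqI)
  fix j assume j: "j < dim_col (rat_pm H)"
  have Hc: "rat_pm H \<in> carrier_mat q (dim_col H)" by (rule poly_basis_carrier[OF H])
  have "col (E * (P * rat_pm H)) j = E *\<^sub>v (P *\<^sub>v col (rat_pm H) j)"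
    using col_mult2[OF dim(3) mult_carrier_mat[OF dim(4) Hc], of j] col_mult2[OF dim(4) Hc, of j] j
    by simp
  also have "\<dots> = col (rat_pm H) j" using H j by (intro EP) (auto simp: poly_basis_of_def)
  finally show "col (E * (P * rat_pm H)) j = col (rat_pm H) j" .
qed (use H dim in \<open>auto simp: poly_basis_of_def\<close>)

lemma lift_degrees:
  assumes H: "poly_basis_of p (right_null X) H" and H': "rat_pm H' = E * rat_pm H"
  shows "col_degrees H' = map (\<lambda>d. d + s) (col_degrees H)"
proof -
  have Hc: "rat_pm H \<in> carrier_mat p (dim_col H)" by (rule poly_basis_carrier[OF H])
  have dc: "dim_col H' = dim_col H" using arg_cong[OF H', of dim_col] by simp
  have "col_degree H' j = col_degree H j + s" if j: "j < dim_col H" for j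
  proof -
    have "rat_vec (col H j) \<in> right_null X" "col H j \<in> carrier_vec p"
      using H j by (auto simp: poly_basis_of_def col_rat_pm[symmetric])
    from E_poly[OF this(2,1) poly_basis_col_nonzero[OF H j]]
    obtain g where g: "rat_vec g = E *\<^sub>v rat_vec (col H j)" "vec_degree g = vec_degree (col H j) + s"
      by blast
    have "rat_vec (col H' j) = E *\<^sub>v rat_vec (col H j)"
      using col_mult2[OF dim(3) Hc j] H' j dc by (auto simp: col_rat_pm[symmetric])
    then have "col H' j = g" using g(1) rat_vec_inj by metis
    then show ?thesis using g(2) j dc by (simp add: col_degree_vec)
  qed
  then show ?thesis by (simp add: col_degrees_def dc)
qed

lemma lift_total_degree:
  assumes H: "poly_basis_of p (right_null X) H" and H': "rat_pm H' = E * rat_pm H"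
  shows "total_degree H' = total_degree H + s * dim_col H"
proof -
  have "(\<Sum>d\<leftarrow>ds. d + s) = sum_list ds + s * length ds" for ds :: "nat list"
    by (induction ds) auto
  then show ?thesis unfolding total_degree_def lift_degrees[OF assms]
    by (simp only: col_degrees_def length_map length_upt) simp
qed

text \<open>A competing basis of the larger null space is itself the lift of a basis of the smaller
  one. Both total degrees grow by \<open>s\<close> times the same number of columns, so the
  comparison can be made downstairs.\<close>

lemma lift_minimal:
  assumes H: "minimal_basis_of p (right_null X) H" and H': "rat_pm H' = E * rat_pm H"
  shows "minimal_basis_of q (right_null Y) H'"
proof -
  have b: "poly_basis_of p (right_null X) H" using H by (simp add: minimal_basis_of_def)
  from lift_basis[OF b] H' have b': "poly_basis_of q (right_null Y) H'" by (metis rat_pm_inj)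
  have "total_degree H' \<le> total_degree K'" if K': "poly_basis_of q (right_null Y) K'" for K'
  proof -
    from lower_basis[OF K'] obtain K where K: "rat_pm K = P * rat_pm K'"
      "poly_basis_of p (right_null X) K" by blast
    have "rat_pm K' = E * rat_pm K" using EP_mat[OF K'] K by simp
    from lift_total_degree[OF K(2) this] lift_total_degree[OF b H'] poly_basis_dim_eq[OF b K(2)]
    show ?thesis using H K(2) by (auto simp: minimal_basis_of_def)
  qed
  with b' show ?thesis by (simp add: minimal_basis_of_def)
qed

text \<open>The same comparison read upwards: a competitor for \<open>X\<close> is lifted, and equal
  shifts cancel. That \<open>H'\<close> is recovered from \<open>H\<close> is what later yields the
  explicit formulas for the blocks.\<close>

lemma lower_minimal:
  assumes H': "minimal_basis_of q (right_null Y) H'" and H: "rat_pm H = P * rat_pm H'"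
  shows "minimal_basis_of p (right_null X) H" "rat_pm H' = E * rat_pm H"
proof -
  have b': "poly_basis_of q (right_null Y) H'" using H' by (simp add: minimal_basis_of_def)
  from lower_basis[OF b'] H have b: "poly_basis_of p (right_null X) H" by (metis rat_pm_inj)
  show eq: "rat_pm H' = E * rat_pm H" using EP_mat[OF b'] H by simp
  have "total_degree H \<le> total_degree K" if K: "poly_basis_of p (right_null X) K" for K
  proof -
    from lift_basis[OF K] obtain K' where K': "rat_pm K' = E * rat_pm K"
      "poly_basis_of q (right_null Y) K'" by blast
    from lift_total_degree[OF K K'(1)] lift_total_degree[OF b eq] poly_basis_dim_eq[OF b K]
    show ?thesis using H' K'(2) by (auto simp: minimal_basis_of_def)
  qed
  with b show "minimal_basis_of p (right_null X) H" by (simp add: minimal_basis_of_def)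
qed

end

section \<open>Observability of minimal realizations\<close>

lemma rat_cm_add:
  "X \<in> carrier_mat a b \<Longrightarrow> Y \<in> carrier_mat a b \<Longrightarrow> rat_cm (X + Y) = rat_cm X + rat_cm Y"
  by (rule eq_matI) (auto simp: ratf.hom_add[symmetric])

lemma transfer_transpose:
  assumes A: "A \<in> carrier_mat n n" and B: "B \<in> carrier_mat n m" and C: "C \<in> carrier_mat m n"
  shows "transfer (transpose_mat A) (transpose_mat C) (transpose_mat B) = transpose_mat (transfer A B C)"
proof -
  let ?F = "minv (rat_pm (lamI_minus A))"
  have F: "?F \<in> carrier_mat n n" using minv_det(1)[OF _ det_lamI_minus[OF A]] A by simp
  have "transpose_mat (rat_cm C * ?F * rat_cm B)
      = transpose_mat (rat_cm B) * (transpose_mat ?F * transpose_mat (rat_cm C))"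
    using A B C F transpose_mult[of "rat_cm C * ?F" m n "rat_cm B" m] transpose_mult[of "rat_cm C" m n ?F n]
    by simp
  also have "\<dots> = transpose_mat (rat_cm B) * transpose_mat ?F * transpose_mat (rat_cm C)"
    using A B C F by (intro assoc_mult_mat[symmetric]) auto
  finally show ?thesis
    using A minv_transpose[OF _ det_lamI_minus[OF A], of n]
    by (simp add: transfer_def rat_cm_transpose lamI_minus_transpose rat_pm_transpose)
qed

text \<open>Transposing exchanges the input and output matrices, and a smaller realization of the
  transposed function would transpose back to one of the original. This makes the observability
  argument available on the left as well.\<close>

lemma minimal_realization_transpose:
  assumes "is_minimal_realization m n A B C"
  shows "is_minimal_realization m n (transpose_mat A) (transpose_mat C) (transpose_mat B)"
proof -
  from assms have c: "A \<in> carrier_mat n n" "B \<in> carrier_mat n m" "C \<in> carrier_mat m n"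
    and min: "\<And>n' A' B' C'. is_realization m n' A' B' C' (transfer A B C) \<Longrightarrow> n \<le> n'"
    by (auto simp: is_minimal_realization_def is_realization_def)
  have "n \<le> n'" if r: "is_realization m n' A' B' C'
    (transfer (transpose_mat A) (transpose_mat C) (transpose_mat B))" for n' A' B' C'
  proof -
    from r have c': "A' \<in> carrier_mat n' n'" "B' \<in> carrier_mat n' m" "C' \<in> carrier_mat m n'"
      by (auto simp: is_realization_def)
    have "transfer (transpose_mat A') (transpose_mat C') (transpose_mat B') = transfer A B C"
      using r unfolding transfer_transpose[OF c'] is_realization_def transfer_transpose[OF c] by simp
    then have "is_realization m n' (transpose_mat A') (transpose_mat C') (transpose_mat B') (transfer A B C)"
      using c' by (auto simp: is_realization_def)
    then show ?thesis by (rule min)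
  qed
  with c show ?thesis by (auto simp: is_minimal_realization_def is_realization_def)
qed

lemma rat_lamI_minus:
  "A \<in> carrier_mat a a \<Longrightarrow> rat_pm (lamI_minus A) = ratf [:0,1:] \<cdot>\<^sub>m 1\<^sub>m a - rat_cm A"
  by (rule eq_matI) (auto simp: lamI_minus_def char_poly_matrix_def ratf.hom_minus[symmetric] ratf.hom_add[symmetric]
      ratf.hom_uminus[symmetric])

text \<open>The scalar part lambda commutes with \<open>V\<close>, so only the defect
  \<open>W\<close> of the intertwining relation survives.\<close>

lemma resolvent_intertwine:
  assumes A: "A \<in> carrier_mat a a" and A': "A' \<in> carrier_mat b b" and V: "V \<in> carrier_mat a b"
    and W: "W \<in> carrier_mat a b" and eq: "A * V = V * A' + W"
  shows "rat_cm V * rat_pm (lamI_minus A') = rat_pm (lamI_minus A) * rat_cm V + rat_cm W"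
proof -
  let ?s = "ratf [:0,1:]"
  have W': "W = A * V - V * A'" unfolding eq using A A' V W by (intro eq_matI) auto
  have "rat_cm W = rat_cm A * rat_cm V - rat_cm V * rat_cm A'"
    unfolding rat_cm_mult[OF A V, symmetric] rat_cm_mult[OF V A', symmetric] W'
    using A A' V by (intro eq_matI) (auto simp: ratf.hom_minus[symmetric])
  moreover have "rat_cm V * rat_pm (lamI_minus A') = ?s \<cdot>\<^sub>m rat_cm V - rat_cm V * rat_cm A'"
    unfolding rat_lamI_minus[OF A'] using A' V
    by (subst mult_minus_distrib_mat[of _ a b]) (auto simp: mult_smult_distrib[of _ a b])
  moreover have "rat_pm (lamI_minus A) * rat_cm V = ?s \<cdot>\<^sub>m rat_cm V - rat_cm A * rat_cm V"
    unfolding rat_lamI_minus[OF A] using A V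
    by (subst minus_mult_distrib_mat[of _ a a]) (auto simp: mult_smult_assoc_mat[of _ a a])
  ultimately show ?thesis using A A' V W by (intro eq_matI) auto
qed

text \<open>Deleting the state direction r: V and U are the inclusion of a coordinate hyperplane and the
  projection onto it along r. The hyperplane is not invariant under A, but the error terms are multiples
  of r, hence invisible to the output.\<close>
lemma smaller_realization:
  fixes A B C :: "'a::field mat"
  assumes A: "A \<in> carrier_mat n n" and B: "B \<in> carrier_mat n m" and C: "C \<in> carrier_mat m n"
    and r: "r \<in> carrier_vec n" "r \<noteq> 0\<^sub>v n"
    and unobs: "(rat_cm C * minv (rat_pm (lamI_minus A))) *\<^sub>v map_vec (\<lambda>a. ratf [:a:]) r = 0\<^sub>v m"
  shows "\<exists>A' B' C'. is_realization m (n - 1) A' B' C' (transfer A B C)"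
proof -
  from r obtain p where p: "p < n" "r $ p \<noteq> 0" by (metis eq_vecI carrier_vecD index_zero_vec)
  define q where "q = n - 1"
  define V where "V = mat n q (\<lambda>(i,j). if i = insert_index p j then 1 else (0::'a))"
  define U where "U = mat q n (\<lambda>(i,j). (if j = insert_index p i then 1 else 0)
     - (if j = p then r $ insert_index p i / r $ p else 0))"
  \<comment> \<open>\<open>N\<close> is the complementary projection onto the line of
    \<open>r\<close>; hence \<open>V * U + N\<close> is the identity and every column of
    \<open>N\<close> is a multiple of \<open>r\<close>.\<close>
  define N where "N = mat n n (\<lambda>(i,j). if j = p then r $ i / r $ p else 0)"
  have c[simp]: "V \<in> carrier_mat n q" "U \<in> carrier_mat q n" "N \<in> carrier_mat n n"
    by (auto simp: V_def U_def N_def)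
  have VU[simp]: "V * U \<in> carrier_mat n n" and AVc[simp]: "A * V \<in> carrier_mat n q"
    by (rule mult_carrier_mat[OF c(1,2)], rule mult_carrier_mat[OF A c(1)])
  have VUN: "V * U + N = 1\<^sub>m n"
  proof (rule eq_matI)
    fix i j assume "i < dim_row (1\<^sub>m n)" "j < dim_col (1\<^sub>m n)"
    then have ij: "i < n" "j < n" by auto
    have "(V * U) $$ (i,j) = (\<Sum>l = 0..<q. if i = insert_index p l then U $$ (l,j) else 0)"
      using ij by (auto simp: V_def U_def scalar_prod_def intro!: sum.cong)
    also have "\<dots> = (if i = p then 0 else (if j = i then 1 else 0) - (if j = p then r $ i / r $ p else 0))"
    proof (cases "i = p")
      case True
      then show ?thesis by (auto intro!: sum.neutral simp: insert_index_def split: if_splits)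
    next
      case False
      define l where "l = delete_index p i"
      have l: "insert_index p l = i" "l < q"
        using False ij p by (auto simp: q_def l_def insert_index_def delete_index_def)
      have "(\<Sum>l = 0..<q. if i = insert_index p l then U $$ (l,j) else 0) = (\<Sum>k = 0..<q. if k = l then U $$ (k,j) else 0)"
        by (rule sum.cong) (use l(1) in \<open>auto simp: insert_index_def split: if_splits\<close>)
      also have "\<dots> = U $$ (l,j)" using l by simp
      finally show ?thesis using False ij l by (simp add: U_def)
    qed
    finally show "(V * U + N) $$ (i,j) = 1\<^sub>m n $$ (i,j)" using ij p by (auto simp: N_def)
  qed (auto simp: N_def)
  define A' where "A' = U * (A * V)"
  have A': "A' \<in> carrier_mat q q" unfolding A'_def
    by (rule mult_carrier_mat[OF c(2) mult_carrier_mat[OF A c(1)]])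
  let ?F = "rat_pm (lamI_minus A)" and ?F' = "rat_pm (lamI_minus A')"
  define R where "R = rat_cm C * minv ?F"
  have F: "?F \<in> carrier_mat n n" "minv ?F \<in> carrier_mat n n" "minv ?F * ?F = 1\<^sub>m n"
    using A minv_det[OF _ det_lamI_minus[OF A]] by auto
  have F': "?F' \<in> carrier_mat q q" "minv ?F' \<in> carrier_mat q q" "?F' * minv ?F' = 1\<^sub>m q"
    using A' minv_det[OF _ det_lamI_minus[OF A']] by auto
  have R: "R \<in> carrier_mat m n" using C F by (auto simp: R_def)
  have RF: "R * ?F = rat_cm C"
    unfolding R_def using assoc_mult_mat[of "rat_cm C" m n "minv ?F" n ?F n] C F by simp
  \<comment> \<open>The columns of \<open>N\<close> are multiples of \<open>r\<close>, which the
    hypothesis \<open>unobs\<close> says is annihilated by \<open>R\<close>.\<close>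
  have RN: "R * rat_cm N = 0\<^sub>m m n"
  proof (rule eq_matI)
    fix i j assume ij: "i < dim_row (0\<^sub>m m n)" "j < dim_col (0\<^sub>m m n)"
    have "col (rat_cm N) j = (if j = p then ratf [:1 / r $ p:] else 0) \<cdot>\<^sub>v map_vec (\<lambda>a. ratf [:a:]) r"
      using ij r by (intro eq_vecI) (auto simp: N_def ratf.hom_mult[symmetric])
    moreover have "row R i \<bullet> map_vec (\<lambda>a. ratf [:a:]) r = 0"
      using arg_cong[OF unobs, of "\<lambda>v. v $ i"] ij R unfolding R_def[symmetric] by simp
    ultimately show "(R * rat_cm N) $$ (i,j) = 0\<^sub>m m n $$ (i,j)"
      using ij R r carrier_matD[OF c(3)] by auto
  qed (use R carrier_matD[OF c(3)] in auto)
  \<comment> \<open>Inserting the identity \<open>V * U + N\<close> in front of \<open>A * V\<close>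
    isolates the failure of the hyperplane to be invariant as a left multiple by
    \<open>N\<close>.\<close>
  have AV: "A * V = V * A' + N * (A * V)"
  proof -
    have "A * V = (V * U + N) * (A * V)" unfolding VUN using A by auto
    also have "\<dots> = V * U * (A * V) + N * (A * V)"
      using A by (intro add_mult_distrib_mat[of _ n n]) auto
    also have "V * U * (A * V) = V * A'" unfolding A'_def
      using A by (intro assoc_mult_mat[of _ n "q" _ n]) auto
    finally show ?thesis .
  qed
  have NAV: "N * (A * V) \<in> carrier_mat n q" by (rule mult_carrier_mat[OF c(3) AVc])
  \<comment> \<open>The defect dies under \<open>R\<close>, which leaves R V (lambda I - A') = R
    (lambda I - A) V = C V. So \<open>R * rat_cm V\<close> is the output resolvent of the compressed
    system.\<close>
  have "R * rat_cm V * ?F' = R * (rat_cm V * ?F')"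
    by (rule assoc_mult_mat[OF R _ F'(1)]) simp
  also have "\<dots> = R * (?F * rat_cm V) + R * rat_cm (N * (A * V))"
    unfolding resolvent_intertwine[OF A A' c(1) NAV AV]
    by (rule mult_add_distrib_mat[OF R mult_carrier_mat[OF F(1), of _ q]]) (simp_all add: NAV)
  also have "R * rat_cm (N * (A * V)) = R * rat_cm N * rat_cm (A * V)"
    unfolding rat_cm_mult[OF c(3) AVc] by (rule assoc_mult_mat[symmetric, OF R, of _ n _ q]) simp_all
  also have "\<dots> = 0\<^sub>m m q" unfolding RN by (rule left_mult_zero_mat) simp
  also have "R * (?F * rat_cm V) = rat_cm C * rat_cm V"
    unfolding RF[symmetric] by (rule assoc_mult_mat[symmetric, OF R F(1), of _ q]) simp
  finally have RVF': "R * rat_cm V * ?F' = rat_cm (C * V)"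
    unfolding rat_cm_mult[OF C c(1)] using right_add_zero_mat[of "rat_cm C * rat_cm V" m q]
      mult_carrier_mat[of "rat_cm C" m n "rat_cm V" q] C by simp
  have RV: "R * rat_cm V \<in> carrier_mat m q" by (rule mult_carrier_mat[OF R]) simp
  have "rat_cm (C * V) * minv ?F' = R * rat_cm V * (?F' * minv ?F')"
    unfolding RVF'[symmetric] by (rule assoc_mult_mat[OF RV F'(1,2)])
  then have CV: "rat_cm (C * V) * minv ?F' = R * rat_cm V" unfolding F'(3) right_mult_one_mat[OF RV] .
  have "transfer A' (U * B) (C * V) = R * rat_cm V * (rat_cm U * rat_cm B)"
    unfolding transfer_def CV rat_cm_mult[OF c(2) B] ..
  also have "\<dots> = R * rat_cm V * rat_cm U * rat_cm B"
    by (rule assoc_mult_mat[symmetric, OF RV, of _ n _ m]) (use B in simp_all)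
  also have "R * rat_cm V * rat_cm U = R * rat_cm (V * U)"
    unfolding rat_cm_mult[OF c(1,2)] by (rule assoc_mult_mat[OF R, of _ q _ n]) simp_all
  \<comment> \<open>Since R N = 0, adding \<open>N\<close> completes the projection
    \<open>V * U\<close> to the identity at no cost.\<close>
  also have "R * rat_cm (V * U) = R * (rat_cm (V * U) + rat_cm N)"
    using R RN mult_add_distrib_mat[of R m n "rat_cm (V * U)" n "rat_cm N"] by simp
  also have "rat_cm (V * U) + rat_cm N = rat_cm (V * U + N)"
    by (rule rat_cm_add[symmetric, OF VU c(3)])
  also have "R * rat_cm (V * U + N) * rat_cm B = transfer A B C"
    unfolding VUN rat_cm_one right_mult_one_mat[OF R] by (simp add: R_def transfer_def)
  finally have "is_realization m q A' (U * B) (C * V) (transfer A B C)"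
    using A' mult_carrier_mat[OF c(2) B] mult_carrier_mat[OF C c(1)] by (simp add: is_realization_def)
  then show ?thesis unfolding q_def by blast
qed

lemma minimal_realization_observable:
  assumes "is_minimal_realization m n A B C" "r \<in> carrier_vec n"
    "(rat_cm C * minv (rat_pm (lamI_minus A))) *\<^sub>v map_vec (\<lambda>a. ratf [:a:]) r = 0\<^sub>v m"
  shows "r = 0\<^sub>v n"
proof (rule ccontr)
  assume nz: "r \<noteq> 0\<^sub>v n"
  have c: "A \<in> carrier_mat n n" "B \<in> carrier_mat n m" "C \<in> carrier_mat m n"
    using assms(1) by (auto simp: is_minimal_realization_def is_realization_def)
  from smaller_realization[OF c assms(2) nz assms(3)] assms(1) have "n \<le> n - 1"
    by (auto simp: is_minimal_realization_def)
  \<comment> \<open>For \<open>n = 0\<close> the truncated \<open>n - 1\<close> would not be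
    smaller; a nonzero \<open>r\<close> excludes that case.\<close>
  moreover have "n \<noteq> 0" using nz assms(2) by auto
  ultimately show False by simp
qed

text \<open>After multiplication by the characteristic polynomial \<open>ch\<close> the state is
  polynomial. Dividing by \<open>ch\<close> with remainder \<open>\<rho>\<close> separates the
  polynomial part \<open>u\<close> of the state from its strictly proper part \<rho>/ch. Counting
  degrees makes (lambda I - A) \<rho>/ch a constant vector and C \<rho>/ch zero, so observability
  kills the remainder.\<close>

lemma observable_polynomial:
  assumes min: "is_minimal_realization m n A B C" and x: "x \<in> carrier_vec n"
    and h: "rat_pm (lamI_minus A) *\<^sub>v x = rat_vec h" and g: "rat_cm C *\<^sub>v x = rat_vec g"
  shows "\<exists>u. x = rat_vec u"
proof -
  have A: "A \<in> carrier_mat n n" and C: "C \<in> carrier_mat m n"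
    using min by (auto simp: is_minimal_realization_def is_realization_def)
  let ?Z = "lamI_minus A"
  let ?F = "rat_pm ?Z"
  define ch where "ch = det ?Z"
  have ch: "degree ch = n" "ch \<noteq> 0"
    using degree_monic_char_poly[OF A] by (auto simp: ch_def char_poly_def lamI_minus_def)
  have Z: "?Z \<in> carrier_mat n n" using A by simp
  note F = minv_det[OF rat_pm_carrier[THEN iffD2, OF Z] det_lamI_minus[OF A]]
  have inj: "u = v" if "?F *\<^sub>v u = ?F *\<^sub>v v" "u \<in> carrier_vec n" "v \<in> carrier_vec n" for u v
    using arg_cong[OF that(1), of "\<lambda>y. minv ?F *\<^sub>v y"] that(2,3) F Z
    by (simp add: assoc_mult_mat_vec[symmetric, of _ n n _ n])
  have hc: "h \<in> carrier_vec n" using arg_cong[OF h, of dim_vec] Z by (auto intro!: carrier_vecI)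
  have gc: "g \<in> carrier_vec m" using arg_cong[OF g, of dim_vec] C by (auto intro!: carrier_vecI)
  \<comment> \<open>By Cramer's rule this is the state multiplied by \<open>ch\<close>.\<close>
  define N where "N = adj_mat ?Z *\<^sub>v h"
  note adj = adj_mat[OF Z]
  have N: "N \<in> carrier_vec n" using adj(1) hc by (auto simp: N_def)
  have ZN: "?Z *\<^sub>v N = ch \<cdot>\<^sub>v h"
    unfolding N_def using Z adj hc by (simp add: assoc_mult_mat_vec[symmetric, of _ n n _ n] ch_def smult_mat_mult_vec[of _ n n])
  have chx: "ratf ch \<cdot>\<^sub>v x = rat_vec N"
  proof (rule inj)
    have "?F *\<^sub>v (ratf ch \<cdot>\<^sub>v x) = ratf ch \<cdot>\<^sub>v rat_vec h"
      using Z x mat_mult_smult_vec[of ?F n n x] h by simp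
    also have "\<dots> = rat_vec (ch \<cdot>\<^sub>v h)" by (rule eq_vecI) (auto simp: ratf.hom_mult)
    also have "\<dots> = ?F *\<^sub>v rat_vec N" unfolding ZN[symmetric] by (rule rat_pm_mult_vec[OF Z N])
    finally show "?F *\<^sub>v (ratf ch \<cdot>\<^sub>v x) = ?F *\<^sub>v rat_vec N" .
  qed (use x N in auto)
  define u where "u = map_vec (\<lambda>p. p div ch) N"
  define \<rho> where "\<rho> = map_vec (\<lambda>p. p mod ch) N"
  have u: "u \<in> carrier_vec n" and \<rho>: "\<rho> \<in> carrier_vec n" using N by (auto simp: u_def \<rho>_def)
  have Ndec: "N = ch \<cdot>\<^sub>v u + \<rho>" using N by (intro eq_vecI) (auto simp: u_def \<rho>_def)
  have deg\<rho>: "degree (\<rho> $ i) < n" if "i < n" for i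
  proof -
    \<comment> \<open>A vanishing remainder has degree 0, still below \<open>n\<close>, because
      \<open>i < n\<close> forces \<open>n\<close> to be positive.\<close>
    have "\<rho> $ i = 0 \<or> degree (\<rho> $ i) < n"
      using degree_mod_less[OF ch(2), of "N $ i"] that N by (auto simp: \<rho>_def ch(1))
    then show ?thesis using that by auto
  qed
  \<comment> \<open>Used for the pencil and for the output matrix: if \<open>ch\<close> divides the
    image of \<open>N\<close>, it divides the image of the remainder, with an explicit
    quotient.\<close>
  have split: "M *\<^sub>v \<rho> = ch \<cdot>\<^sub>v (y - M *\<^sub>v u)"
    if "M \<in> carrier_mat l n" "M *\<^sub>v N = ch \<cdot>\<^sub>v y" "y \<in> carrier_vec l" for M l y
  proof -
    have "M *\<^sub>v N = ch \<cdot>\<^sub>v (M *\<^sub>v u) + M *\<^sub>v \<rho>"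
      unfolding Ndec using that(1) u \<rho> by (simp add: mult_add_distrib_mat_vec[of _ l n] mat_mult_smult_vec[of _ l n])
    then have "M *\<^sub>v \<rho> = ch \<cdot>\<^sub>v y - ch \<cdot>\<^sub>v (M *\<^sub>v u)"
      unfolding that(2) using that(1,3) u \<rho> by (intro eq_vecI) (auto simp: algebra_simps)
    then show ?thesis using that(1,3) u by (intro eq_vecI) (auto simp: algebra_simps)
  qed
  \<comment> \<open>\<open>ch\<close> already has degree \<open>n\<close>, so no room is left for a
    nonconstant cofactor.\<close>
  have const_degree: "degree q = 0 \<or> q = 0" if "degree (ch * q) \<le> n" for q
    using that ch by (cases "q = 0") (auto simp: degree_mult_eq)
  define r where "r = h - ?Z *\<^sub>v u"
  have rc: "r \<in> carrier_vec n" using hc Z u by (auto simp: r_def)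
  have Z\<rho>: "?Z *\<^sub>v \<rho> = ch \<cdot>\<^sub>v r" unfolding r_def by (rule split[OF Z ZN hc])
  define r0 where "r0 = map_vec (\<lambda>p. coeff p 0) r"
  have r0: "r0 \<in> carrier_vec n" "r = map_vec (\<lambda>a. [:a:]) r0"
  proof -
    show "r0 \<in> carrier_vec n" using rc by (simp add: r0_def)
    have "r $ i = [:coeff (r $ i) 0:]" if i: "i < n" for i
    proof -
      \<comment> \<open>Pencil entries have degree at most 1 and remainder entries degree at most n
        - 1.\<close>
      have "degree (\<Sum>j = 0..<n. ?Z $$ (i,j) * \<rho> $ j) \<le> n"
      proof (rule degree_sum_le)
        fix j assume j: "j \<in> {0..<n}"
        have "degree (?Z $$ (i,j)) \<le> 1" using A i j by (auto simp: lamI_minus_index)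
        then show "degree (?Z $$ (i,j) * \<rho> $ j) \<le> n"
          using degree_mult_le[of "?Z $$ (i,j)" "\<rho> $ j"] deg\<rho>[of j] j by auto
      qed simp
      also have "(\<Sum>j = 0..<n. ?Z $$ (i,j) * \<rho> $ j) = ch * r $ i"
        using arg_cong[OF Z\<rho>, of "\<lambda>v. v $ i"] Z \<rho> rc i by (simp add: scalar_prod_def)
      finally have "degree (r $ i) = 0" using const_degree[of "r $ i"] by auto
      then show ?thesis by (metis degree_eq_zeroE coeff_pCons_0)
    qed
    then show "r = map_vec (\<lambda>a. [:a:]) r0" using rc by (intro eq_vecI) (auto simp: r0_def)
  qed
  have CN: "const_pm C *\<^sub>v N = ch \<cdot>\<^sub>v g"
  proof -
    have "rat_vec (const_pm C *\<^sub>v N) = rat_cm C *\<^sub>v (ratf ch \<cdot>\<^sub>v x)"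
      unfolding chx rat_cm_def using C N by (intro rat_pm_mult_vec) auto
    also have "\<dots> = ratf ch \<cdot>\<^sub>v rat_vec g"
      using C x mat_mult_smult_vec[of "rat_cm C" m n x] g by simp
    also have "\<dots> = rat_vec (ch \<cdot>\<^sub>v g)" by (rule eq_vecI) (auto simp: ratf.hom_mult)
    finally show ?thesis by (simp add: rat_vec_inj)
  qed
  have C\<rho>: "const_pm C *\<^sub>v \<rho> = 0\<^sub>v m"
  proof (rule eq_vecI)
    fix i assume "i < dim_vec (0\<^sub>v m)"
    then have i: "i < m" by simp
    have eq: "const_pm C *\<^sub>v \<rho> = ch \<cdot>\<^sub>v (g - const_pm C *\<^sub>v u)"
      using C gc by (intro split[of _ m] CN) auto
    let ?q = "(g - const_pm C *\<^sub>v u) $ i"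
    have qe: "(const_pm C *\<^sub>v \<rho>) $ i = ch * ?q" using eq gc C i by simp
    show "(const_pm C *\<^sub>v \<rho>) $ i = 0\<^sub>v m $ i"
    \<comment> \<open>For \<open>n = 0\<close> the bound \<open>n - 1\<close> would equal the degree
      of \<open>ch\<close> and exclude no cofactor; there the sum is empty.\<close>
    proof (cases "n = 0")
      case True
      then show ?thesis using i C \<rho> by (simp add: scalar_prod_def)
    next
      case False
      have "degree (\<Sum>j = 0..<n. [:C $$ (i,j):] * \<rho> $ j) \<le> n - 1"
      proof (rule degree_sum_le)
        fix j assume "j \<in> {0..<n}"
        then show "degree ([:C $$ (i,j):] * \<rho> $ j) \<le> n - 1"
          using deg\<rho>[of j] degree_smult_le[of "C $$ (i,j)" "\<rho> $ j"] by auto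
      qed simp
      also have "(\<Sum>j = 0..<n. [:C $$ (i,j):] * \<rho> $ j) = (const_pm C *\<^sub>v \<rho>) $ i"
        using i C \<rho> by (simp add: scalar_prod_def)
      finally have "degree (ch * ?q) \<le> n - 1" using qe by simp
      then have "?q = 0" using ch False by (cases "?q = 0") (auto simp: degree_mult_eq)
      then show ?thesis using qe i by simp
    qed
  qed (use C in auto)
  \<comment> \<open>Thus (lambda I - A)^{-1} r0 = \<rho>/ch, and C annihilates it: \<open>r0\<close>
    is an unobservable constant vector.\<close>
  have F\<rho>: "?F *\<^sub>v rat_vec \<rho> = ratf ch \<cdot>\<^sub>v map_vec (\<lambda>a. ratf [:a:]) r0"
    unfolding rat_pm_mult_vec[OF Z \<rho>, symmetric] Z\<rho> r0(2) by (rule eq_vecI) (auto simp: ratf.hom_mult[symmetric])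
  have "ratf ch \<cdot>\<^sub>v ((rat_cm C * minv ?F) *\<^sub>v map_vec (\<lambda>a. ratf [:a:]) r0)
      = (rat_cm C * minv ?F) *\<^sub>v (?F *\<^sub>v rat_vec \<rho>)"
    unfolding F\<rho> using mat_mult_smult_vec[of "rat_cm C * minv ?F" m n "map_vec (\<lambda>a. ratf [:a:]) r0"] C F r0(1) by simp
  also have "\<dots> = rat_cm C *\<^sub>v rat_vec \<rho>"
    using C F Z \<rho> by (simp add: assoc_mult_mat_vec[of _ m n _ n] assoc_mult_mat_vec[symmetric, of _ n n _ n])
  also have "\<dots> = 0\<^sub>v m"
    using rat_pm_mult_vec[of "const_pm C" m n \<rho>] C \<rho> C\<rho> by (simp add: rat_cm_def)
  finally have z: "ratf ch \<cdot>\<^sub>v ((rat_cm C * minv ?F) *\<^sub>v map_vec (\<lambda>a. ratf [:a:]) r0) = 0\<^sub>v m" .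
  have "(rat_cm C * minv ?F) *\<^sub>v map_vec (\<lambda>a. ratf [:a:]) r0 = 0\<^sub>v m"
  proof (rule eq_vecI)
    fix i assume "i < dim_vec (0\<^sub>v m)"
    then show "((rat_cm C * minv ?F) *\<^sub>v map_vec (\<lambda>a. ratf [:a:]) r0) $ i = 0\<^sub>v m $ i"
      using arg_cong[OF z, of "\<lambda>v. v $ i"] C ch(2) by simp
  qed (use C in simp)
  from minimal_realization_observable[OF min r0(1) this] have "r0 = 0\<^sub>v n" .
  then have "?F *\<^sub>v rat_vec \<rho> = ?F *\<^sub>v 0\<^sub>v n"
    unfolding F\<rho> using mat_mult_zero_vec[of ?F n n] Z by (auto intro!: eq_vecI)
  then have "rat_vec \<rho> = 0\<^sub>v n" by (rule inj) (simp_all add: \<rho>)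
  then have "\<rho> = 0\<^sub>v n" using rat_vec_eq_zero by blast
  then have Nu: "N = ch \<cdot>\<^sub>v u" using Ndec u by simp
  have eq: "ratf ch \<cdot>\<^sub>v x = ratf ch \<cdot>\<^sub>v rat_vec u"
    unfolding chx Nu by (rule eq_vecI) (simp_all add: ratf.hom_mult)
  have "x = rat_vec u"
  proof (rule eq_vecI)
    fix i assume "i < dim_vec (rat_vec u)"
    then show "x $ i = rat_vec u $ i"
      using arg_cong[OF eq, of "\<lambda>v. v $ i"] x u ch(2) by simp
  qed (use x u in simp)
  then show ?thesis by blast
qed

section \<open>Kronecker products and the polynomial basis\<close>

lemma sum_blocks:
  "(\<Sum>l = 0..<b * m. f l) = (\<Sum>p = 0..<b. \<Sum>q = 0..<m. f (p * m + q :: nat) :: 'b::comm_monoid_add)"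
proof (induction b)
  case (Suc b)
  have "(\<Sum>l = 0..<Suc b * m. f l) = (\<Sum>l = 0..<b * m. f l) + (\<Sum>l = b * m..<b * m + m. f l)"
    by (simp add: sum.atLeastLessThan_concat add.commute)
  also have "(\<Sum>l = b * m..<b * m + m. f l) = (\<Sum>q = 0..<m. f (b * m + q))"
    using sum.shift_bounds_nat_ivl[of f 0 "b * m" m] by (simp add: add.commute)
  finally show ?case using Suc by simp
qed simp

lemma block_index_less: "p < b \<Longrightarrow> q < m \<Longrightarrow> p * m + q < b * (m::nat)"
  by (metis add_less_cancel_left less_le_trans add.commute mult_Suc mult_le_mono1 Suc_leI)

lemma kron_dim [simp]: "dim_row (kron X Y) = dim_row X * dim_row Y" "dim_col (kron X Y) = dim_col X * dim_col Y"
  by (auto simp: kron_def)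

lemma kron_carrier [simp]:
  "X \<in> carrier_mat a b \<Longrightarrow> Y \<in> carrier_mat c d \<Longrightarrow> kron X Y \<in> carrier_mat (a * c) (b * d)"
  by (auto simp: kron_def)

lemma kron_one_index:
  assumes "X \<in> carrier_mat a b" "i < a * m" "j < b * m"
  shows "kron X (1\<^sub>m m) $$ (i,j) = (if i mod m = j mod m then X $$ (i div m, j div m) else 0)"
proof -
  have "m > 0" using assms(2) by (cases m) auto
  then show ?thesis using assms by (auto simp: kron_def)
qed

lemma kron_one_mult:
  fixes X Y :: "'b::comm_semiring_1 mat"
  assumes X: "X \<in> carrier_mat a b" and Y: "Y \<in> carrier_mat b c"
  shows "kron X (1\<^sub>m m) * kron Y (1\<^sub>m m) = kron (X * Y) (1\<^sub>m m)"
proof (rule eq_matI)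
  have XY: "X * Y \<in> carrier_mat a c" using X Y by simp
  fix i j assume "i < dim_row (kron (X * Y) (1\<^sub>m m))" "j < dim_col (kron (X * Y) (1\<^sub>m m))"
  then have ij: "i < a * m" "j < c * m" using X Y by auto
  then have m: "m > 0" by (cases m) auto
  have d: "i div m < a" "j div m < c" using ij by (auto simp: less_mult_imp_div_less)
  have "(kron X (1\<^sub>m m) * kron Y (1\<^sub>m m)) $$ (i,j)
      = (\<Sum>l = 0..<b * m. kron X (1\<^sub>m m) $$ (i,l) * kron Y (1\<^sub>m m) $$ (l,j))"
    using ij X Y by (auto simp: scalar_prod_def)
  \<comment> \<open>The identity factor lets only the offset \<open>i mod m\<close> survive within
    each block.\<close>
  also have "\<dots> = (\<Sum>p = 0..<b. \<Sum>q = 0..<m. if q = i mod m then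
      (if i mod m = j mod m then X $$ (i div m, p) * Y $$ (p, j div m) else 0) else 0)"
    unfolding sum_blocks
    by (intro sum.cong) (use ij m in \<open>auto simp: kron_one_index[OF X] kron_one_index[OF Y] block_index_less\<close>)
  also have "\<dots> = (\<Sum>p = 0..<b. if i mod m = j mod m then X $$ (i div m, p) * Y $$ (p, j div m) else 0)"
    using m by (intro sum.cong) auto
  also have "\<dots> = kron (X * Y) (1\<^sub>m m) $$ (i,j)"
    using d X Y unfolding kron_one_index[OF XY ij] by (auto simp: scalar_prod_def)
  finally show "(kron X (1\<^sub>m m) * kron Y (1\<^sub>m m)) $$ (i,j) = kron (X * Y) (1\<^sub>m m) $$ (i,j)" .
qed (use X Y in auto)

lemma kron_one_transpose:
  assumes X: "X \<in> carrier_mat a b"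
  shows "transpose_mat (kron X (1\<^sub>m m)) = kron (transpose_mat X) (1\<^sub>m m)"
proof (rule eq_matI)
  fix i j assume "i < dim_row (kron (transpose_mat X) (1\<^sub>m m))" "j < dim_col (kron (transpose_mat X) (1\<^sub>m m))"
  then have ij: "i < b * m" "j < a * m" using X by auto
  then have d: "i div m < b" "j div m < a" by (auto simp: less_mult_imp_div_less)
  have XT: "transpose_mat X \<in> carrier_mat b a" using X by simp
  show "transpose_mat (kron X (1\<^sub>m m)) $$ (i,j) = kron (transpose_mat X) (1\<^sub>m m) $$ (i,j)"
    unfolding kron_one_index[OF XT ij] using kron_one_index[OF X ij(2,1)] ij d X by auto
qed auto

lemma kron_one_one: "kron (1\<^sub>m a) (1\<^sub>m m) = 1\<^sub>m (a * m)"
proof (rule eq_matI)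
  fix i j assume "i < dim_row (1\<^sub>m (a * m))" "j < dim_col (1\<^sub>m (a * m))"
  then have ij: "i < a * m" "j < a * m" by auto
  then have d: "i div m < a" "j div m < a" by (auto simp: less_mult_imp_div_less)
  have "i = j \<longleftrightarrow> i div m = j div m \<and> i mod m = j mod m" by (metis div_mult_mod_eq)
  then show "kron (1\<^sub>m a) (1\<^sub>m m) $$ (i,j) = 1\<^sub>m (a * m) $$ (i,j)"
    using ij d unfolding kron_one_index[OF one_carrier_mat ij] by auto
qed auto

lemma kron_one_zero: "kron (0\<^sub>m a b) (1\<^sub>m m) = 0\<^sub>m (a * m) (b * m)"
proof (rule eq_matI)
  fix i j assume "i < dim_row (0\<^sub>m (a * m) (b * m))" "j < dim_col (0\<^sub>m (a * m) (b * m))"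
  then have ij: "i < a * m" "j < b * m" by auto
  then show "kron (0\<^sub>m a b) (1\<^sub>m m) $$ (i,j) = 0\<^sub>m (a * m) (b * m) $$ (i,j)"
    unfolding kron_one_index[OF zero_carrier_mat ij] by (auto simp: less_mult_imp_div_less)
qed auto

lemma kron_one_add:
  fixes X Y :: "'b::comm_semiring_1 mat"
  assumes X: "X \<in> carrier_mat a b" and Y: "Y \<in> carrier_mat a b"
  shows "kron (X + Y) (1\<^sub>m m) = kron X (1\<^sub>m m) + kron Y (1\<^sub>m m)"
proof (rule eq_matI)
  have XY: "X + Y \<in> carrier_mat a b" using X Y by simp
  fix i j assume "i < dim_row (kron X (1\<^sub>m m) + kron Y (1\<^sub>m m))" "j < dim_col (kron X (1\<^sub>m m) + kron Y (1\<^sub>m m))"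
  then have ij: "i < a * m" "j < b * m" using Y by auto
  then have d: "i div m < a" "j div m < b" by (auto simp: less_mult_imp_div_less)
  show "kron (X + Y) (1\<^sub>m m) $$ (i,j) = (kron X (1\<^sub>m m) + kron Y (1\<^sub>m m)) $$ (i,j)"
    using ij d X Y by (simp add: kron_one_index[OF XY ij] kron_one_index[OF X ij] kron_one_index[OF Y ij])
qed (use X Y in auto)

lemma kron_one_map:
  assumes "f 0 = 0"
  shows "map_mat f (kron X (1\<^sub>m m)) = kron (map_mat f X) (1\<^sub>m m)"
proof (rule eq_matI)
  fix i j assume "i < dim_row (kron (map_mat f X) (1\<^sub>m m))" "j < dim_col (kron (map_mat f X) (1\<^sub>m m))"
  then have ij: "i < dim_row X * m" "j < dim_col X * m" by auto
  then have d: "i div m < dim_row X" "j div m < dim_col X" by (auto simp: less_mult_imp_div_less)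
  have X: "X \<in> carrier_mat (dim_row X) (dim_col X)" "map_mat f X \<in> carrier_mat (dim_row X) (dim_col X)"
    by auto
  show "map_mat f (kron X (1\<^sub>m m)) $$ (i,j) = kron (map_mat f X) (1\<^sub>m m) $$ (i,j)"
    unfolding kron_one_index[OF X(2) ij] using kron_one_index[OF X(1) ij] ij d assms by auto
qed auto

lemma rat_pm_kron_one: "rat_pm (kron X (1\<^sub>m m)) = kron (rat_pm X) (1\<^sub>m m)"
  unfolding rat_pm_def by (rule kron_one_map) simp

lemma block_transpose_carrier [simp]:
  "X \<in> carrier_mat a b \<Longrightarrow> block_transpose m X \<in> carrier_mat b a"
  by (auto simp: block_transpose_def)

section \<open>The polynomial basis, its recurrence and the expansion of D\<close>

lemma degree_phi:
  assumes "\<forall>j. al j \<noteq> 0" shows "degree (phi al be ga j) = j"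
  using assms
proof (induction al be ga j rule: phi.induct)
  case (3 al be ga j)
  have "phi al be ga (Suc j) \<noteq> 0" using 3 by auto
  then have "degree ([:- be (Suc j), 1:] * phi al be ga (Suc j)) = Suc (Suc j)"
    using 3 by (subst degree_mult_eq) auto
  moreover have "degree (Polynomial.smult (ga (Suc j)) (phi al be ga j)) < Suc (Suc j)"
    using 3 degree_smult_le[of "ga (Suc j)" "phi al be ga j"] by simp
  ultimately have "degree ([:- be (Suc j), 1:] * phi al be ga (Suc j) - Polynomial.smult (ga (Suc j)) (phi al be ga j)) = Suc (Suc j)"
    by (metis degree_add_eq_left degree_minus diff_conv_add_uminus)
  then show ?case using 3 by simp
qed auto

text \<open>The order is descending, matching the columns of \<open>M_Phi\<close>, so that the last
  entry, the one picked by e_k^T, is phi_0 = 1.\<close>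

definition Phi_vec :: "(nat \<Rightarrow> 'a::field) \<Rightarrow> (nat \<Rightarrow> 'a) \<Rightarrow> (nat \<Rightarrow> 'a) \<Rightarrow> nat \<Rightarrow> 'a poly mat" where
  "Phi_vec al be ga k = mat k 1 (\<lambda>(i,_). phi al be ga (k - 1 - i))"

lemma Phi_vec_carrier [simp]: "Phi_vec al be ga k \<in> carrier_mat k 1"
  by (simp add: Phi_vec_def)

lemma M_Phi_carrier [simp]: "M_Phi al be ga k \<in> carrier_mat (k - 1) k"
  by (simp add: M_Phi_def)

lemma ekT_carrier [simp]: "ekT k \<in> carrier_mat 1 k"
  by (simp add: ekT_def)

lemma mD_Phi_carrier [simp]: "mD_Phi al be ga m k D \<in> carrier_mat m (k * m)"
  by (simp add: mD_Phi_def)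

lemma Dpoly_carrier [simp]: "Dpoly al be ga m k D \<in> carrier_mat m m"
  by (simp add: Dpoly_def)

lemma rat_pm_ekT: "rat_pm (ekT k) = ekT k"
  by (rule eq_matI) (auto simp: ekT_def)

text \<open>Row \<open>r\<close> applied to the basis column is the three-term recurrence with index
  \<open>k - 2 - r\<close>, all terms on one side.\<close>

lemma M_Phi_mult_Phi_vec:
  assumes al: "\<forall>j. al j \<noteq> 0"
  shows "M_Phi al be ga k * Phi_vec al be ga k = 0\<^sub>m (k - 1) 1"
proof (rule eq_matI)
  let ?f = "phi al be ga"
  fix r j assume "r < dim_row (0\<^sub>m (k - 1) 1)" "j < dim_col (0\<^sub>m (k - 1) 1)"
  then have r: "r < k - 1" "j = 0" "Suc r < k" by auto
  define t where "t = k - 2 - r"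
  have "(M_Phi al be ga k * Phi_vec al be ga k) $$ (r,j)
      = (\<Sum>c = 0..<k. (if c = r then [:- al t:] * ?f (Suc t) else 0) + (if c = r + 1 then [:- be t, 1:] * ?f t else 0)
        + (if c = r + 2 then [:- ga t:] * ?f (t - 1) else 0))"
    using r by (auto simp: M_Phi_def Phi_vec_def scalar_prod_def t_def Let_def Suc_diff_Suc numeral_2_eq_2 intro!: sum.cong)
  also have "\<dots> = [:- al t:] * ?f (Suc t) + [:- be t, 1:] * ?f t
        + (if r + 2 < k then [:- ga t:] * ?f (t - 1) else 0)"
    using r by (simp add: sum.distrib)
  also have "\<dots> = 0"
  \<comment> \<open>\<open>t = 0\<close> is the last row. Its gamma entry would lie outside the
    matrix, in agreement with phi_{-1} = 0, so the truncated \<open>t - 1\<close> never contributes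
    there.\<close>
  proof (cases t)
    case 0
    define X where "X = [:- be 0, 1:]"
    have "phi al be ga (Suc 0) = Polynomial.smult (1 / al 0) X" by (simp add: X_def)
    moreover have "pCons (- be 0) 1 = X" by (simp add: X_def)
    ultimately show ?thesis using r al 0 unfolding t_def by (simp del: phi.simps(2))
  next
    case (Suc t')
    then show ?thesis using r al unfolding t_def by (simp add: smult_diff_right)
  qed
  finally show "(M_Phi al be ga k * Phi_vec al be ga k) $$ (r,j) = 0\<^sub>m (k - 1) 1 $$ (r,j)"
    using r by simp
qed (auto simp: M_Phi_def Phi_vec_def)

lemma ekT_mult_Phi_vec: "1 \<le> k \<Longrightarrow> ekT k * Phi_vec al be ga k = 1\<^sub>m 1"
proof (rule eq_matI)
  fix i j assume k: "1 \<le> k" and "i < dim_row (1\<^sub>m 1)" "j < dim_col (1\<^sub>m 1)"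
  then have ij: "i = 0" "j = 0" by auto
  have "(ekT k * Phi_vec al be ga k) $$ (0,0) = (\<Sum>c = 0..<k. if c = k - 1 then 1 else 0)"
  proof -
    have "(ekT k * Phi_vec al be ga k) $$ (0,0) = (\<Sum>c = 0..<k. ekT k $$ (0,c) * Phi_vec al be ga k $$ (c,0))"
      by (simp add: ekT_def Phi_vec_def scalar_prod_def)
    also have "\<dots> = (\<Sum>c = 0..<k. if c = k - 1 then 1 else 0)"
      by (intro sum.cong) (auto simp: ekT_def Phi_vec_def)
    finally show ?thesis .
  qed
  then show "(ekT k * Phi_vec al be ga k) $$ (i,j) = 1\<^sub>m 1 $$ (i,j)" using k ij by simp
qed (auto simp: ekT_def Phi_vec_def)

text \<open>The bordered matrix is upper triangular with diagonal -alpha_{k-2}, ..., -alpha_0, 1. A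
  constant determinant means that its inverse is polynomial too.\<close>

lemma det_M_Phi_ekT:
  assumes al: "\<forall>j. al j \<noteq> 0" and k: "1 \<le> k"
  shows "\<exists>d. d \<noteq> 0 \<and> det (M_Phi al be ga k @\<^sub>r ekT k) = [:d:]"
proof -
  let ?U = "M_Phi al be ga k @\<^sub>r ekT k"
  have U: "?U \<in> carrier_mat k k"
    using carrier_append_rows[OF M_Phi_carrier ekT_carrier, of al be ga k] k by simp
  have "upper_triangular ?U"
    using k by (auto simp: append_rows_def M_Phi_def ekT_def Let_def upper_triangular_def)
  then have "det ?U = prod_list (diag_mat ?U)" by (rule det_upper_triangular[OF _ U])
  also have "diag_mat ?U = map (\<lambda>i. [:if i < k - 1 then - al (k - 2 - i) else 1:]) [0..<k]"
    unfolding diag_mat_def carrier_matD(1)[OF U]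
    by (rule map_cong) (use k in \<open>auto simp: append_rows_def M_Phi_def ekT_def\<close>)
  also have "prod_list \<dots> = [:prod_list (map (\<lambda>i. if i < k - 1 then - al (k - 2 - i) else 1) [0..<k]):]"
    by (simp add: poly_const.hom_prod_list o_def)
  finally show ?thesis using al by (intro exI conjI) (auto simp: prod_list_zero_iff)
qed

text \<open>Explains the shape of m^D_Phi: only phi_{k-1}, ..., phi_0 are available, so D_k phi_k is
  rewritten by the recurrence. Its two terms are the additions to the coefficients of phi_{k-1} and
  phi_{k-2}; the other blocks are the plain coefficients D_j.\<close>

lemma Phi_mult_mD_Phi:
  assumes al: "\<forall>j. al j \<noteq> 0" and k: "2 \<le> k"
  shows "kron (transpose_mat (Phi_vec al be ga k)) (1\<^sub>m m) * block_transpose m (mD_Phi al be ga m k D)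
    = Dpoly al be ga m k D"
proof (rule eq_matI)
  let ?f = "phi al be ga" and ?P = "Phi_vec al be ga k" and ?M = "mD_Phi al be ga m k D"
  obtain r where kr: "k = Suc (Suc r)" using k by (metis add_2_eq_Suc le_Suc_ex)
  fix i b assume "i < dim_row (Dpoly al be ga m k D)" "b < dim_col (Dpoly al be ga m k D)"
  then have ib: "i < m" "b < m" by (auto simp: Dpoly_def)
  have PT: "transpose_mat ?P \<in> carrier_mat 1 k" using Phi_vec_carrier[of al be ga k] by simp
  have "(kron (transpose_mat ?P) (1\<^sub>m m) * block_transpose m ?M) $$ (i,b)
      = (\<Sum>l = 0..<k * m. kron (transpose_mat ?P) (1\<^sub>m m) $$ (i,l) * block_transpose m ?M $$ (l,b))"
    using ib by (simp add: block_transpose_def mD_Phi_def scalar_prod_def Phi_vec_def)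
  also have "\<dots> = (\<Sum>p = 0..<k. \<Sum>q = 0..<m. if q = i then ?f (k - 1 - p) * ?M $$ (i, p * m + b) else 0)"
    unfolding sum_blocks
  proof (intro sum.cong refl)
    fix p q assume "p \<in> {0..<k}" "q \<in> {0..<m}"
    then have pq: "p < k" "q < m" by auto
    then show "kron (transpose_mat ?P) (1\<^sub>m m) $$ (i, p * m + q) * block_transpose m ?M $$ (p * m + q, b)
        = (if q = i then ?f (k - 1 - p) * ?M $$ (i, p * m + b) else 0)"
      using ib block_index_less[OF pq] by (subst kron_one_index[OF PT])
        (auto simp: block_transpose_def Phi_vec_def mD_Phi_def)
  qed
  also have "\<dots> = (\<Sum>p < k. ?f (k - 1 - p) * ?M $$ (i, p * m + b))"
    using ib by (simp add: lessThan_atLeast0)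
  \<comment> \<open>Put in the form required for reversing the order of summation, so that
    \<open>j\<close> becomes the index of the basis polynomial.\<close>
  also have "\<dots> = (\<Sum>p < k. (\<lambda>j. ?f j * ?M $$ (i, (k - 1 - j) * m + b)) (k - Suc p))"
    by (intro sum.cong) auto
  also have "\<dots> = (\<Sum>j < k. ?f j * ?M $$ (i, (k - 1 - j) * m + b))"
    by (rule sum.nat_diff_reindex)
  also have "\<dots> = (\<Sum>j < r. Polynomial.smult (D j $$ (i,b)) (?f j)) + ?f r * ?M $$ (i, m + b) + ?f (Suc r) * ?M $$ (i, b)"
  proof -
    have "?M $$ (i, (Suc r - j) * m + b) = [:D j $$ (i,b):]" if "j < r" for j
      using that ib block_index_less[of "Suc r - j" k b m] by (auto simp: mD_Phi_def kr Let_def)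
    then show ?thesis by (simp add: kr)
  qed
  also have "?M $$ (i, m + b) = [:D r $$ (i,b) - (ga (k-1) / al (k-1)) * D k $$ (i,b):]"
    using ib block_index_less[of 1 k b m] by (simp add: mD_Phi_def kr Let_def)
  also have "?M $$ (i, b) = Polynomial.smult (D k $$ (i,b)) (Polynomial.smult (1 / al (k-1)) [:- be (k-1), 1:]) + [:D (k-1) $$ (i,b):]"
    using ib block_index_less[of 0 k b m] by (simp add: mD_Phi_def kr)
  also have "(\<Sum>j < r. Polynomial.smult (D j $$ (i,b)) (?f j))
      + ?f r * [:D r $$ (i,b) - (ga (k-1) / al (k-1)) * D k $$ (i,b):]
      + ?f (Suc r) * (Polynomial.smult (D k $$ (i,b)) (Polynomial.smult (1 / al (k-1)) [:- be (k-1), 1:]) + [:D (k-1) $$ (i,b):])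
      = (\<Sum>j \<le> k. Polynomial.smult (D j $$ (i,b)) (?f j))"
  proof -
    have s: "{..Suc (Suc r)} = {..<Suc (Suc (Suc r))}" by auto
    define X where "X = [:- be (Suc r), 1:]"
    have fk: "?f (Suc (Suc r)) = Polynomial.smult (1 / al (Suc r)) (X * ?f (Suc r) - Polynomial.smult (ga (Suc r)) (?f r))"
      by (simp add: X_def)
    have "(\<Sum>j \<le> k. Polynomial.smult (D j $$ (i,b)) (?f j)) = (\<Sum>j < r. Polynomial.smult (D j $$ (i,b)) (?f j))
      + Polynomial.smult (D r $$ (i,b)) (?f r) + Polynomial.smult (D (Suc r) $$ (i,b)) (?f (Suc r))
      + Polynomial.smult (D k $$ (i,b)) (?f (Suc (Suc r)))"
      unfolding kr s sum.lessThan_Suc by (rule refl)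
    then show ?thesis unfolding fk kr diff_Suc_1 X_def[symmetric]
      by (simp del: phi.simps add: smult_diff_right smult_diff_left smult_add_right algebra_simps)
  qed
  finally show "(kron (transpose_mat ?P) (1\<^sub>m m) * block_transpose m ?M) $$ (i,b) = Dpoly al be ga m k D $$ (i,b)"
    using ib by (simp add: Dpoly_def)
qed (auto simp: Dpoly_def Phi_vec_def block_transpose_def mD_Phi_def)

section \<open>Null spaces of the block pencil\<close>

text \<open>Dimension conditions instead of carrier membership let the simplifier apply these rules without
  guessing intermediate dimensions.\<close>
lemma mult_mat_vec_dim_rules:
  fixes X Y :: "'b::comm_ring_1 mat"
  shows "dim_col X = dim_row Y \<Longrightarrow> dim_vec v = dim_col Y \<Longrightarrow> (X * Y) *\<^sub>v v = X *\<^sub>v (Y *\<^sub>v v)"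
    "dim_vec u = dim_col X \<Longrightarrow> dim_vec v = dim_col X \<Longrightarrow> X *\<^sub>v (u + v) = X *\<^sub>v u + X *\<^sub>v v"
    "dim_vec v = dim_col X \<Longrightarrow> X *\<^sub>v (- v) = - (X *\<^sub>v v)"
    "dim_row X = dim_row Y \<Longrightarrow> dim_col X = dim_col Y \<Longrightarrow> dim_vec v = dim_col Y \<Longrightarrow> (X + Y) *\<^sub>v v = X *\<^sub>v v + Y *\<^sub>v v"
    "dim_vec v = dim_col X \<Longrightarrow> (- X) *\<^sub>v v = - (X *\<^sub>v v)"
    "dim_col X = dim_col Y \<Longrightarrow> dim_vec v = dim_col Y \<Longrightarrow> (X @\<^sub>r Y) *\<^sub>v v = X *\<^sub>v v @\<^sub>v Y *\<^sub>v v"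
proof -
  assume "dim_col X = dim_row Y" "dim_vec v = dim_col Y"
  then show "(X * Y) *\<^sub>v v = X *\<^sub>v (Y *\<^sub>v v)"
    by (intro assoc_mult_mat_vec[of _ "dim_row X" "dim_col X" _ "dim_col Y"]) (auto intro!: carrier_matI carrier_vecI)
next
  assume "dim_vec u = dim_col X" "dim_vec v = dim_col X"
  then show "X *\<^sub>v (u + v) = X *\<^sub>v u + X *\<^sub>v v"
    by (intro mult_add_distrib_mat_vec[of _ "dim_row X" "dim_col X"]) (auto intro!: carrier_matI carrier_vecI)
next
  assume "dim_vec v = dim_col X"
  then show "X *\<^sub>v (- v) = - (X *\<^sub>v v)" "(- X) *\<^sub>v v = - (X *\<^sub>v v)"
    by (auto intro!: eq_vecI simp: scalar_prod_def sum_negf)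
next
  assume "dim_row X = dim_row Y" "dim_col X = dim_col Y" "dim_vec v = dim_col Y"
  then show "(X + Y) *\<^sub>v v = X *\<^sub>v v + Y *\<^sub>v v"
    by (intro add_mult_distrib_mat_vec[of _ "dim_row X" "dim_col X"]) (auto intro!: carrier_matI carrier_vecI)
next
  assume "dim_col X = dim_col Y" "dim_vec v = dim_col Y"
  then show "(X @\<^sub>r Y) *\<^sub>v v = X *\<^sub>v v @\<^sub>v Y *\<^sub>v v"
    by (intro append_rows_mult_vec[of _ "dim_row X" "dim_col X" _ "dim_row Y"]) (auto intro!: carrier_matI carrier_vecI)
qed

lemma transpose_mult_dim:
  fixes X Y :: "'b::comm_ring_1 mat"
  shows "dim_col X = dim_row Y \<Longrightarrow> transpose_mat (X * Y) = transpose_mat Y * transpose_mat X"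
  by (intro transpose_mult[of _ "dim_row X" "dim_col X" _ "dim_col Y"]) (auto intro!: carrier_matI)

lemma transpose_uminus: "transpose_mat (- X) = - transpose_mat X"
  by (rule eq_matI) auto

lemma append_rows_dim [simp]:
  "dim_row (X @\<^sub>r Y) = dim_row X + dim_row Y" "dim_col (X @\<^sub>r Y) = dim_col X"
  by (auto simp: append_rows_def)

text \<open>The bottom blocks have height zero: this is how \<^const>\<open>L2\<close> writes a row of blocks.\<close>
definition beside :: "'b::zero mat \<Rightarrow> 'b mat \<Rightarrow> 'b mat" where
  "beside X Y = four_block_mat X Y (0\<^sub>m 0 (dim_col X)) (0\<^sub>m 0 (dim_col Y))"

lemma beside_dim [simp]: "dim_row (beside X Y) = dim_row X" "dim_col (beside X Y) = dim_col X + dim_col Y"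
  by (auto simp: beside_def)

lemma beside_mult_append:
  fixes X Y :: "'b::comm_ring_1 mat"
  shows "dim_row X = dim_row Y \<Longrightarrow> dim_vec u = dim_col X \<Longrightarrow> dim_vec v = dim_col Y \<Longrightarrow>
    beside X Y *\<^sub>v (u @\<^sub>v v) = X *\<^sub>v u + Y *\<^sub>v v"
  unfolding beside_def
  by (intro beside_mult_vec[of _ "dim_row X"]) (auto intro!: carrier_matI carrier_vecI)

lemma transpose_beside:
  "dim_row X = dim_row Y \<Longrightarrow> transpose_mat (beside X Y) = transpose_mat X @\<^sub>r transpose_mat Y"
  by (rule eq_matI) (auto simp: beside_def append_rows_def)

lemma transpose_four_block_dim:
  "dim_row X = dim_row Y \<Longrightarrow> dim_row Z = dim_row W \<Longrightarrow> dim_col X = dim_col Z \<Longrightarrow> dim_col Y = dim_col W \<Longrightarrow>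
   transpose_mat (four_block_mat X Y Z W)
    = four_block_mat (transpose_mat X) (transpose_mat Z) (transpose_mat Y) (transpose_mat W)"
  by (rule eq_matI) auto

lemma four_block_mult_append:
  fixes X Y Z W :: "'b::comm_ring_1 mat"
  shows "dim_row X = dim_row Y \<Longrightarrow> dim_row Z = dim_row W \<Longrightarrow> dim_col X = dim_col Z \<Longrightarrow> dim_col Y = dim_col W \<Longrightarrow>
   dim_vec u = dim_col X \<Longrightarrow> dim_vec v = dim_col W \<Longrightarrow>
   four_block_mat X Y Z W *\<^sub>v (u @\<^sub>v v) = (X *\<^sub>v u + Y *\<^sub>v v) @\<^sub>v (Z *\<^sub>v u + W *\<^sub>v v)"
  by (intro four_block_mat_mult_vec[of _ "dim_row X" "dim_col X" _ "dim_col Y" _ "dim_row Z"])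
    (auto intro!: carrier_matI carrier_vecI)

lemma right_null_iff: "dim_vec x = dim_col X \<Longrightarrow> x \<in> right_null X \<longleftrightarrow> X *\<^sub>v x = 0\<^sub>v (dim_row X)"
  by (auto simp: right_null_def intro: carrier_vecI)

lemma vec_add_eq_zero:
  fixes u v :: "'b::ab_group_add vec"
  shows "dim_vec u = d \<Longrightarrow> dim_vec v = d \<Longrightarrow> u + v = 0\<^sub>v d \<longleftrightarrow> u = - v"
proof
  assume d: "dim_vec u = d" "dim_vec v = d" and eq: "u + v = 0\<^sub>v d"
  show "u = - v"
  proof (rule eq_vecI)
    fix i assume "i < dim_vec (- v)"
    then show "u $ i = (- v) $ i" using arg_cong[OF eq, of "\<lambda>x. x $ i"] d
      by (simp add: eq_neg_iff_add_eq_0)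
  qed (use d in simp)
qed (auto intro!: eq_vecI)

lemma append_eq_zero:
  "dim_vec u = a \<Longrightarrow> dim_vec v = b \<Longrightarrow> u @\<^sub>v v = 0\<^sub>v (a + b) \<longleftrightarrow> u = 0\<^sub>v a \<and> v = 0\<^sub>v b"
proof -
  assume d: "dim_vec u = a" "dim_vec v = b"
  have "0\<^sub>v (a + b) = 0\<^sub>v a @\<^sub>v 0\<^sub>v b" by (rule eq_vecI) auto
  moreover have "u \<in> carrier_vec a" using d by (intro carrier_vecI)
  note append_vec_eq[OF this zero_carrier_vec[of a], of v "0\<^sub>v b"]
  ultimately show ?thesis by metis
qed

lemma vec_split:
  assumes "dim_vec x = a + b"
  obtains u v where "x = u @\<^sub>v v" "dim_vec u = a" "dim_vec v = b"
  using assms vec_first_last_append[of x a b] by (metis carrier_vecI dim_vec_first dim_vec_last)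

text \<open>Here \<open>Ek\<close> stands for the block column of $e_k$, \<open>W1\<close> and \<open>W2\<close> for $w^T \otimes I$ and $J^B$, and
  \<open>Nh\<close>, \<open>Pt\<close> are the two block rows of the inverse of \<open>[Mt Ek]\<close>.\<close>
locale block_pencil =
  fixes n m N q :: nat and F Fi Tr Ti Sr Si Br Cr Dr Mb Mt Nh Ek Pt W1 W2 Wi :: "'b::field mat"
  assumes
    carrier: "F \<in> carrier_mat n n" "Fi \<in> carrier_mat n n" "Tr \<in> carrier_mat n n" "Ti \<in> carrier_mat n n"
      "Sr \<in> carrier_mat n n" "Si \<in> carrier_mat n n" "Br \<in> carrier_mat n m" "Cr \<in> carrier_mat m n"
      "Dr \<in> carrier_mat m m" "Mb \<in> carrier_mat N m" "Mt \<in> carrier_mat N q" "Nh \<in> carrier_mat q N"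
      "Ek \<in> carrier_mat N m" "Pt \<in> carrier_mat m N" "W1 \<in> carrier_mat m N" "W2 \<in> carrier_mat q N"
      "Wi \<in> carrier_mat N N"
    and N: "N = m + q"
    and F_inv: "F * Fi = 1\<^sub>m n" "Fi * F = 1\<^sub>m n"
    and T_inv: "Tr * Ti = 1\<^sub>m n" "Ti * Tr = 1\<^sub>m n"
    and S_inv: "Sr * Si = 1\<^sub>m n" "Si * Sr = 1\<^sub>m n"
    and W_inv: "(W1 @\<^sub>r W2) * Wi = 1\<^sub>m N" "Wi * (W1 @\<^sub>r W2) = 1\<^sub>m N"
    and Nh_Mt: "Nh * Mt = 1\<^sub>m q" and Nh_Ek: "Nh * Ek = 0\<^sub>m q m"
    and Pt_Mt: "Pt * Mt = 0\<^sub>m m q" and Pt_Ek: "Pt * Ek = 1\<^sub>m m"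
    and resolution: "Mt * Nh + Ek * Pt = 1\<^sub>m N"
    and Pt_Mb: "Pt * Mb = Dr"
begin

definition G where "G = Dr + Cr * Fi * Br"

definition K where "K = four_block_mat (Tr * F * Sr) (beside (Tr * Br) (0\<^sub>m n q)) (- (Ek * (Cr * Sr))) (beside Mb Mt)"

definition L where "L = K * four_block_mat (1\<^sub>m n) (0\<^sub>m n N) (0\<^sub>m N n) (W1 @\<^sub>r W2)"

text \<open>The solution of the block equations for given y: the lower part is the preimage under W
  of y stacked over the component forced by the rows \<open>Nh\<close>.\<close>

definition right_lift where "right_lift = - (Si * Fi * Br) @\<^sub>r Wi * (1\<^sub>m m @\<^sub>r - (Nh * Mb))"

definition right_drop where "right_drop = beside (0\<^sub>m m n) W1"

definition left_lift where "left_lift = transpose_mat (Cr * Fi * Ti) @\<^sub>r transpose_mat Pt"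

definition left_drop where "left_drop = beside (0\<^sub>m m n) (transpose_mat Ek)"

lemmas dims [simp] = carrier[THEN carrier_matD(1)] carrier[THEN carrier_matD(2)]

lemma result_dims [simp]:
  "dim_row G = m" "dim_col G = m" "dim_row K = n + N" "dim_col K = n + N" "dim_row L = n + N" "dim_col L = n + N"
  "dim_row right_lift = n + N" "dim_col right_lift = m" "dim_row right_drop = m" "dim_col right_drop = n + N"
  "dim_row left_lift = n + N" "dim_col left_lift = m" "dim_row left_drop = m" "dim_col left_drop = n + N"
  by (auto simp: G_def K_def L_def right_lift_def right_drop_def left_lift_def left_drop_def N[symmetric])

lemma apply_eq:
  assumes "X * Y = Z" "dim_col X = dim_row Y" "dim_vec v = dim_col Y"
  shows "X *\<^sub>v (Y *\<^sub>v v) = (Z :: 'b mat) *\<^sub>v v"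
  using assms mult_mat_vec_dim_rules(1)[of X Y v] by simp

lemma one_mult_vec: "dim_vec v = d \<Longrightarrow> 1\<^sub>m d *\<^sub>v v = (v :: 'b vec)"
  by (intro one_mult_mat_vec carrier_vecI)

lemma zero_mult_vec: "dim_vec v = d \<Longrightarrow> 0\<^sub>m c d *\<^sub>v v = (0\<^sub>v c :: 'b vec)"
  by (intro zero_mat_mult_vec carrier_vecI)

lemma mult_zero_vec: "dim_col X = d \<Longrightarrow> dim_row X = c \<Longrightarrow> X *\<^sub>v 0\<^sub>v d = (0\<^sub>v c :: 'b vec)"
  by (rule eq_vecI) (auto simp: scalar_prod_def)

lemma transpose_eq:
  assumes "X * Y = Z" "dim_col X = dim_row Y"
  shows "transpose_mat Y * transpose_mat X = (transpose_mat Z :: 'b mat)"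
  using assms transpose_mult_dim[of X Y] by simp

lemma cancel:
  assumes "dim_vec v = n"
  shows "F *\<^sub>v (Fi *\<^sub>v v) = v" "Fi *\<^sub>v (F *\<^sub>v v) = v" "Tr *\<^sub>v (Ti *\<^sub>v v) = v" "Ti *\<^sub>v (Tr *\<^sub>v v) = v"
    "Sr *\<^sub>v (Si *\<^sub>v v) = v" "Si *\<^sub>v (Sr *\<^sub>v v) = v"
  using assms by (simp_all add: apply_eq[OF F_inv(1)] apply_eq[OF F_inv(2)] apply_eq[OF T_inv(1)]
      apply_eq[OF T_inv(2)] apply_eq[OF S_inv(1)] apply_eq[OF S_inv(2)] one_mult_vec)

lemma cancel_transpose:
  assumes "dim_vec v = n"
  shows "transpose_mat F *\<^sub>v (transpose_mat Fi *\<^sub>v v) = v" "transpose_mat Fi *\<^sub>v (transpose_mat F *\<^sub>v v) = v"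
    "transpose_mat Tr *\<^sub>v (transpose_mat Ti *\<^sub>v v) = v" "transpose_mat Ti *\<^sub>v (transpose_mat Tr *\<^sub>v v) = v"
    "transpose_mat Sr *\<^sub>v (transpose_mat Si *\<^sub>v v) = v" "transpose_mat Si *\<^sub>v (transpose_mat Sr *\<^sub>v v) = v"
  using assms by (simp_all add: apply_eq[OF transpose_eq[OF F_inv(1)]] apply_eq[OF transpose_eq[OF F_inv(2)]]
      apply_eq[OF transpose_eq[OF T_inv(1)]] apply_eq[OF transpose_eq[OF T_inv(2)]]
      apply_eq[OF transpose_eq[OF S_inv(1)]] apply_eq[OF transpose_eq[OF S_inv(2)]] one_mult_vec)

lemma cancel_W:
  assumes "dim_vec v = N"
  shows "Wi *\<^sub>v (W1 *\<^sub>v v @\<^sub>v W2 *\<^sub>v v) = v" "W1 *\<^sub>v (Wi *\<^sub>v v) @\<^sub>v W2 *\<^sub>v (Wi *\<^sub>v v) = v"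
  using apply_eq[OF W_inv(2), of v] apply_eq[OF W_inv(1), of v] assms
  by (simp_all add: N[symmetric] mult_mat_vec_dim_rules one_mult_vec)

lemma resolve:
  assumes "dim_vec v = N" shows "Mt *\<^sub>v (Nh *\<^sub>v v) + Ek *\<^sub>v (Pt *\<^sub>v v) = v"
  using assms arg_cong[OF resolution, of "\<lambda>X. X *\<^sub>v v"] by (simp add: mult_mat_vec_dim_rules one_mult_vec)

lemma L_mult:
  assumes "dim_vec x1 = n" "dim_vec x2 = N"
  shows "L *\<^sub>v (x1 @\<^sub>v x2) = Tr *\<^sub>v (F *\<^sub>v (Sr *\<^sub>v x1) + Br *\<^sub>v (W1 *\<^sub>v x2))
    @\<^sub>v (Mb *\<^sub>v (W1 *\<^sub>v x2) + Mt *\<^sub>v (W2 *\<^sub>v x2) + - (Ek *\<^sub>v (Cr *\<^sub>v (Sr *\<^sub>v x1))))"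
proof -
  have "four_block_mat (1\<^sub>m n) (0\<^sub>m n N) (0\<^sub>m N n) (W1 @\<^sub>r W2) *\<^sub>v (x1 @\<^sub>v x2)
      = x1 @\<^sub>v (W1 *\<^sub>v x2 @\<^sub>v W2 *\<^sub>v x2)"
    using assms by (subst four_block_mult_append)
      (auto simp: N[symmetric] one_mult_vec zero_mult_vec mult_mat_vec_dim_rules intro!: eq_vecI)
  then have "L *\<^sub>v (x1 @\<^sub>v x2) = K *\<^sub>v (x1 @\<^sub>v (W1 *\<^sub>v x2 @\<^sub>v W2 *\<^sub>v x2))"
    unfolding L_def using assms by (simp add: mult_mat_vec_dim_rules N[symmetric])
  also have "\<dots> = (Tr *\<^sub>v (F *\<^sub>v (Sr *\<^sub>v x1)) + (Tr *\<^sub>v (Br *\<^sub>v (W1 *\<^sub>v x2)) + 0\<^sub>v n))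
    @\<^sub>v (- (Ek *\<^sub>v (Cr *\<^sub>v (Sr *\<^sub>v x1))) + (Mb *\<^sub>v (W1 *\<^sub>v x2) + Mt *\<^sub>v (W2 *\<^sub>v x2)))"
    unfolding K_def using assms
    by (simp add: four_block_mult_append N[symmetric] beside_mult_append mult_mat_vec_dim_rules zero_mult_vec)
  also have "\<dots> = Tr *\<^sub>v (F *\<^sub>v (Sr *\<^sub>v x1) + Br *\<^sub>v (W1 *\<^sub>v x2))
    @\<^sub>v (Mb *\<^sub>v (W1 *\<^sub>v x2) + Mt *\<^sub>v (W2 *\<^sub>v x2) + - (Ek *\<^sub>v (Cr *\<^sub>v (Sr *\<^sub>v x1))))"
  proof -
    have "u + (v + 0\<^sub>v n) = u + v" if "dim_vec u = n" "dim_vec v = n" for u v :: "'b vec"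
      using that by (intro eq_vecI) auto
    moreover have "- u + (v + x) = v + x + - u" if "dim_vec u = N" "dim_vec v = N" "dim_vec x = N" for u v x :: "'b vec"
      using that by (intro eq_vecI) auto
    ultimately show ?thesis using assms by (simp add: mult_mat_vec_dim_rules)
  qed
  finally show ?thesis .
qed

text \<open>Block elimination. The upper row determines the state, \<open>Tr\<close> and
  \<open>F\<close> being invertible. The lower row is tested with the two block rows of the inverse
  of [Mt Ek]: \<open>Nh\<close> determines \<open>W2 *\<^sub>v x2\<close>, and \<open>Pt\<close>
  leaves the equation for G.\<close>

lemma right_null_L:
  assumes d: "dim_vec x1 = n" "dim_vec x2 = N" and y: "y = W1 *\<^sub>v x2"
  shows "x1 @\<^sub>v x2 \<in> right_null L \<longleftrightarrow> y \<in> right_null G \<and> x1 = - (Si *\<^sub>v (Fi *\<^sub>v (Br *\<^sub>v y)))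
    \<and> W2 *\<^sub>v x2 = - (Nh *\<^sub>v (Mb *\<^sub>v y))"
proof -
  define z where "z = W2 *\<^sub>v x2"
  define v where "v = Sr *\<^sub>v x1"
  have dd[simp]: "dim_vec y = m" "dim_vec z = q" "dim_vec v = n" by (auto simp: y z_def v_def)
  define t where "t = F *\<^sub>v v + Br *\<^sub>v y"
  define b where "b = Mb *\<^sub>v y + Mt *\<^sub>v z + - (Ek *\<^sub>v (Cr *\<^sub>v v))"
  have td[simp]: "dim_vec t = n" "dim_vec b = N" by (auto simp: t_def b_def)
  have "x1 @\<^sub>v x2 \<in> right_null L \<longleftrightarrow> Tr *\<^sub>v t @\<^sub>v b = 0\<^sub>v (n + N)"
    unfolding right_null_def using d L_mult[OF d]
    by (auto simp: y z_def v_def t_def b_def intro!: carrier_vecI)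
  also have "\<dots> \<longleftrightarrow> Tr *\<^sub>v t = 0\<^sub>v n \<and> b = 0\<^sub>v N" by (rule append_eq_zero) auto
  also have "Tr *\<^sub>v t = 0\<^sub>v n \<longleftrightarrow> t = 0\<^sub>v n"
    using cancel(4)[of t] by (metis dims td(1) mult_zero_vec)
  also have "t = 0\<^sub>v n \<longleftrightarrow> F *\<^sub>v v = - (Br *\<^sub>v y)" unfolding t_def by (rule vec_add_eq_zero) auto
  also have "\<dots> \<longleftrightarrow> v = - (Fi *\<^sub>v (Br *\<^sub>v y))"
  proof
    assume "F *\<^sub>v v = - (Br *\<^sub>v y)"
    then show "v = - (Fi *\<^sub>v (Br *\<^sub>v y))" using cancel(2)[of v] by (simp add: mult_mat_vec_dim_rules)
  next
    assume v: "v = - (Fi *\<^sub>v (Br *\<^sub>v y))"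
    show "F *\<^sub>v v = - (Br *\<^sub>v y)" unfolding v by (simp add: mult_mat_vec_dim_rules cancel)
  qed
  also have "v = - (Fi *\<^sub>v (Br *\<^sub>v y)) \<longleftrightarrow> x1 = - (Si *\<^sub>v (Fi *\<^sub>v (Br *\<^sub>v y)))"
  proof
    assume "v = - (Fi *\<^sub>v (Br *\<^sub>v y))"
    then show "x1 = - (Si *\<^sub>v (Fi *\<^sub>v (Br *\<^sub>v y)))"
      using cancel(6)[of x1] d by (simp add: v_def mult_mat_vec_dim_rules)
  next
    assume v: "x1 = - (Si *\<^sub>v (Fi *\<^sub>v (Br *\<^sub>v y)))"
    show "v = - (Fi *\<^sub>v (Br *\<^sub>v y))" unfolding v_def v by (simp add: mult_mat_vec_dim_rules cancel)
  qed
  \<comment> \<open>By the resolution of the identity a vector is zero iff its \<open>Nh\<close> and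
    \<open>Pt\<close> components are.\<close>
  also have "b = 0\<^sub>v N \<longleftrightarrow> Nh *\<^sub>v b = 0\<^sub>v q \<and> Pt *\<^sub>v b = 0\<^sub>v m"
  proof
    assume "Nh *\<^sub>v b = 0\<^sub>v q \<and> Pt *\<^sub>v b = 0\<^sub>v m"
    then show "b = 0\<^sub>v N" using resolve[of b] by (simp add: mult_zero_vec)
  qed (simp add: mult_zero_vec)
  also have "Nh *\<^sub>v b = z + Nh *\<^sub>v (Mb *\<^sub>v y)"
    unfolding b_def by (rule eq_vecI)
      (simp_all add: mult_mat_vec_dim_rules apply_eq[OF Nh_Mt] apply_eq[OF Nh_Ek] one_mult_vec zero_mult_vec)
  also have "z + Nh *\<^sub>v (Mb *\<^sub>v y) = 0\<^sub>v q \<longleftrightarrow> z = - (Nh *\<^sub>v (Mb *\<^sub>v y))"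
    by (rule vec_add_eq_zero) auto
  \<comment> \<open>\<open>Pt\<close> annihilates \<open>Mt\<close>, so the unknown \<open>z\<close>
    disappears; once the state is substituted, this component becomes G y.\<close>
  also have "Pt *\<^sub>v b = Dr *\<^sub>v y + - (Cr *\<^sub>v v)"
    unfolding b_def by (rule eq_vecI)
      (simp_all add: mult_mat_vec_dim_rules apply_eq[OF Pt_Mb] apply_eq[OF Pt_Mt] apply_eq[OF Pt_Ek] one_mult_vec zero_mult_vec)
  finally have main: "x1 @\<^sub>v x2 \<in> right_null L \<longleftrightarrow> x1 = - (Si *\<^sub>v (Fi *\<^sub>v (Br *\<^sub>v y))) \<and>
      z = - (Nh *\<^sub>v (Mb *\<^sub>v y)) \<and> Dr *\<^sub>v y + - (Cr *\<^sub>v v) = 0\<^sub>v m" .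
  have "Dr *\<^sub>v y + - (Cr *\<^sub>v v) = G *\<^sub>v y" if "x1 = - (Si *\<^sub>v (Fi *\<^sub>v (Br *\<^sub>v y)))"
    unfolding v_def that G_def by (simp add: mult_mat_vec_dim_rules cancel)
  moreover have "y \<in> right_null G \<longleftrightarrow> G *\<^sub>v y = 0\<^sub>v m"
    by (auto simp: right_null_def intro!: carrier_vecI)
  ultimately show ?thesis using main unfolding z_def by metis
qed

lemma right_lift_mult:
  assumes "dim_vec y = m"
  shows "right_lift *\<^sub>v y = - (Si *\<^sub>v (Fi *\<^sub>v (Br *\<^sub>v y))) @\<^sub>v Wi *\<^sub>v (y @\<^sub>v - (Nh *\<^sub>v (Mb *\<^sub>v y)))"
  using assms by (simp add: right_lift_def mult_mat_vec_dim_rules one_mult_vec N[symmetric])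

lemma right_drop_mult:
  "dim_vec x1 = n \<Longrightarrow> dim_vec x2 = N \<Longrightarrow> right_drop *\<^sub>v (x1 @\<^sub>v x2) = W1 *\<^sub>v x2"
  by (auto simp: right_drop_def beside_mult_append zero_mult_vec intro!: eq_vecI)

lemma W_Wi:
  assumes "dim_vec y = m" "dim_vec z = q"
  shows "W1 *\<^sub>v (Wi *\<^sub>v (y @\<^sub>v z)) = y" "W2 *\<^sub>v (Wi *\<^sub>v (y @\<^sub>v z)) = z"
proof -
  have "W1 *\<^sub>v (Wi *\<^sub>v (y @\<^sub>v z)) @\<^sub>v W2 *\<^sub>v (Wi *\<^sub>v (y @\<^sub>v z)) = y @\<^sub>v z"
    using assms by (intro cancel_W) (simp add: N[symmetric])
  then show "W1 *\<^sub>v (Wi *\<^sub>v (y @\<^sub>v z)) = y" "W2 *\<^sub>v (Wi *\<^sub>v (y @\<^sub>v z)) = z"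
    using append_vec_eq[of "W1 *\<^sub>v (Wi *\<^sub>v (y @\<^sub>v z))" m y "W2 *\<^sub>v (Wi *\<^sub>v (y @\<^sub>v z))" z]
      carrier_vecI[OF assms(1)] mult_mat_vec_carrier[OF carrier(15), of "Wi *\<^sub>v (y @\<^sub>v z)"]
      carrier_vecI[of "Wi *\<^sub>v (y @\<^sub>v z)" N] by simp_all
qed

lemma right_lift_null:
  assumes "y \<in> right_null G"
  shows "right_lift *\<^sub>v y \<in> right_null L" "right_drop *\<^sub>v (right_lift *\<^sub>v y) = y"
proof -
  have d: "dim_vec y = m" using assms by (auto simp: right_null_def)
  show "right_lift *\<^sub>v y \<in> right_null L"
    unfolding right_lift_mult[OF d] using assms d by (subst right_null_L[OF _ _ refl]) (auto simp: W_Wi)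
  show "right_drop *\<^sub>v (right_lift *\<^sub>v y) = y"
    unfolding right_lift_mult[OF d] using d by (subst right_drop_mult) (auto simp: W_Wi)
qed

lemma right_drop_null:
  assumes "x \<in> right_null L"
  shows "right_drop *\<^sub>v x \<in> right_null G" "right_lift *\<^sub>v (right_drop *\<^sub>v x) = x"
proof -
  have "dim_vec x = n + N" using assms by (auto simp: right_null_def)
  then obtain x1 x2 where x: "x = x1 @\<^sub>v x2" and d: "dim_vec x1 = n" "dim_vec x2 = N"
    by (rule vec_split)
  note eqs = assms[unfolded x right_null_L[OF d refl]]
  show "right_drop *\<^sub>v x \<in> right_null G" using eqs unfolding x right_drop_mult[OF d] by blast
  have "right_lift *\<^sub>v (W1 *\<^sub>v x2) = x1 @\<^sub>v Wi *\<^sub>v (W1 *\<^sub>v x2 @\<^sub>v W2 *\<^sub>v x2)"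
    using eqs by (subst right_lift_mult) auto
  then show "right_lift *\<^sub>v (right_drop *\<^sub>v x) = x" unfolding x right_drop_mult[OF d] using d by (simp add: cancel_W)
qed

text \<open>The invertible factors S and W drop out. The transposed \<open>Mt\<close> equation
  confines u to the range of the transposed \<open>Pt\<close>, so its last block v is the only
  freedom; the state equation then gives x1, and the equation left over is the transposed G applied
  to v.\<close>

lemma transpose_L_null:
  assumes d: "dim_vec x1 = n" "dim_vec u = N" and v: "v = transpose_mat Ek *\<^sub>v u"
  shows "x1 @\<^sub>v u \<in> right_null (transpose_mat L) \<longleftrightarrow> v \<in> right_null (transpose_mat G)
    \<and> x1 = transpose_mat (Cr * Fi * Ti) *\<^sub>v v \<and> u = transpose_mat Pt *\<^sub>v v"
proof -
  define W where "W = W1 @\<^sub>r W2"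
  have Wd[simp]: "dim_row W = N" "dim_col W = N" by (auto simp: W_def N)
  have vd[simp]: "dim_vec v = m" by (simp add: v)
  let ?B = "four_block_mat (1\<^sub>m n) (0\<^sub>m n N) (0\<^sub>m N n) W"
  have LT: "transpose_mat L = transpose_mat ?B * transpose_mat K"
    unfolding L_def W_def[symmetric] by (rule transpose_mult_dim) simp
  define t where "t = transpose_mat F *\<^sub>v (transpose_mat Tr *\<^sub>v x1) + - (transpose_mat Cr *\<^sub>v v)"
  define b where "b = transpose_mat Br *\<^sub>v (transpose_mat Tr *\<^sub>v x1) + transpose_mat Mb *\<^sub>v u"
  define c where "c = transpose_mat Mt *\<^sub>v u"
  have td[simp]: "dim_vec t = n" "dim_vec b = m" "dim_vec c = q" by (auto simp: t_def b_def c_def)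
  have "transpose_mat K *\<^sub>v (x1 @\<^sub>v u) = (transpose_mat Sr *\<^sub>v t) @\<^sub>v (b @\<^sub>v c)"
  proof -
    have 1: "transpose_mat (- (Ek * (Cr * Sr))) *\<^sub>v u = - (transpose_mat Sr *\<^sub>v (transpose_mat Cr *\<^sub>v v))"
      using d by (simp add: transpose_uminus transpose_mult_dim mult_mat_vec_dim_rules v)
    have 2: "transpose_mat (Tr * F * Sr) *\<^sub>v x1 = transpose_mat Sr *\<^sub>v (transpose_mat F *\<^sub>v (transpose_mat Tr *\<^sub>v x1))"
      using d by (simp add: transpose_mult_dim mult_mat_vec_dim_rules)
    have 3: "transpose_mat (beside (Tr * Br) (0\<^sub>m n q)) *\<^sub>v x1 = transpose_mat Br *\<^sub>v (transpose_mat Tr *\<^sub>v x1) @\<^sub>v 0\<^sub>v q"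
      using d by (simp add: transpose_beside transpose_mult_dim mult_mat_vec_dim_rules zero_mult_vec)
    have 4: "transpose_mat (beside Mb Mt) *\<^sub>v u = transpose_mat Mb *\<^sub>v u @\<^sub>v c"
      using d by (simp add: transpose_beside mult_mat_vec_dim_rules c_def)
    have "transpose_mat K *\<^sub>v (x1 @\<^sub>v u) = (transpose_mat Sr *\<^sub>v (transpose_mat F *\<^sub>v (transpose_mat Tr *\<^sub>v x1))
       + - (transpose_mat Sr *\<^sub>v (transpose_mat Cr *\<^sub>v v))) @\<^sub>v
       ((transpose_mat Br *\<^sub>v (transpose_mat Tr *\<^sub>v x1) @\<^sub>v 0\<^sub>v q) + (transpose_mat Mb *\<^sub>v u @\<^sub>v c))"
      unfolding K_def using d
      by (simp add: transpose_four_block_dim four_block_mult_append N[symmetric] 1 2 3 4)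
    also have "(transpose_mat Br *\<^sub>v (transpose_mat Tr *\<^sub>v x1) @\<^sub>v 0\<^sub>v q) + (transpose_mat Mb *\<^sub>v u @\<^sub>v c) = b @\<^sub>v c"
      unfolding b_def by (rule eq_vecI) auto
    also have "transpose_mat Sr *\<^sub>v (transpose_mat F *\<^sub>v (transpose_mat Tr *\<^sub>v x1))
       + - (transpose_mat Sr *\<^sub>v (transpose_mat Cr *\<^sub>v v)) = transpose_mat Sr *\<^sub>v t"
      unfolding t_def by (simp add: mult_mat_vec_dim_rules)
    finally show ?thesis .
  qed
  then have "transpose_mat L *\<^sub>v (x1 @\<^sub>v u) = transpose_mat ?B *\<^sub>v (transpose_mat Sr *\<^sub>v t @\<^sub>v (b @\<^sub>v c))"
    unfolding LT using d by (simp add: mult_mat_vec_dim_rules)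
  also have "\<dots> = transpose_mat Sr *\<^sub>v t @\<^sub>v transpose_mat W *\<^sub>v (b @\<^sub>v c)"
    by (simp add: transpose_four_block_dim four_block_mult_append N[symmetric] one_mult_vec zero_mult_vec)
      (auto intro!: arg_cong2[of _ _ _ _ append_vec] eq_vecI simp: N[symmetric])
  finally have L: "transpose_mat L *\<^sub>v (x1 @\<^sub>v u) = transpose_mat Sr *\<^sub>v t @\<^sub>v transpose_mat W *\<^sub>v (b @\<^sub>v c)" .
  have "x1 @\<^sub>v u \<in> right_null (transpose_mat L) \<longleftrightarrow>
     transpose_mat Sr *\<^sub>v t @\<^sub>v transpose_mat W *\<^sub>v (b @\<^sub>v c) = 0\<^sub>v (n + N)"
    using d right_null_iff[of "x1 @\<^sub>v u" "transpose_mat L"] by (simp add: L)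
  also have "\<dots> \<longleftrightarrow> transpose_mat Sr *\<^sub>v t = 0\<^sub>v n \<and> transpose_mat W *\<^sub>v (b @\<^sub>v c) = 0\<^sub>v N"
    by (rule append_eq_zero) auto
  also have "transpose_mat Sr *\<^sub>v t = 0\<^sub>v n \<longleftrightarrow> t = 0\<^sub>v n"
    using cancel_transpose(5,6)[of t] mult_zero_vec[of "transpose_mat Sr" n n] mult_zero_vec[of "transpose_mat Si" n n]
    by auto
  also have "transpose_mat W *\<^sub>v (b @\<^sub>v c) = 0\<^sub>v N \<longleftrightarrow> b @\<^sub>v c = 0\<^sub>v (m + q)"
  proof
    assume z: "transpose_mat W *\<^sub>v (b @\<^sub>v c) = 0\<^sub>v N"
    have "transpose_mat Wi *\<^sub>v (transpose_mat W *\<^sub>v (b @\<^sub>v c)) = b @\<^sub>v c"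
      using apply_eq[OF transpose_eq[OF W_inv(1)[folded W_def]], of "b @\<^sub>v c"] by (simp add: N[symmetric] one_mult_vec)
    then show "b @\<^sub>v c = 0\<^sub>v (m + q)" unfolding z N[symmetric] by (simp add: mult_zero_vec)
  next
    assume "b @\<^sub>v c = 0\<^sub>v (m + q)"
    then show "transpose_mat W *\<^sub>v (b @\<^sub>v c) = 0\<^sub>v N" by (simp add: N[symmetric] mult_zero_vec)
  qed
  also have "b @\<^sub>v c = 0\<^sub>v (m + q) \<longleftrightarrow> b = 0\<^sub>v m \<and> c = 0\<^sub>v q" by (rule append_eq_zero) auto
  also have "c = 0\<^sub>v q \<longleftrightarrow> u = transpose_mat Pt *\<^sub>v v"
  proof
    assume c: "c = 0\<^sub>v q"
    \<comment> \<open>With \<open>c = 0\<close> the transposed resolution of the identity loses its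
      first summand and expresses u through v alone.\<close>
    have "transpose_mat (Mt * Nh + Ek * Pt) = transpose_mat (Mt * Nh) + transpose_mat (Ek * Pt)"
      by (rule eq_matI) auto
    then have "transpose_mat Nh * transpose_mat Mt + transpose_mat Pt * transpose_mat Ek = 1\<^sub>m N"
      unfolding resolution by (simp add: transpose_mult_dim)
    from arg_cong[OF this, of "\<lambda>X. X *\<^sub>v u"]
    have "transpose_mat Nh *\<^sub>v c + transpose_mat Pt *\<^sub>v v = u"
      using d by (simp add: mult_mat_vec_dim_rules one_mult_vec c_def v)
    then show "u = transpose_mat Pt *\<^sub>v v" unfolding c
      using left_zero_vec[of "transpose_mat Pt *\<^sub>v v" N] carrier_vecI[of "transpose_mat Pt *\<^sub>v v" N]
      by (simp add: mult_zero_vec)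
  next
    assume u: "u = transpose_mat Pt *\<^sub>v v"
    show "c = 0\<^sub>v q" unfolding c_def u
      by (simp add: apply_eq[OF transpose_eq[OF Pt_Mt]] zero_mult_vec)
  qed
  also have "t = 0\<^sub>v n \<longleftrightarrow> transpose_mat F *\<^sub>v (transpose_mat Tr *\<^sub>v x1) = transpose_mat Cr *\<^sub>v v"
    unfolding t_def by (subst vec_add_eq_zero) (auto intro!: eq_vecI)
  also have "\<dots> \<longleftrightarrow> x1 = transpose_mat (Cr * Fi * Ti) *\<^sub>v v"
  proof
    assume eq: "transpose_mat F *\<^sub>v (transpose_mat Tr *\<^sub>v x1) = transpose_mat Cr *\<^sub>v v"
    show "x1 = transpose_mat (Cr * Fi * Ti) *\<^sub>v v"
      using d by (simp add: transpose_mult_dim mult_mat_vec_dim_rules eq[symmetric] cancel_transpose)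
  next
    assume x1: "x1 = transpose_mat (Cr * Fi * Ti) *\<^sub>v v"
    show "transpose_mat F *\<^sub>v (transpose_mat Tr *\<^sub>v x1) = transpose_mat Cr *\<^sub>v v"
      unfolding x1 by (simp add: transpose_mult_dim mult_mat_vec_dim_rules cancel_transpose)
  qed
  finally have main: "x1 @\<^sub>v u \<in> right_null (transpose_mat L) \<longleftrightarrow>
     x1 = transpose_mat (Cr * Fi * Ti) *\<^sub>v v \<and> b = 0\<^sub>v m \<and> u = transpose_mat Pt *\<^sub>v v" .
  have GT: "transpose_mat G = transpose_mat Dr + transpose_mat Br * (transpose_mat Fi * transpose_mat Cr)"
  proof -
    have "transpose_mat G = transpose_mat Dr + transpose_mat (Cr * Fi * Br)"
      unfolding G_def by (rule eq_matI) auto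
    then show ?thesis by (simp add: transpose_mult_dim)
  qed
  have "b = transpose_mat G *\<^sub>v v"
    if x1: "x1 = transpose_mat (Cr * Fi * Ti) *\<^sub>v v" and u: "u = transpose_mat Pt *\<^sub>v v"
  proof -
    have "transpose_mat Tr *\<^sub>v x1 = transpose_mat Fi *\<^sub>v (transpose_mat Cr *\<^sub>v v)"
      unfolding x1 by (simp add: transpose_mult_dim mult_mat_vec_dim_rules cancel_transpose)
    moreover have "transpose_mat Mb *\<^sub>v u = transpose_mat Dr *\<^sub>v v"
      unfolding u by (simp add: apply_eq[OF transpose_eq[OF Pt_Mb]])
    ultimately show ?thesis unfolding b_def GT
      by (simp add: mult_mat_vec_dim_rules) (rule eq_vecI, auto)
  qed
  moreover have "v \<in> right_null (transpose_mat G) \<longleftrightarrow> transpose_mat G *\<^sub>v v = 0\<^sub>v m"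
    by (auto simp: right_null_def intro!: carrier_vecI)
  ultimately show ?thesis using main by metis
qed

lemma left_lift_mult:
  "dim_vec v = m \<Longrightarrow> left_lift *\<^sub>v v = transpose_mat (Cr * Fi * Ti) *\<^sub>v v @\<^sub>v transpose_mat Pt *\<^sub>v v"
  by (simp add: left_lift_def mult_mat_vec_dim_rules)

lemma left_drop_mult:
  "dim_vec x1 = n \<Longrightarrow> dim_vec u = N \<Longrightarrow> left_drop *\<^sub>v (x1 @\<^sub>v u) = transpose_mat Ek *\<^sub>v u"
  by (auto simp: left_drop_def beside_mult_append zero_mult_vec intro!: eq_vecI)

lemma Ek_Pt_transpose: "dim_vec v = m \<Longrightarrow> transpose_mat Ek *\<^sub>v (transpose_mat Pt *\<^sub>v v) = v"
  by (simp add: apply_eq[OF transpose_eq[OF Pt_Ek]] one_mult_vec)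

lemma left_lift_null:
  assumes "v \<in> right_null (transpose_mat G)"
  shows "left_lift *\<^sub>v v \<in> right_null (transpose_mat L)" "left_drop *\<^sub>v (left_lift *\<^sub>v v) = v"
proof -
  have d: "dim_vec v = m" using assms by (auto simp: right_null_def)
  show "left_lift *\<^sub>v v \<in> right_null (transpose_mat L)"
    unfolding left_lift_mult[OF d] using assms d
    by (subst transpose_L_null[OF _ _ Ek_Pt_transpose[OF d, symmetric]]) auto
  show "left_drop *\<^sub>v (left_lift *\<^sub>v v) = v"
    unfolding left_lift_mult[OF d] using d by (subst left_drop_mult) (auto simp: Ek_Pt_transpose)
qed

lemma left_drop_null:
  assumes "x \<in> right_null (transpose_mat L)"
  shows "left_drop *\<^sub>v x \<in> right_null (transpose_mat G)" "left_lift *\<^sub>v (left_drop *\<^sub>v x) = x"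
proof -
  have "dim_vec x = n + N" using assms by (auto simp: right_null_def)
  then obtain x1 u where x: "x = x1 @\<^sub>v u" and d: "dim_vec x1 = n" "dim_vec u = N"
    by (rule vec_split)
  note eqs = assms[unfolded x transpose_L_null[OF d refl]]
  show "left_drop *\<^sub>v x \<in> right_null (transpose_mat G)" using eqs unfolding x left_drop_mult[OF d] by blast
  have "left_lift *\<^sub>v (transpose_mat Ek *\<^sub>v u) = x1 @\<^sub>v u"
    using eqs by (subst left_lift_mult) auto
  then show "left_lift *\<^sub>v (left_drop *\<^sub>v x) = x" unfolding x left_drop_mult[OF d] .
qed

end

section \<open>Resolution of the identity\<close>

definition Q_mat :: "(nat \<Rightarrow> 'a::field) \<Rightarrow> (nat \<Rightarrow> 'a) \<Rightarrow> (nat \<Rightarrow> 'a) \<Rightarrow> nat \<Rightarrow> 'a poly fract mat" where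
  "Q_mat al be ga k = minv (rat_pm (M_Phi al be ga k @\<^sub>r ekT k)) * rat_cm (1\<^sub>m (k - 1) @\<^sub>r 0\<^sub>m 1 (k - 1))"

text \<open>The columns of \<open>Q\<close> followed by the vector of basis polynomials form the inverse of
  \<open>M_Phi\<close> bordered by $e_k^T$, which is triangular with constant diagonal.\<close>
lemma Q_mat:
  fixes al be ga :: "nat \<Rightarrow> 'a::field"
  assumes al: "\<forall>j. al j \<noteq> 0" and k: "1 \<le> k"
  defines "M \<equiv> rat_pm (M_Phi al be ga k)" and "P \<equiv> rat_pm (Phi_vec al be ga k)" and "Q \<equiv> Q_mat al be ga k"
  shows "Q \<in> carrier_mat k (k - 1)"
    and "M * Q = 1\<^sub>m (k - 1)" and "ekT k * Q = 0\<^sub>m 1 (k - 1)"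
    and "Q * M + P * ekT k = 1\<^sub>m k"
    and "\<exists>Q' \<in> carrier_mat k (k - 1). Q = rat_pm Q'"
proof -
  let ?U = "M_Phi al be ga k @\<^sub>r ekT k"
  have kk: "k - 1 + 1 = k" using k by simp
  have U: "?U \<in> carrier_mat k k"
    using carrier_append_rows[OF M_Phi_carrier ekT_carrier, of al be ga k] unfolding kk .
  have rU: "rat_pm ?U = M @\<^sub>r ekT k"
    using rat_pm_append_rows[OF M_Phi_carrier ekT_carrier] by (simp add: M_def rat_pm_ekT)
  have M: "M \<in> carrier_mat (k - 1) k" and P: "P \<in> carrier_mat k 1"
    unfolding M_def P_def rat_pm_carrier by (rule M_Phi_carrier, rule Phi_vec_carrier)
  obtain d where d: "d \<noteq> 0" "det ?U = [:d:]" using det_M_Phi_ekT[OF al k] by blast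
  then have "det (rat_pm ?U) \<noteq> 0" by (simp add: det_rat_pm)
  note inv = minv_det[OF rat_pm_carrier[THEN iffD2, OF U] this]
  have Ie: "1\<^sub>m (k - 1) @\<^sub>r 0\<^sub>m 1 (k - 1) \<in> carrier_mat k (k - 1)"
    using carrier_append_rows[OF one_carrier_mat zero_carrier_mat, of "k - 1" 1] unfolding kk .
  then have I: "rat_cm (1\<^sub>m (k - 1) @\<^sub>r 0\<^sub>m 1 (k - 1)) \<in> carrier_mat k (k - 1)" by simp
  have Ieq: "rat_cm (1\<^sub>m (k - 1) @\<^sub>r 0\<^sub>m 1 (k - 1)) = 1\<^sub>m (k - 1) @\<^sub>r 0\<^sub>m 1 (k - 1)"
    using rat_cm_append_rows[OF one_carrier_mat zero_carrier_mat] by simp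
  show Q: "Q \<in> carrier_mat k (k - 1)" unfolding Q_def Q_mat_def by (rule mult_carrier_mat[OF inv(1) I])
  have "rat_pm ?U * Q = (rat_pm ?U * minv (rat_pm ?U)) * rat_cm (1\<^sub>m (k - 1) @\<^sub>r 0\<^sub>m 1 (k - 1))"
    unfolding Q_def Q_mat_def by (rule assoc_mult_mat[symmetric, OF rat_pm_carrier[THEN iffD2, OF U] inv(1) I])
  also have "\<dots> = 1\<^sub>m (k - 1) @\<^sub>r 0\<^sub>m 1 (k - 1)" unfolding inv(2) left_mult_one_mat[OF I] by (rule Ieq)
  finally have UQ: "rat_pm ?U * Q = 1\<^sub>m (k - 1) @\<^sub>r 0\<^sub>m 1 (k - 1)" .
  then have "M * Q @\<^sub>r ekT k * Q = 1\<^sub>m (k - 1) @\<^sub>r 0\<^sub>m 1 (k - 1)"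
    unfolding rU append_rows_mult[OF M ekT_carrier Q] .
  then show MQ: "M * Q = 1\<^sub>m (k - 1)" and eQ: "ekT k * Q = 0\<^sub>m 1 (k - 1)"
    using append_rows_eq[OF mult_carrier_mat[OF M Q] one_carrier_mat mult_carrier_mat[OF ekT_carrier Q] zero_carrier_mat]
    by blast+
  have MP: "M * P = 0\<^sub>m (k - 1) 1"
    unfolding M_def P_def rat_pm_mult[symmetric, OF M_Phi_carrier Phi_vec_carrier] M_Phi_mult_Phi_vec[OF al] by simp
  have eP: "ekT k * P = 1\<^sub>m 1"
  proof -
    have "ekT k * P = rat_pm (ekT k * Phi_vec al be ga k)"
      unfolding P_def rat_pm_mult[OF ekT_carrier Phi_vec_carrier] rat_pm_ekT ..
    then show ?thesis by (simp add: ekT_mult_Phi_vec[OF k])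
  qed
  have QM: "Q * M \<in> carrier_mat k k" and Pe: "P * ekT k \<in> carrier_mat k k"
    by (rule mult_carrier_mat[OF Q M], rule mult_carrier_mat[OF P ekT_carrier])
  have "M * (Q * M + P * ekT k) = M * (Q * M) + M * (P * ekT k)"
    by (rule mult_add_distrib_mat[OF M QM Pe])
  also have "M * (Q * M) = M" unfolding assoc_mult_mat[symmetric, OF M Q M] MQ by (rule left_mult_one_mat[OF M])
  also have "M * (P * ekT k) = 0\<^sub>m (k - 1) k"
    unfolding assoc_mult_mat[symmetric, OF M P ekT_carrier] MP by (rule left_mult_zero_mat[OF ekT_carrier])
  finally have 1: "M * (Q * M + P * ekT k) = M" using right_add_zero_mat[OF M] by simp
  have "ekT k * (Q * M + P * ekT k) = ekT k * (Q * M) + ekT k * (P * ekT k)"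
    by (rule mult_add_distrib_mat[OF ekT_carrier QM Pe])
  also have "ekT k * (Q * M) = 0\<^sub>m 1 k"
    unfolding assoc_mult_mat[symmetric, OF ekT_carrier Q M] eQ by (rule left_mult_zero_mat[OF M])
  also have "ekT k * (P * ekT k) = ekT k"
    unfolding assoc_mult_mat[symmetric, OF ekT_carrier P ekT_carrier] eP by (rule left_mult_one_mat[OF ekT_carrier])
  finally have 2: "ekT k * (Q * M + P * ekT k) = ekT k" using left_add_zero_mat[OF ekT_carrier[of k]] by simp
  have R: "Q * M + P * ekT k \<in> carrier_mat k k" by (rule add_carrier_mat[OF Pe])
  \<comment> \<open>The bordered matrix does not distinguish the candidate from the identity, as
    \<open>M\<close> and e_k^T reproduce themselves; cancelling it proves the resolution without
    computing an inverse.\<close>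
  have "rat_pm ?U * (Q * M + P * ekT k) = rat_pm ?U"
    unfolding rU append_rows_mult[OF M ekT_carrier R] 1 2 ..
  then have "minv (rat_pm ?U) * (rat_pm ?U * (Q * M + P * ekT k)) = 1\<^sub>m k" using inv(3) by simp
  then show "Q * M + P * ekT k = 1\<^sub>m k"
    unfolding assoc_mult_mat[symmetric, OF inv(1) rat_pm_carrier[THEN iffD2, OF U] R] inv(3)
    using left_mult_one_mat[OF R] by simp
  obtain V where V: "V \<in> carrier_mat k k" "minv (rat_pm ?U) = rat_pm V"
    using minv_rat_pm_unimodular[OF U d(2,1)] by blast
  have "Q = rat_pm (V * const_pm (1\<^sub>m (k - 1) @\<^sub>r 0\<^sub>m 1 (k - 1)))"
    unfolding Q_def Q_mat_def V(2) rat_cm_def using Ie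
    by (intro rat_pm_mult[symmetric, OF V(1)]) simp
  moreover have "V * const_pm (1\<^sub>m (k - 1) @\<^sub>r 0\<^sub>m 1 (k - 1)) \<in> carrier_mat k (k - 1)"
    using Ie by (intro mult_carrier_mat[OF V(1)]) simp
  ultimately show "\<exists>Q' \<in> carrier_mat k (k - 1). Q = rat_pm Q'" by blast
qed

lemma kron_one_mult_transpose:
  fixes X Y :: "'b::comm_ring_1 mat"
  assumes X: "X \<in> carrier_mat a b" and Y: "Y \<in> carrier_mat b c"
  shows "kron (transpose_mat Y) (1\<^sub>m m) * kron (transpose_mat X) (1\<^sub>m m) = kron (transpose_mat (X * Y)) (1\<^sub>m m)"
  unfolding transpose_mult[OF X Y] using X Y by (intro kron_one_mult) auto

lemma kron_ekT: "1 \<le> k \<Longrightarrow> kron (transpose_mat (ekT k)) (1\<^sub>m m) = 0\<^sub>m ((k - 1) * m) m @\<^sub>r (1\<^sub>m m :: 'b::comm_ring_1 mat)"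
proof (rule eq_matI)
  assume k: "1 \<le> k"
  have e: "transpose_mat (ekT k) \<in> carrier_mat k 1" using ekT_carrier[of k] by simp
  have km: "(k - 1) * m + m = k * m" using k by (cases k) auto
  fix i j assume "i < dim_row (0\<^sub>m ((k - 1) * m) m @\<^sub>r (1\<^sub>m m :: 'b mat))" "j < dim_col (0\<^sub>m ((k - 1) * m) m @\<^sub>r (1\<^sub>m m :: 'b mat))"
  then have ij: "i < k * m" "j < 1 * m" using km by auto
  then have m: "m > 0" by (cases m) auto
  have id: "i div m < k" using ij by (auto simp: less_mult_imp_div_less)
  have eq: "kron (transpose_mat (ekT k)) (1\<^sub>m m) $$ (i,j) = (if i mod m = j \<and> i div m = k - 1 then 1 else (0::'b))"
    unfolding kron_one_index[OF e ij] using ij id by (auto simp: ekT_def)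
  show "kron (transpose_mat (ekT k)) (1\<^sub>m m) $$ (i,j) = (0\<^sub>m ((k - 1) * m) m @\<^sub>r (1\<^sub>m m :: 'b mat)) $$ (i,j)"
  proof (cases "i < (k - 1) * m")
    case True
    then have "i div m < k - 1" by (auto simp: less_mult_imp_div_less)
    then show ?thesis unfolding eq using True ij by (simp add: append_rows_def)
  next
    case False
    define i' where "i' = i - (k - 1) * m"
    have i: "i = (k - 1) * m + i'" "i' < m" using False ij km by (auto simp: i'_def)
    have "i div m = k - 1" "i mod m = i'" unfolding i(1) using i(2) by simp_all
    then show ?thesis unfolding eq using False i ij by (simp add: append_rows_def)
  qed
next
  assume k: "1 \<le> k"
  show "dim_row (kron (transpose_mat (ekT k)) (1\<^sub>m m)) = dim_row (0\<^sub>m ((k - 1) * m) m @\<^sub>r (1\<^sub>m m :: 'b mat))"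
    using k by (cases k) (auto simp: ekT_def)
qed (simp add: ekT_def)

lemma rat_pm_four_block:
  "dim_row X = dim_row Y \<Longrightarrow> dim_row Z = dim_row W \<Longrightarrow> dim_col X = dim_col Z \<Longrightarrow> dim_col Y = dim_col W \<Longrightarrow>
   rat_pm (four_block_mat X Y Z W) = four_block_mat (rat_pm X) (rat_pm Y) (rat_pm Z) (rat_pm W)"
  by (rule eq_matI) auto

lemma rat_pm_beside:
  "X \<in> carrier_mat a b \<Longrightarrow> Y \<in> carrier_mat a c \<Longrightarrow>
   rat_pm (four_block_mat X Y (0\<^sub>m 0 b) (0\<^sub>m 0 c)) = beside (rat_pm X) (rat_pm Y)"
  by (subst rat_pm_four_block) (auto simp: beside_def)

lemma beside_mult_append_rows:
  fixes X Y U V :: "'b::comm_ring_1 mat"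
  assumes "X \<in> carrier_mat a b" "Y \<in> carrier_mat a c" "U \<in> carrier_mat b l" "V \<in> carrier_mat c l"
  shows "beside X Y * (U @\<^sub>r V) = X * U + Y * V"
proof (rule mat_col_eqI)
  have UV: "U @\<^sub>r V \<in> carrier_mat (b + c) l" using assms by auto
  have b: "beside X Y \<in> carrier_mat a (b + c)" using assms by (intro carrier_matI) auto
  fix j assume "j < dim_col (X * U + Y * V)"
  then have j: "j < l" using assms by auto
  have "col (U @\<^sub>r V) j = col U j @\<^sub>v col V j"
    using j assms by (intro eq_vecI) (auto simp: append_rows_def)
  then have "col (beside X Y * (U @\<^sub>r V)) j = X *\<^sub>v col U j + Y *\<^sub>v col V j"
    using col_mult2[OF b UV j] assms j by (simp add: beside_mult_append)
  then show "col (beside X Y * (U @\<^sub>r V)) j = col (X * U + Y * V) j"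
    using j assms by (intro eq_vecI) auto
qed (use assms in auto)

lemma row_block_dim [simp]: "dim_row (row_block X a b) = b" "dim_col (row_block X a b) = dim_col X"
  by (auto simp: row_block_def)

lemma row_block_append:
  assumes "dim_row H = a + b" shows "row_block H 0 a @\<^sub>r row_block H a b = H"
  using assms by (intro eq_matI) (auto simp: row_block_def append_rows_def)

lemma vec_degree_uminus [simp]: "vec_degree (- v) = vec_degree (v :: 'a::ab_group_add poly vec)"
proof -
  have "vec_degree (- v) \<le> d \<longleftrightarrow> vec_degree v \<le> d" for d by (auto simp: vec_degree_le_iff)
  then show ?thesis by (meson order_antisym order_refl)
qed

text \<open>Stated for a single row because the block transpose of m^D_Phi is constant only below
  its first block row.\<close>

lemma degree_mult_vec_index:
  assumes "X \<in> carrier_mat a b" "v \<in> carrier_vec b" "i < a" "\<And>j. j < b \<Longrightarrow> degree (X $$ (i,j)) = 0"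
  shows "degree ((X *\<^sub>v v) $ i) \<le> vec_degree v"
proof -
  have "degree (\<Sum>j = 0..<b. X $$ (i,j) * v $ j) \<le> vec_degree v"
  proof (rule degree_sum_le)
    fix j assume "j \<in> {0..<b}"
    then show "degree (X $$ (i,j) * v $ j) \<le> vec_degree v"
      using degree_mult_le[of "X $$ (i,j)" "v $ j"] degree_le_vec_degree[of j v] assms by auto
  qed simp
  then show ?thesis using assms by (simp add: scalar_prod_def)
qed

text \<open>A nonzero entry is demanded so that multiplying it by a basis polynomial adds degrees.
  At degree 0 a maximal entry could be zero, hence the case distinction.\<close>

lemma vec_degree_attained:
  assumes "h \<in> carrier_vec m" "h \<noteq> 0\<^sub>v m"
  shows "\<exists>i < m. h $ i \<noteq> 0 \<and> degree (h $ i) = vec_degree h"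
proof (cases "vec_degree h = 0")
  case True
  from assms obtain i where "i < m" "h $ i \<noteq> 0" by (metis eq_vecI carrier_vecD index_zero_vec)
  then show ?thesis using True degree_le_vec_degree[of i h] assms by auto
next
  case False
  then have "\<not> vec_degree h \<le> vec_degree h - 1" by simp
  then obtain i where "i < m" "\<not> degree (h $ i) \<le> vec_degree h - 1"
    using assms by (auto simp: vec_degree_le_iff)
  then show ?thesis using degree_le_vec_degree[of i h] assms by (intro exI[of _ i]) auto
qed

lemma rat_vec_uminus: "rat_vec (- v) = - rat_vec v"
  by (rule eq_vecI) (auto simp: ratf.hom_uminus)

lemma sort_map_add: "sort (map (\<lambda>d. d + c) ds) = map (\<lambda>d. d + c :: nat) (sort ds)"
  by (rule properties_for_sort) (auto simp: sorted_wrt_map intro: sorted_wrt_mono_rel[of _ "(\<le>)"])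

section \<open>The linearization\<close>

lemma block_transpose_dim [simp]:
  "dim_row (block_transpose m X) = dim_col X" "dim_col (block_transpose m X) = dim_row X"
  by (auto simp: block_transpose_def)

lemma basis_mats_dim [simp]:
  "dim_row (Phi_vec al be ga k) = k" "dim_col (Phi_vec al be ga k) = 1"
  "dim_row (M_Phi al be ga k) = k - 1" "dim_col (M_Phi al be ga k) = k"
  "dim_row (ekT k) = 1" "dim_col (ekT k) = k"
  "dim_row (mD_Phi al be ga m k D) = m" "dim_col (mD_Phi al be ga m k D) = k * m"
  "dim_row (Dpoly al be ga m k D) = m" "dim_col (Dpoly al be ga m k D) = m"
  by (simp_all add: Phi_vec_def M_Phi_def ekT_def mD_Phi_def Dpoly_def)

lemma mult_mat_vec_index:
  "X \<in> carrier_mat a b \<Longrightarrow> v \<in> carrier_vec b \<Longrightarrow> i < a \<Longrightarrow> (X *\<^sub>v v) $ i = (\<Sum>j = 0..<b. X $$ (i,j) * v $ j)"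
  by (simp add: scalar_prod_def)

locale m2_linearization =
  fixes al be ga :: "nat \<Rightarrow> 'a::field" and m n k :: nat and D :: "nat \<Rightarrow> 'a mat"
    and A B C T S J :: "'a mat" and w :: "'a vec"
  assumes al: "\<forall>j. al j \<noteq> 0" and k2: "2 \<le> k"
    and minreal: "is_minimal_realization m n A B C"
    and T: "T \<in> carrier_mat n n" "det T \<noteq> 0" and S: "S \<in> carrier_mat n n" "det S \<noteq> 0"
    and w: "w \<in> carrier_vec k" and J: "J \<in> carrier_mat (k * m) ((k - 1) * m)"
    and WJ: "det (WJ m w J) \<noteq> 0"
begin

abbreviation Q where "Q \<equiv> Q_mat al be ga k"

abbreviation Dp where "Dp \<equiv> Dpoly al be ga m k D"

abbreviation mB where "mB \<equiv> block_transpose m (mD_Phi al be ga m k D)"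

abbreviation Mtp where "Mtp \<equiv> kron (transpose_mat (M_Phi al be ga k)) (1\<^sub>m m)"

abbreviation Pm where "Pm \<equiv> kron (Phi_vec al be ga k) (1\<^sub>m m)"

abbreviation F where "F \<equiv> rat_pm (lamI_minus A)"

lemma k1: "1 \<le> k" using k2 by simp

lemma km: "k * m = m + (k - 1) * m" using k2 by (cases k) auto

lemma ABC: "A \<in> carrier_mat n n" "B \<in> carrier_mat n m" "C \<in> carrier_mat m n"
  using minreal by (auto simp: is_minimal_realization_def is_realization_def)

lemmas ABC_dim [simp] = ABC[THEN carrier_matD(1)] ABC[THEN carrier_matD(2)]
  T(1)[THEN carrier_matD(1)] T(1)[THEN carrier_matD(2)] S(1)[THEN carrier_matD(1)] S(1)[THEN carrier_matD(2)]
  minv_det(1)[OF T, THEN carrier_matD(1)] minv_det(1)[OF T, THEN carrier_matD(2)]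
  minv_det(1)[OF S, THEN carrier_matD(1)] minv_det(1)[OF S, THEN carrier_matD(2)]
  lamI_minus_carrier[OF ABC(1), THEN carrier_matD(1)] lamI_minus_carrier[OF ABC(1), THEN carrier_matD(2)]

lemma wI_carrier: "wI m w \<in> carrier_mat m (k * m)"
  using w by (intro carrier_matI) (auto simp: wI_def row_of_vec_def)

lemma WJ_carrier: "WJ m w J \<in> carrier_mat (k * m) (k * m)"
  using carrier_append_rows[OF wI_carrier block_transpose_carrier[OF J]] unfolding WJ_def km[symmetric] .

lemma Mtp_carrier: "Mtp \<in> carrier_mat (k * m) ((k - 1) * m)"
  by (intro kron_carrier) (simp_all only: transpose_carrier_mat M_Phi_carrier one_carrier_mat)

lemma mB_carrier: "mB \<in> carrier_mat (k * m) m"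
  by (rule block_transpose_carrier[OF mD_Phi_carrier])

lemma Pm_carrier: "Pm \<in> carrier_mat (k * m) m"
  using kron_carrier[OF Phi_vec_carrier one_carrier_mat[of m], of al be ga k] by simp

lemma rat_Mtp: "rat_pm Mtp = kron (transpose_mat (rat_pm (M_Phi al be ga k))) (1\<^sub>m m)"
  by (simp add: rat_pm_kron_one rat_pm_transpose)

lemma rat_Pm_transpose: "transpose_mat (rat_pm Pm) = kron (transpose_mat (rat_pm (Phi_vec al be ga k))) (1\<^sub>m m)"
  unfolding rat_pm_kron_one by (rule kron_one_transpose) (rule rat_pm_carrier[THEN iffD2, OF Phi_vec_carrier])

text \<open>The locale's identities are the transposes of M Q = I, e_k^T Q = 0, M Phi = 0, e_k^T Phi
  = 1 and Q M + Phi e_k^T = I, tensored with I_m. Thus \<open>Nh\<close> becomes Nhat and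
  \<open>Pt\<close> the row of basis polynomials, and \<open>Pt_Mb\<close> is the expansion of
  D.\<close>

sublocale block_pencil n m "k * m" "(k - 1) * m" F "minv F" "rat_cm T" "rat_cm (minv T)" "rat_cm S"
  "rat_cm (minv S)" "rat_cm B" "rat_cm C" "rat_pm Dp" "rat_pm mB" "rat_pm Mtp"
  "kron (transpose_mat Q) (1\<^sub>m m)" "kron (transpose_mat (ekT k)) (1\<^sub>m m)" "transpose_mat (rat_pm Pm)"
  "rat_cm (wI m w)" "rat_cm (block_transpose m J)" "rat_cm (minv (WJ m w J))"
proof -
  note Qm = Q_mat[OF al k1, of be ga]
  let ?M = "rat_pm (M_Phi al be ga k)" and ?P = "rat_pm (Phi_vec al be ga k)"
  have M: "?M \<in> carrier_mat (k - 1) k" and P: "?P \<in> carrier_mat k 1"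
    unfolding rat_pm_carrier by (rule M_Phi_carrier, rule Phi_vec_carrier)
  have e: "ekT k \<in> carrier_mat 1 k" by (rule ekT_carrier)
  have QT: "transpose_mat Q \<in> carrier_mat (k - 1) k" using Qm(1) by simp
  have Fi: "minv F \<in> carrier_mat n n" "F * minv F = 1\<^sub>m n" "minv F * F = 1\<^sub>m n"
    using minv_det[OF _ det_lamI_minus[OF ABC(1)]] ABC by auto
  have W: "rat_cm (wI m w) @\<^sub>r rat_cm (block_transpose m J) = rat_cm (WJ m w J)"
    unfolding WJ_def by (rule rat_cm_append_rows[symmetric, OF wI_carrier block_transpose_carrier[OF J]])
  have c: "F \<in> carrier_mat n n" "rat_cm T \<in> carrier_mat n n" "rat_cm (minv T) \<in> carrier_mat n n"
    "rat_cm S \<in> carrier_mat n n" "rat_cm (minv S) \<in> carrier_mat n n" "rat_cm B \<in> carrier_mat n m"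
    "rat_cm C \<in> carrier_mat m n" "rat_pm Dp \<in> carrier_mat m m"
    using ABC T S minv_det(1)[OF T] minv_det(1)[OF S] by simp_all
  have inv: "rat_cm X * rat_cm (minv X) = 1\<^sub>m a" "rat_cm (minv X) * rat_cm X = 1\<^sub>m a"
    if "X \<in> carrier_mat a a" "det X \<noteq> 0" for X :: "'a mat" and a
    using minv_det[OF that] that(1) by (simp_all add: rat_cm_mult[symmetric, of _ a a _ a])
  have Ek: "kron (transpose_mat (ekT k)) (1\<^sub>m m) \<in> carrier_mat (k * m) (1 * m)"
    using e by (intro kron_carrier) (simp_all only: transpose_carrier_mat one_carrier_mat)
  have one: "kron (transpose_mat (1\<^sub>m a)) (1\<^sub>m m) = (1\<^sub>m (a * m) :: 'a poly fract mat)" for a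
    by (simp add: kron_one_one)
  show "block_pencil n m (k * m) ((k - 1) * m) F (minv F) (rat_cm T) (rat_cm (minv T)) (rat_cm S)
    (rat_cm (minv S)) (rat_cm B) (rat_cm C) (rat_pm Dp) (rat_pm mB) (rat_pm Mtp)
    (kron (transpose_mat Q) (1\<^sub>m m)) (kron (transpose_mat (ekT k)) (1\<^sub>m m)) (transpose_mat (rat_pm Pm))
    (rat_cm (wI m w)) (rat_cm (block_transpose m J)) (rat_cm (minv (WJ m w J)))"
  proof
    show "kron (transpose_mat Q) (1\<^sub>m m) * rat_pm Mtp = 1\<^sub>m ((k - 1) * m)"
      unfolding rat_Mtp kron_one_mult_transpose[OF M Qm(1)] Qm(2) by (rule one)
    show "kron (transpose_mat Q) (1\<^sub>m m) * kron (transpose_mat (ekT k)) (1\<^sub>m m) = 0\<^sub>m ((k - 1) * m) m"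
      unfolding kron_one_mult_transpose[OF e Qm(1)] Qm(3) using kron_one_zero[of "k - 1" 1 m] by simp
    show "transpose_mat (rat_pm Pm) * rat_pm Mtp = 0\<^sub>m m ((k - 1) * m)"
      unfolding rat_Mtp rat_Pm_transpose kron_one_mult_transpose[OF M P]
      using kron_one_zero[of 1 "k - 1" m]
      by (simp add: rat_pm_mult[symmetric, OF M_Phi_carrier Phi_vec_carrier] M_Phi_mult_Phi_vec[OF al])
    show "transpose_mat (rat_pm Pm) * kron (transpose_mat (ekT k)) (1\<^sub>m m) = 1\<^sub>m m"
    proof -
      have "ekT k * ?P = 1\<^sub>m 1"
        using rat_pm_mult[OF ekT_carrier Phi_vec_carrier, of k al be ga] ekT_mult_Phi_vec[OF k1, of al be ga]
        by (simp add: rat_pm_ekT)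
      then show ?thesis unfolding rat_Pm_transpose kron_one_mult_transpose[OF e P] using one[of 1] by simp
    qed
    show "rat_pm Mtp * kron (transpose_mat Q) (1\<^sub>m m)
        + kron (transpose_mat (ekT k)) (1\<^sub>m m) * transpose_mat (rat_pm Pm) = 1\<^sub>m (k * m)"
    proof -
      have QM: "Q * ?M \<in> carrier_mat k k" and Pe: "?P * ekT k \<in> carrier_mat k k"
        by (rule mult_carrier_mat[OF Qm(1) M], rule mult_carrier_mat[OF P e])
      have "transpose_mat (Q * ?M) + transpose_mat (?P * ekT k) = transpose_mat (Q * ?M + ?P * ekT k)"
        by (rule transpose_add[symmetric, OF QM Pe])
      also have "\<dots> = 1\<^sub>m k" unfolding Qm(4) by simp
      finally show ?thesis
        unfolding rat_Mtp rat_Pm_transpose kron_one_mult_transpose[OF Qm(1) M] kron_one_mult_transpose[OF P e]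
        using QM Pe by (subst kron_one_add[of _ k k, symmetric]) (simp_all add: kron_one_one)
    qed
    show "transpose_mat (rat_pm Pm) * rat_pm mB = rat_pm Dp"
    proof -
      have "transpose_mat (rat_pm Pm) = rat_pm (kron (transpose_mat (Phi_vec al be ga k)) (1\<^sub>m m))"
        unfolding rat_Pm_transpose by (simp add: rat_pm_kron_one rat_pm_transpose)
      moreover have "kron (transpose_mat (Phi_vec al be ga k)) (1\<^sub>m m) \<in> carrier_mat m (k * m)"
        unfolding kron_one_transpose[OF Phi_vec_carrier, symmetric] using Pm_carrier by simp
      ultimately show ?thesis
        using rat_pm_mult[OF _ mB_carrier] Phi_mult_mD_Phi[OF al k2, of be ga m D] by metis
    qed
    show "(rat_cm (wI m w) @\<^sub>r rat_cm (block_transpose m J)) * rat_cm (minv (WJ m w J)) = 1\<^sub>m (k * m)"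
      "rat_cm (minv (WJ m w J)) * (rat_cm (wI m w) @\<^sub>r rat_cm (block_transpose m J)) = 1\<^sub>m (k * m)"
      unfolding W by (rule inv[OF WJ_carrier WJ])+
    show "kron (transpose_mat (ekT k)) (1\<^sub>m m) \<in> carrier_mat (k * m) m" using Ek by simp
    show "kron (transpose_mat Q) (1\<^sub>m m) \<in> carrier_mat ((k - 1) * m) (k * m)"
      by (rule kron_carrier[OF QT one_carrier_mat])
    show "rat_cm (minv (WJ m w J)) \<in> carrier_mat (k * m) (k * m)"
      using minv_det(1)[OF WJ_carrier WJ] by simp
    show "transpose_mat (rat_pm Pm) \<in> carrier_mat m (k * m)" using Pm_carrier by simp
  qed (fact c Fi km inv[OF T] inv[OF S] rat_pm_carrier[THEN iffD2, OF mB_carrier] rat_pm_carrier[THEN iffD2, OF Mtp_carrier]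
     rat_cm_carrier[THEN iffD2, OF wI_carrier] rat_cm_carrier[THEN iffD2, OF block_transpose_carrier[OF J]])+
qed

lemma G_eq: "G = Gmat al be ga m k D A B C"
  by (simp add: G_def Gmat_def transfer_def)

lemma L_eq: "L = rat_pm (L2 al be ga m n k D A B C T S w J)"
proof -
  let ?q = "(k - 1) * m"
  let ?X = "const_pm T * lamI_minus A * const_pm S"
  let ?Y = "four_block_mat (const_pm (T * B)) (0\<^sub>m n ?q) (0\<^sub>m 0 m) (0\<^sub>m 0 ?q)"
  let ?Z = "0\<^sub>m ?q n @\<^sub>r const_pm (- (C * S))"
  let ?V = "four_block_mat mB Mtp (0\<^sub>m 0 m) (0\<^sub>m 0 ?q)"
  let ?R = "four_block_mat (1\<^sub>m n) (0\<^sub>m n (k * m)) (0\<^sub>m (k * m) n) (const_pm (WJ m w J))"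
  have TS: "const_pm T \<in> carrier_mat n n" "const_pm S \<in> carrier_mat n n" "lamI_minus A \<in> carrier_mat n n"
    using T S ABC by simp_all
  have TA: "const_pm T * lamI_minus A \<in> carrier_mat n n" by (rule mult_carrier_mat[OF TS(1,3)])
  have TB: "T * B \<in> carrier_mat n m" and CS: "- (C * S) \<in> carrier_mat m n"
    using T S ABC by auto
  have X: "?X \<in> carrier_mat n n" by (rule mult_carrier_mat[OF TA TS(2)])
  have Y: "?Y \<in> carrier_mat n (k * m)"
    using four_block_carrier_mat[of "const_pm (T * B)" n m "0\<^sub>m 0 ?q" 0 ?q] TB unfolding km by simp
  have Z: "?Z \<in> carrier_mat (k * m) n"
    using carrier_append_rows[of "0\<^sub>m ?q n" ?q n "const_pm (- (C * S))" m] CS unfolding km by (simp add: add.commute)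
  have V: "?V \<in> carrier_mat (k * m) (k * m)"
    using four_block_carrier_mat[OF mB_carrier, of "0\<^sub>m 0 ?q" 0 ?q] km by simp
  have R: "?R \<in> carrier_mat (n + k * m) (n + k * m)"
    using four_block_carrier_mat[OF one_carrier_mat[of n], of "const_pm (WJ m w J)" "k * m" "k * m"] WJ_carrier by simp
  have rX: "rat_pm ?X = rat_cm T * F * rat_cm S"
    unfolding rat_cm_def rat_pm_mult[OF TA TS(2)] rat_pm_mult[OF TS(1,3)] ..
  have rY: "rat_pm ?Y = beside (rat_cm T * rat_cm B) (0\<^sub>m n ?q)"
    using rat_pm_beside[of "const_pm (T * B)" n m "0\<^sub>m n ?q" ?q] TB rat_cm_mult[OF T(1) ABC(2)]
    by (simp add: rat_cm_def)
  have rV: "rat_pm ?V = beside (rat_pm mB) (rat_pm Mtp)"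
    by (rule rat_pm_beside[OF mB_carrier Mtp_carrier])
  have uCS: "rat_cm (- (C * S)) = - (rat_cm C * rat_cm S)"
    unfolding rat_cm_mult[OF ABC(3) S(1), symmetric] by (rule eq_matI) (auto simp: ratf.hom_uminus[symmetric])
  \<comment> \<open>Zero rows stacked over C S are e_k \<otimes> I times C S, the form in which the
    abstract pencil carries this block.\<close>
  have rZ: "rat_pm ?Z = - (kron (transpose_mat (ekT k)) (1\<^sub>m m) * (rat_cm C * rat_cm S))"
  proof -
    have CS': "rat_cm C * rat_cm S \<in> carrier_mat m n"
      by (rule mult_carrier_mat) (use ABC S in simp_all)
    have "rat_pm ?Z = 0\<^sub>m ?q n @\<^sub>r - (rat_cm C * rat_cm S)"
      using rat_pm_append_rows[of "0\<^sub>m ?q n" ?q n "const_pm (- (C * S))" m] CS uCS by (simp add: rat_cm_def)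
    also have "\<dots> = - (0\<^sub>m ?q n @\<^sub>r rat_cm C * rat_cm S)"
      using CS' by (intro eq_matI) (auto simp: append_rows_def)
    also have "0\<^sub>m ?q n @\<^sub>r rat_cm C * rat_cm S = (0\<^sub>m ?q m @\<^sub>r 1\<^sub>m m) * (rat_cm C * rat_cm S)"
      unfolding append_rows_mult[OF zero_carrier_mat one_carrier_mat CS'] left_mult_zero_mat[OF CS'] left_mult_one_mat[OF CS'] ..
    finally show ?thesis unfolding kron_ekT[OF k1] .
  qed
  have rW: "rat_pm (const_pm (WJ m w J)) = rat_cm (wI m w) @\<^sub>r rat_cm (block_transpose m J)"
    unfolding rat_cm_def[symmetric] WJ_def by (rule rat_cm_append_rows[OF wI_carrier block_transpose_carrier[OF J]])
  have rR: "rat_pm ?R = four_block_mat (1\<^sub>m n) (0\<^sub>m n (k * m)) (0\<^sub>m (k * m) n) (rat_cm (wI m w) @\<^sub>r rat_cm (block_transpose m J))"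
    unfolding rW[symmetric] using WJ_carrier by (subst rat_pm_four_block) auto
  have rK: "rat_pm (four_block_mat ?X ?Y ?Z ?V) = K"
    unfolding K_def rX[symmetric] rY[symmetric] rZ[symmetric] rV[symmetric]
    by (rule rat_pm_four_block) (simp_all only: carrier_matD[OF X] carrier_matD[OF Y] carrier_matD[OF Z] carrier_matD[OF V])
  have "rat_pm (four_block_mat ?X ?Y ?Z ?V * ?R) = K * rat_pm ?R"
    unfolding rK[symmetric] by (rule rat_pm_mult[OF four_block_carrier_mat[OF X V] R])
  then show ?thesis unfolding L_def L2_def rR by simp
qed

text \<open>Below its first block row, the equation says that a pencil $\lambda I - K$ applied to \<open>z\<close> has
  degree at most that of \<open>h\<close>.\<close>
lemma pencil_degree:
  assumes z: "z \<in> carrier_vec ((k - 1) * m)" and h: "h \<in> carrier_vec m" and g: "g \<in> carrier_vec m"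
    and eq: "Mtp *\<^sub>v z + kron (transpose_mat (ekT k)) (1\<^sub>m m) *\<^sub>v g = mB *\<^sub>v h"
    and gd: "vec_degree g \<le> vec_degree h"
  shows "vec_degree z \<le> vec_degree h"
proof -
  let ?q = "(k - 1) * m" and ?E = "kron (transpose_mat (ekT k)) (1\<^sub>m m) :: 'a poly mat"
  \<comment> \<open>Deleting the first block row of the transposed \<open>M_Phi\<close> moves the
    entries lambda - beta onto the diagonal, which makes the rest a square monic pencil.\<close>
  define Z where "Z = mat ?q ?q (\<lambda>(i,j). Mtp $$ (m + i, j))"
  have Z: "Z \<in> carrier_mat ?q ?q" by (simp add: Z_def)
  \<comment> \<open>The constant parts: -alpha above, -beta on and -gamma below the block
    diagonal.\<close>
  define c where "c i j = (if i mod m \<noteq> j mod m then 0 else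
     let r = j div m; t = k - 2 - r; d = i div m in
     if Suc d = r then - al t else if d = r then - be t else if d = Suc r then - ga t else 0)" for i j
  have MT: "transpose_mat (M_Phi al be ga k) \<in> carrier_mat k (k - 1)"
    unfolding transpose_carrier_mat by (rule M_Phi_carrier)
  have Zij: "Z $$ (i,j) = (if i = j then [:0,1:] else 0) + [:c i j:]" if ij: "i < ?q" "j < ?q" for i j
  proof -
    have m: "m > 0" using ij by (cases m) auto
    have i': "m + i < k * m" using ij(1) km by simp
    have d: "i div m < k - 1" "j div m < k - 1" using ij by (auto simp: less_mult_imp_div_less)
    have "Z $$ (i,j) = (if i mod m = j mod m then M_Phi al be ga k $$ (j div m, Suc (i div m)) else 0)"
      using ij m kron_one_index[OF MT i' ij(2)] d by (simp add: Z_def M_Phi_def div_add_self1)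
    moreover have "i = j \<longleftrightarrow> i div m = j div m \<and> i mod m = j mod m" by (metis div_mult_mod_eq)
    ultimately show ?thesis using d by (auto simp: M_Phi_def c_def Let_def)
  qed
  have "vec_degree z \<le> vec_degree (Z *\<^sub>v z)" by (rule vec_degree_pencil[OF Z z Zij])
  also have "\<dots> \<le> vec_degree h"
    unfolding vec_degree_le_iff
  proof (intro allI impI)
    fix i assume "i < dim_vec (Z *\<^sub>v z)"
    then have i: "i < ?q" using Z by simp
    then have mi: "m + i < k * m" using km by simp
    have m: "m > 0" using i by (cases m) auto
    have E: "?E \<in> carrier_mat (k * m) m"
      using kron_carrier[of "transpose_mat (ekT k)" k 1 "1\<^sub>m m" m m] ekT_carrier[of k] by simp
    have "(Z *\<^sub>v z) $ i = (Mtp *\<^sub>v z) $ (m + i)"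
      unfolding mult_mat_vec_index[OF Mtp_carrier z mi] mult_mat_vec_index[OF Z z i]
      by (rule sum.cong) (use i in \<open>auto simp: Z_def\<close>)
    also have "\<dots> = (mB *\<^sub>v h) $ (m + i) - (?E *\<^sub>v g) $ (m + i)"
      using arg_cong[OF eq, of "\<lambda>v. v $ (m + i)"] mi E by (simp add: eq_diff_eq)
    finally have e: "(Z *\<^sub>v z) $ i = (mB *\<^sub>v h) $ (m + i) - (?E *\<^sub>v g) $ (m + i)" .
    have d: "(m + i) div m = Suc (i div m)" using m by (simp add: div_add_self1)
    have "i div m < k - 1" using i by (simp add: less_mult_imp_div_less)
    then have di: "Suc (i div m) * m + b < k * m" if "b < m" for b
      using block_index_less[of "Suc (i div m)" k b m] that by simp
    have "degree ((mB *\<^sub>v h) $ (m + i)) \<le> vec_degree h"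
    proof (rule degree_mult_vec_index[OF mB_carrier h mi])
      fix b assume b: "b < m"
      define c where "c = Suc (i div m) * m + b"
      \<comment> \<open>A row below the first block row reads from a column block of m^D_Phi with
        nonzero index, where all entries are constants.\<close>
      have c: "c < k * m" "c div m \<noteq> 0" using di[OF b] b by (simp_all add: c_def del: mult_Suc)
      have "mB $$ (m + i, b) = mD_Phi al be ga m k D $$ (i mod m, c)"
        using b mi m by (simp add: block_transpose_def d c_def)
      then show "degree (mB $$ (m + i, b)) = 0"
        using c m by (simp add: mD_Phi_def Let_def)
    qed
    moreover have "degree ((?E *\<^sub>v g) $ (m + i)) \<le> vec_degree g"
    proof (rule degree_mult_vec_index[OF E g mi])
      fix b assume b: "b < m"
      show "degree (?E $$ (m + i, b)) = 0"
        unfolding kron_ekT[OF k1] using b i mi km by (auto simp: append_rows_def)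
    qed
    ultimately show "degree ((Z *\<^sub>v z) $ i) \<le> vec_degree h"
      unfolding e using gd by (intro degree_diff_le) auto
  qed
  finally show ?thesis .
qed

text \<open>The upper bound needs G h = 0, not only the formula for the lift. For arbitrary h
  neither polynomiality of the state nor the bound on D h would be available.\<close>

lemma right_lift_poly:
  assumes h: "h \<in> carrier_vec m" and null: "rat_vec h \<in> right_null G"
  shows "\<exists>g. rat_vec g = right_lift *\<^sub>v rat_vec h \<and> vec_degree g = vec_degree h"
proof -
  let ?y = "rat_vec h" and ?q = "(k - 1) * m"
  have hd[simp]: "dim_vec h = m" using h by simp
  then have yd: "dim_vec ?y = m" by simp
  define v where "v = minv F *\<^sub>v (rat_cm B *\<^sub>v ?y)"
  have vd: "v \<in> carrier_vec n" unfolding v_def by (intro carrier_vecI) simp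
  have rB: "rat_cm B *\<^sub>v ?y = rat_vec (const_pm B *\<^sub>v h)"
    unfolding rat_cm_def by (rule rat_pm_mult_vec[symmetric, OF _ h]) (use ABC in simp)
  have Fv: "F *\<^sub>v v = rat_vec (const_pm B *\<^sub>v h)" unfolding v_def rB[symmetric] by (simp add: cancel)
  have rD: "rat_pm Dp *\<^sub>v ?y = rat_vec (Dp *\<^sub>v h)" by (rule rat_pm_mult_vec[symmetric, OF Dpoly_carrier h])
  have "rat_pm Dp *\<^sub>v ?y + rat_cm C *\<^sub>v v = 0\<^sub>v m"
    using null yd unfolding right_null_def G_def v_def by (simp add: mult_mat_vec_dim_rules)
  then have "rat_pm Dp *\<^sub>v ?y = - (rat_cm C *\<^sub>v v)" by (subst (asm) vec_add_eq_zero) auto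
  then have Cv: "rat_cm C *\<^sub>v v = rat_vec (- (Dp *\<^sub>v h))" by (simp add: rat_vec_uminus rD[symmetric])
  \<comment> \<open>Both hypotheses of observability hold: (lambda I - A) v = B h is polynomial, and
    C v = - D h is polynomial because G h = 0.\<close>
  obtain u where u: "v = rat_vec u" using observable_polynomial[OF minreal vd Fv Cv] by blast
  have ud: "u \<in> carrier_vec n" using vd u by simp
  have "rat_vec (lamI_minus A *\<^sub>v u) = rat_vec (const_pm B *\<^sub>v h)"
    using Fv rat_pm_mult_vec[OF lamI_minus_carrier[OF ABC(1)] ud] by (simp add: u)
  then have Au: "lamI_minus A *\<^sub>v u = const_pm B *\<^sub>v h" by (simp add: rat_vec_inj)
  have du: "vec_degree u \<le> vec_degree h"
    using vec_degree_lamI_minus[OF ABC(1) ud] vec_degree_const_mult[OF ABC(2) h] unfolding Au by simp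
  have "rat_vec (- (Dp *\<^sub>v h)) = rat_vec (const_pm C *\<^sub>v u)"
    unfolding Cv[symmetric] u rat_cm_def by (rule rat_pm_mult_vec[symmetric, OF _ ud]) (use ABC in simp)
  then have "- (Dp *\<^sub>v h) = const_pm C *\<^sub>v u" by (simp add: rat_vec_inj)
  \<comment> \<open>A direct estimate would add the degree of D; replacing D h by - C u removes that
    growth.\<close>
  then have dD: "vec_degree (Dp *\<^sub>v h) \<le> vec_degree h"
    using vec_degree_const_mult[OF ABC(3) ud] du vec_degree_uminus[of "Dp *\<^sub>v h"] by simp
  obtain Q' where Q': "Q' \<in> carrier_mat k (k - 1)" "Q = rat_pm Q'"
    using Q_mat(5)[OF al k1, of be ga] by blast
  define Np where "Np = kron (transpose_mat Q') (1\<^sub>m m)"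
  have Np: "Np \<in> carrier_mat ?q (k * m)"
    unfolding Np_def by (rule kron_carrier[OF transpose_carrier_mat[THEN iffD2, OF Q'(1)] one_carrier_mat])
  have rN: "rat_pm Np = kron (transpose_mat Q) (1\<^sub>m m)"
    by (simp add: Np_def rat_pm_kron_one rat_pm_transpose Q'(2))
  define z where "z = Np *\<^sub>v (mB *\<^sub>v h)"
  have mBh: "mB *\<^sub>v h \<in> carrier_vec (k * m)" by (rule mult_mat_vec_carrier[OF mB_carrier h])
  have z: "z \<in> carrier_vec ?q" unfolding z_def by (rule mult_mat_vec_carrier[OF Np mBh])
  have rm: "rat_vec (mB *\<^sub>v h) = rat_pm mB *\<^sub>v ?y" by (rule rat_pm_mult_vec[OF mB_carrier h])
  have rz: "rat_vec z = kron (transpose_mat Q) (1\<^sub>m m) *\<^sub>v (rat_pm mB *\<^sub>v ?y)"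
    unfolding z_def rat_pm_mult_vec[OF Np mBh] rN rm ..
  have dz: "vec_degree z \<le> vec_degree h"
  proof (rule pencil_degree[OF z h _ _ dD])
    show Dh: "Dp *\<^sub>v h \<in> carrier_vec m" by (rule mult_mat_vec_carrier[OF Dpoly_carrier h])
    let ?E = "kron (transpose_mat (ekT k)) (1\<^sub>m m) :: 'a poly mat"
    have E: "?E \<in> carrier_mat (k * m) m"
      using kron_carrier[of "transpose_mat (ekT k)" k 1 "1\<^sub>m m" m m] ekT_carrier[of k] by simp
    have rE: "rat_pm ?E = kron (transpose_mat (ekT k)) (1\<^sub>m m)"
      by (simp add: rat_pm_kron_one rat_pm_transpose rat_pm_ekT)
    \<comment> \<open>The resolution of the identity applied to mB h, its \<open>Pt\<close>
      component being D h, yields the equation for z.\<close>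
    have "rat_vec (Mtp *\<^sub>v z + ?E *\<^sub>v (Dp *\<^sub>v h)) = rat_vec (Mtp *\<^sub>v z) + rat_vec (?E *\<^sub>v (Dp *\<^sub>v h))"
      by (rule eq_vecI) (auto simp: ratf.hom_add)
    also have "\<dots> = rat_pm Mtp *\<^sub>v (kron (transpose_mat Q) (1\<^sub>m m) *\<^sub>v (rat_pm mB *\<^sub>v ?y))
        + kron (transpose_mat (ekT k)) (1\<^sub>m m) *\<^sub>v (transpose_mat (rat_pm Pm) *\<^sub>v (rat_pm mB *\<^sub>v ?y))"
      unfolding rat_pm_mult_vec[OF Mtp_carrier z] rz rat_pm_mult_vec[OF E Dh] rE rD[symmetric]
      using apply_eq[OF Pt_Mb, of ?y] yd by simp
    also have "\<dots> = rat_pm mB *\<^sub>v ?y" by (rule resolve) simp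
    also have "\<dots> = rat_vec (mB *\<^sub>v h)" by (rule rm[symmetric])
    finally show "Mtp *\<^sub>v z + ?E *\<^sub>v (Dp *\<^sub>v h) = mB *\<^sub>v h" by (simp only: rat_vec_inj)
  qed
  note iS = minv_det(1)[OF S] and iW = minv_det(1)[OF WJ_carrier WJ]
  define x1 where "x1 = - (const_pm (minv S) *\<^sub>v u)"
  define x2 where "x2 = const_pm (minv (WJ m w J)) *\<^sub>v (h @\<^sub>v - z)"
  have hz: "h @\<^sub>v - z \<in> carrier_vec (k * m)" unfolding km using h z by simp
  have rx1: "rat_vec x1 = - (rat_cm (minv S) *\<^sub>v v)"
    unfolding x1_def rat_vec_uminus u rat_cm_def
    by (subst rat_pm_mult_vec[OF _ ud]) (use iS in simp_all)
  have rx2: "rat_vec x2 = rat_cm (minv (WJ m w J)) *\<^sub>v (?y @\<^sub>v - rat_vec z)"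
    unfolding x2_def rat_cm_def rat_vec_uminus[symmetric] rat_vec_append[symmetric]
    by (rule rat_pm_mult_vec[OF _ hz]) (use iW in simp)
  have "rat_vec (x1 @\<^sub>v x2) = right_lift *\<^sub>v ?y"
    unfolding right_lift_mult[OF yd] rat_vec_append rx1 rx2 rz v_def ..
  moreover have "vec_degree (x1 @\<^sub>v x2) = vec_degree h"
  proof (rule order_antisym)
    have "vec_degree x1 \<le> vec_degree h"
      using vec_degree_const_mult[OF iS ud] du by (simp add: x1_def)
    moreover have "vec_degree (h @\<^sub>v - z) \<le> vec_degree h" using dz by (simp add: vec_degree_append_le_iff)
    then have "vec_degree x2 \<le> vec_degree h"
      using vec_degree_const_mult[OF iW hz] by (simp add: x2_def)
    ultimately show "vec_degree (x1 @\<^sub>v x2) \<le> vec_degree h" by (simp add: vec_degree_append_le_iff)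
    have x2: "x2 \<in> carrier_vec (k * m)"
      unfolding x2_def by (rule mult_mat_vec_carrier[OF _ hz]) (use iW in simp)
    \<comment> \<open>Lower bound: h comes back from \<open>x2\<close> through a constant matrix,
      which cannot raise degrees.\<close>
    have "rat_vec (const_pm (wI m w) *\<^sub>v x2) = rat_cm (wI m w) *\<^sub>v rat_vec x2"
      unfolding rat_cm_def by (rule rat_pm_mult_vec[OF _ x2]) (use wI_carrier in simp)
    also have "\<dots> = ?y" unfolding rx2 using yd z by (intro W_Wi) simp_all
    finally have "h = const_pm (wI m w) *\<^sub>v x2" by (simp add: rat_vec_inj)
    then have "vec_degree h \<le> vec_degree x2" using vec_degree_const_mult[OF wI_carrier x2] by simp
    also have "\<dots> \<le> vec_degree (x1 @\<^sub>v x2)" using vec_degree_append_le_iff by blast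
    finally show "vec_degree h \<le> vec_degree (x1 @\<^sub>v x2)" .
  qed
  ultimately show ?thesis by blast
qed

lemma Pm_index:
  assumes "r < k * m" "b < m"
  shows "Pm $$ (r, b) = (if r mod m = b then phi al be ga (k - 1 - r div m) else 0)"
proof -
  have "r div m < k" using assms(1) by (simp add: less_mult_imp_div_less)
  then show ?thesis
    using kron_one_index[OF Phi_vec_carrier, of r k m b al be ga] assms by (simp add: Phi_vec_def)
qed

lemma Pm_mult_vec_index:
  assumes "h \<in> carrier_vec m" "r < k * m"
  shows "(Pm *\<^sub>v h) $ r = phi al be ga (k - 1 - r div m) * h $ (r mod m)"
proof -
  have m: "m > 0" using assms(2) by (cases m) auto
  have "(Pm *\<^sub>v h) $ r = (\<Sum>b = 0..<m. Pm $$ (r,b) * h $ b)"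
    by (rule mult_mat_vec_index[OF Pm_carrier assms])
  also have "\<dots> = (\<Sum>b = 0..<m. if b = r mod m then phi al be ga (k - 1 - r div m) * h $ b else 0)"
    by (intro sum.cong) (use assms in \<open>auto simp: Pm_index\<close>)
  finally show ?thesis using m by simp
qed

text \<open>The first of the lower blocks is phi_{k-1} h and dominates: the other multiples have
  smaller factors, and the state component has degree at most that of h. Here h must be nonzero for
  the shift to be exact.\<close>

lemma left_lift_poly:
  assumes h: "h \<in> carrier_vec m" and null: "rat_vec h \<in> right_null (transpose_mat G)" and nz: "h \<noteq> 0\<^sub>v m"
  shows "\<exists>g. rat_vec g = left_lift *\<^sub>v rat_vec h \<and> vec_degree g = vec_degree h + (k - 1)"
proof -
  let ?y = "rat_vec h"
  have hd[simp]: "dim_vec h = m" using h by simp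
  then have yd: "dim_vec ?y = m" by simp
  have FT: "rat_pm (lamI_minus (transpose_mat A)) = transpose_mat F"
    using ABC by (simp add: lamI_minus_transpose rat_pm_transpose)
  have ABCT: "transpose_mat A \<in> carrier_mat n n" "transpose_mat B \<in> carrier_mat m n" "transpose_mat C \<in> carrier_mat n m"
    using ABC by simp_all
  define v where "v = transpose_mat (minv F) *\<^sub>v (transpose_mat (rat_cm C) *\<^sub>v ?y)"
  have vd: "v \<in> carrier_vec n" unfolding v_def by (intro carrier_vecI) simp
  have rC: "transpose_mat (rat_cm C) *\<^sub>v ?y = rat_vec (const_pm (transpose_mat C) *\<^sub>v h)"
    unfolding rat_cm_transpose[symmetric] unfolding rat_cm_def
    by (rule rat_pm_mult_vec[symmetric, OF _ h]) (use ABCT in simp)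
  have Fv: "rat_pm (lamI_minus (transpose_mat A)) *\<^sub>v v = rat_vec (const_pm (transpose_mat C) *\<^sub>v h)"
    unfolding FT v_def rC[symmetric] by (simp add: cancel_transpose)
  have rD: "transpose_mat (rat_pm Dp) *\<^sub>v ?y = rat_vec (transpose_mat Dp *\<^sub>v h)"
    unfolding rat_pm_transpose[symmetric]
    by (rule rat_pm_mult_vec[symmetric, OF _ h]) (use Dpoly_carrier in \<open>simp only: transpose_carrier_mat\<close>)
  have GT: "transpose_mat G = transpose_mat (rat_pm Dp) + transpose_mat (rat_cm B) * (transpose_mat (minv F) * transpose_mat (rat_cm C))"
  proof -
    have "transpose_mat G = transpose_mat (rat_pm Dp) + transpose_mat (rat_cm C * minv F * rat_cm B)"
      unfolding G_def by (rule eq_matI) auto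
    then show ?thesis by (simp add: transpose_mult_dim)
  qed
  have "transpose_mat (rat_pm Dp) *\<^sub>v ?y + transpose_mat (rat_cm B) *\<^sub>v v = 0\<^sub>v m"
    using null yd unfolding right_null_def GT v_def by (simp add: mult_mat_vec_dim_rules)
  then have "transpose_mat (rat_pm Dp) *\<^sub>v ?y = - (transpose_mat (rat_cm B) *\<^sub>v v)"
    by (subst (asm) vec_add_eq_zero) auto
  then have Bv: "rat_cm (transpose_mat B) *\<^sub>v v = rat_vec (- (transpose_mat Dp *\<^sub>v h))"
    by (simp add: rat_cm_transpose rat_vec_uminus rD[symmetric])
  \<comment> \<open>Observability of the dual realization (A^T, C^T, B^T), with B^T as output
    matrix.\<close>
  obtain u where u: "v = rat_vec u"
    using observable_polynomial[OF minimal_realization_transpose[OF minreal] vd Fv Bv] by blast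
  have ud: "u \<in> carrier_vec n" using vd u by simp
  have "rat_vec (lamI_minus (transpose_mat A) *\<^sub>v u) = rat_vec (const_pm (transpose_mat C) *\<^sub>v h)"
    using Fv rat_pm_mult_vec[OF lamI_minus_carrier[OF ABCT(1)] ud] by (simp add: u)
  then have Au: "lamI_minus (transpose_mat A) *\<^sub>v u = const_pm (transpose_mat C) *\<^sub>v h" by (simp only: rat_vec_inj)
  have du: "vec_degree u \<le> vec_degree h"
    using vec_degree_lamI_minus[OF ABCT(1) ud] vec_degree_const_mult[OF ABCT(3) h] unfolding Au by simp
  note iT = minv_det(1)[OF T]
  have iTT: "transpose_mat (minv T) \<in> carrier_mat n n" using iT by simp
  define x1 where "x1 = const_pm (transpose_mat (minv T)) *\<^sub>v u"
  have rx1: "rat_vec x1 = transpose_mat (rat_cm (minv T)) *\<^sub>v v"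
    unfolding x1_def u rat_cm_transpose[symmetric] unfolding rat_cm_def
    by (rule rat_pm_mult_vec[OF _ ud]) (use iTT in simp)
  have "rat_vec (x1 @\<^sub>v Pm *\<^sub>v h) = left_lift *\<^sub>v ?y"
    unfolding left_lift_mult[OF yd] rat_vec_append rx1 rat_pm_mult_vec[OF Pm_carrier h] v_def
    using yd by (simp add: transpose_mult_dim mult_mat_vec_dim_rules)
  moreover have "vec_degree (x1 @\<^sub>v Pm *\<^sub>v h) = vec_degree h + (k - 1)"
  proof (rule order_antisym)
    have "vec_degree x1 \<le> vec_degree h"
      using vec_degree_const_mult[OF iTT ud] du by (simp add: x1_def)
    moreover have "vec_degree (Pm *\<^sub>v h) \<le> vec_degree h + (k - 1)"
      unfolding vec_degree_le_iff
    proof (intro allI impI)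
      fix r assume "r < dim_vec (Pm *\<^sub>v h)"
      then have r: "r < k * m" using Pm_carrier by simp
      then have "r mod m < m" by (cases m) auto
      then show "degree ((Pm *\<^sub>v h) $ r) \<le> vec_degree h + (k - 1)"
        unfolding Pm_mult_vec_index[OF h r]
        using degree_mult_le[of "phi al be ga (k - 1 - r div m)" "h $ (r mod m)"]
          degree_le_vec_degree[of "r mod m" h] h by (simp add: degree_phi[OF al])
    qed
    ultimately show "vec_degree (x1 @\<^sub>v Pm *\<^sub>v h) \<le> vec_degree h + (k - 1)"
      by (simp add: vec_degree_append_le_iff)
    obtain i where i: "i < m" "h $ i \<noteq> 0" "degree (h $ i) = vec_degree h"
      using vec_degree_attained[OF h nz] by blast
    \<comment> \<open>An index below \<open>m\<close> lies in the first block, whose factor is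
      phi_{k-1}.\<close>
    have im: "i < k * m" using i(1) km by simp
    have "phi al be ga (k - 1) \<noteq> 0" using degree_phi[OF al, of be ga "k - 1"] k2 by auto
    then have "degree ((Pm *\<^sub>v h) $ i) = vec_degree h + (k - 1)"
      unfolding Pm_mult_vec_index[OF h im] using i by (simp add: degree_mult_eq degree_phi[OF al])
    then have "vec_degree h + (k - 1) \<le> vec_degree (Pm *\<^sub>v h)"
      using degree_le_vec_degree[of i "Pm *\<^sub>v h"] im Pm_carrier by simp
    also have "\<dots> \<le> vec_degree (x1 @\<^sub>v Pm *\<^sub>v h)" using vec_degree_append_le_iff by blast
    finally show "vec_degree h + (k - 1) \<le> vec_degree (x1 @\<^sub>v Pm *\<^sub>v h)" .
  qed
  ultimately show ?thesis by blast
qed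

end

lemma row_block_add: "row_block X a (b + c) = row_block X a b @\<^sub>r row_block X (a + b) c"
  by (rule eq_matI) (auto simp: row_block_def append_rows_def add.assoc)

lemma (in null_transfer) minimal_basis_iff:
  "right_minimal_basis X H \<longleftrightarrow> minimal_basis_of p (right_null X) H"
  "right_minimal_basis Y H \<longleftrightarrow> minimal_basis_of q (right_null Y) H"
  by (simp_all add: right_minimal_basis_def dim)

context m2_linearization
begin

text \<open>Shift 0. Dropping multiplies the lower part by the constant w^T \<otimes> I and so keeps
  polynomial vectors polynomial.\<close>

sublocale right: null_transfer G L right_lift right_drop m "n + k * m" 0
proof
  show "dim_col L = n + k * m" by (rule result_dims)
  show "right_lift \<in> carrier_mat (n + k * m) m" "right_drop \<in> carrier_mat m (n + k * m)"
    by (auto intro: carrier_matI)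
  fix g :: "'a poly vec" assume g: "g \<in> carrier_vec (n + k * m)"
  then obtain u v where uv: "g = u @\<^sub>v v" "dim_vec u = n" "dim_vec v = k * m"
    using vec_split[of g n "k * m"] by auto
  have "rat_vec (const_pm (wI m w) *\<^sub>v v) = right_drop *\<^sub>v rat_vec g"
    unfolding uv(1) rat_vec_append using right_drop_mult[of "rat_vec u" "rat_vec v"] uv(2,3)
      rat_pm_mult_vec[OF const_pm_carrier[THEN iffD2, OF wI_carrier] carrier_vecI[OF uv(3)]]
    by (metis index_map_vec(2) rat_cm_def)
  then show "\<exists>h. rat_vec h = right_drop *\<^sub>v rat_vec g" by blast
qed (use right_lift_null right_drop_null right_lift_poly in auto)

text \<open>The shift is the degree of phi_{k-1}; dropping selects the last block, where the factor
  is phi_0 = 1.\<close>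

sublocale left: null_transfer "transpose_mat G" "transpose_mat L" left_lift left_drop m "n + k * m" "k - 1"
proof
  show "dim_col (transpose_mat L) = n + k * m" unfolding index_transpose_mat by (rule result_dims)
  show "left_lift \<in> carrier_mat (n + k * m) m" "left_drop \<in> carrier_mat m (n + k * m)"
    by (auto intro: carrier_matI)
  fix g :: "'a poly vec" assume g: "g \<in> carrier_vec (n + k * m)"
  then obtain u v where uv: "g = u @\<^sub>v v" "dim_vec u = n" "dim_vec v = k * m"
    using vec_split[of g n "k * m"] by auto
  have E: "kron (ekT k) (1\<^sub>m m) \<in> carrier_mat m (k * m)"
    using kron_carrier[OF ekT_carrier one_carrier_mat[of m], of k] by simp
  have "transpose_mat (kron (transpose_mat (ekT k)) (1\<^sub>m m)) = kron (ekT k) (1\<^sub>m m)"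
    using kron_one_transpose[of "transpose_mat (ekT k)" k 1 m] ekT_carrier[of k] by simp
  also have "\<dots> = rat_pm (kron (ekT k) (1\<^sub>m m))" by (simp add: rat_pm_kron_one rat_pm_ekT)
  finally have "rat_vec (kron (ekT k) (1\<^sub>m m) *\<^sub>v v) = left_drop *\<^sub>v rat_vec g"
    unfolding uv(1) rat_vec_append using left_drop_mult[of "rat_vec u" "rat_vec v"] uv(2,3)
      rat_pm_mult_vec[OF E carrier_vecI[OF uv(3)]] by (metis index_map_vec(2))
  then show "\<exists>h. rat_vec h = left_drop *\<^sub>v rat_vec g" by blast
qed (use left_lift_null left_drop_null left_lift_poly in auto)

lemmas minimal_basis_iff = right.minimal_basis_iff left.minimal_basis_iff[folded left_minimal_basis_eq]

section \<open>Matrix form of the lifts, and statements (a) to (e)\<close>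

lemma right_lift_mult_mat:
  assumes "X \<in> carrier_mat m l"
  shows "right_lift * X = - (rat_cm (minv S) * minv F * rat_cm B * X) @\<^sub>r
    minv (rat_cm (WJ m w J)) * (X @\<^sub>r - (kron (transpose_mat Q) (1\<^sub>m m) * rat_pm mB * X))"
proof -
  let ?R = "rat_cm (minv S) * minv F * rat_cm B" and ?N = "kron (transpose_mat Q) (1\<^sub>m m) * rat_pm mB"
  let ?W = "rat_cm (minv (WJ m w J))"
  have R: "- ?R \<in> carrier_mat n m" and N: "- ?N \<in> carrier_mat ((k - 1) * m) m"
    using carrier by (auto intro!: carrier_matI)
  have I: "1\<^sub>m m @\<^sub>r - ?N \<in> carrier_mat (k * m) m"
    unfolding km by (rule carrier_append_rows[OF one_carrier_mat N])
  have WI: "?W * (1\<^sub>m m @\<^sub>r - ?N) \<in> carrier_mat (k * m) m" by (rule mult_carrier_mat[OF carrier(17) I])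
  have "right_lift * X = - ?R * X @\<^sub>r ?W * (1\<^sub>m m @\<^sub>r - ?N) * X"
    unfolding right_lift_def by (rule append_rows_mult[OF R WI assms])
  also have "- ?R * X = - (?R * X)" using assms by (intro uminus_mult_left_mat) auto
  also have "?W * (1\<^sub>m m @\<^sub>r - ?N) * X = ?W * ((1\<^sub>m m @\<^sub>r - ?N) * X)"
    by (rule assoc_mult_mat[OF carrier(17) I assms])
  also have "(1\<^sub>m m @\<^sub>r - ?N) * X = X @\<^sub>r - ?N * X"
    unfolding append_rows_mult[OF one_carrier_mat N assms] left_mult_one_mat[OF assms] ..
  also have "- ?N * X = - (?N * X)" using assms by (intro uminus_mult_left_mat) auto
  finally show ?thesis unfolding minv_rat_cm[OF WJ_carrier WJ] .
qed

lemma split_rows: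
  assumes "dim_row H = n + k * m"
  shows "rat_pm H = rat_pm (row_block H 0 n) @\<^sub>r rat_pm (row_block H n (k * m))"
proof -
  have c: "row_block H 0 n \<in> carrier_mat n (dim_col H)" "row_block H n (k * m) \<in> carrier_mat (k * m) (dim_col H)"
    by (intro carrier_matI, simp_all)+
  show ?thesis using rat_pm_append_rows[OF c] unfolding row_block_append[OF assms] .
qed
lemma right_drop_mult_mat:
  assumes "dim_row H = n + k * m"
  shows "right_drop * rat_pm H = rat_pm (const_pm (wI m w) * row_block H n (k * m))"
proof -
  let ?U = "rat_pm (row_block H 0 n)" and ?V = "row_block H n (k * m)"
  have U: "?U \<in> carrier_mat n (dim_col H)" and V: "?V \<in> carrier_mat (k * m) (dim_col H)"
    by (intro carrier_matI, simp_all)+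
  have "right_drop * rat_pm H = 0\<^sub>m m n * ?U + rat_cm (wI m w) * rat_pm ?V"
    unfolding right_drop_def split_rows[OF assms]
    by (rule beside_mult_append_rows[OF zero_carrier_mat _ U]) (use wI_carrier V in simp_all)
  also have "0\<^sub>m m n * ?U = 0\<^sub>m m (dim_col H)" by (rule left_mult_zero_mat[OF U])
  also have "rat_cm (wI m w) * rat_pm ?V = rat_pm (const_pm (wI m w) * ?V)"
    unfolding rat_cm_def by (rule rat_pm_mult[symmetric, OF _ V]) (use wI_carrier in simp)
  also have "0\<^sub>m m (dim_col H) + rat_pm (const_pm (wI m w) * ?V) = rat_pm (const_pm (wI m w) * ?V)"
    by (rule left_add_zero_mat) (use wI_carrier V in \<open>simp add: mult_carrier_mat[of _ m "k * m"]\<close>)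
  finally show ?thesis .
qed

text \<open>A minimal basis of the linearization is the lift of its own drop; the formula for the
  state part is the upper block of that identity.\<close>

lemma right_minimal_basis_drop:
  assumes H: "right_minimal_basis L H"
  defines "H2 \<equiv> const_pm (wI m w) * row_block H n (k * m)"
  shows "right_minimal_basis G H2"
    and "rat_pm (row_block H 0 n) = - (rat_cm (minv S) * minv F * rat_cm B * rat_pm H2)"
proof -
  have min: "minimal_basis_of (n + k * m) (right_null L) H" using H unfolding minimal_basis_iff .
  then have d: "dim_row H = n + k * m" unfolding minimal_basis_of_def poly_basis_of_def by blast
  have eq: "rat_pm H2 = right_drop * rat_pm H" unfolding H2_def right_drop_mult_mat[OF d] ..
  note low = right.lower_minimal[OF min eq]
  show "right_minimal_basis G H2" using low(1) unfolding minimal_basis_iff .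
  have H2: "rat_pm H2 \<in> carrier_mat m (dim_col H)"
    unfolding eq by (intro carrier_matI) simp_all
  show "rat_pm (row_block H 0 n) = - (rat_cm (minv S) * minv F * rat_cm B * rat_pm H2)"
  proof (rule eq_matI)
    fix i j assume "i < dim_row (- (rat_cm (minv S) * minv F * rat_cm B * rat_pm H2))"
      "j < dim_col (- (rat_cm (minv S) * minv F * rat_cm B * rat_pm H2))"
    then have ij: "i < n" "j < dim_col H" using carrier_matD[OF H2] by simp_all
    then show "rat_pm (row_block H 0 n) $$ (i,j) = (- (rat_cm (minv S) * minv F * rat_cm B * rat_pm H2)) $$ (i,j)"
      using arg_cong[OF low(2)[unfolded split_rows[OF d] right_lift_mult_mat[OF H2]], of "\<lambda>X. X $$ (i,j)"]
        carrier_matD[OF H2] by (simp add: append_rows_def)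
  qed (use carrier_matD[OF H2] in simp_all)
qed

lemma right_minimal_basis_lift:
  assumes H: "right_minimal_basis G H"
  shows "\<exists>H1 H2. rat_pm H1 = - (rat_cm (minv S) * minv F * rat_cm B * rat_pm H) \<and>
    rat_pm H2 = minv (rat_cm (WJ m w J)) * (rat_pm H @\<^sub>r - (kron (transpose_mat Q) (1\<^sub>m m) * rat_pm mB * rat_pm H)) \<and>
    right_minimal_basis L (H1 @\<^sub>r H2)"
proof -
  have min: "minimal_basis_of m (right_null G) H" using H unfolding minimal_basis_iff .
  then have b: "poly_basis_of m (right_null G) H" unfolding minimal_basis_of_def by blast
  from right.lift_basis[OF b] obtain H' where H': "rat_pm H' = right_lift * rat_pm H" by blast
  have d: "dim_row H' = n + k * m" "dim_col H' = dim_col H"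
    using arg_cong[OF H', of dim_row] arg_cong[OF H', of dim_col] by simp_all
  let ?l = "dim_col H"
  let ?X1 = "- (rat_cm (minv S) * minv F * rat_cm B * rat_pm H)"
  let ?X2 = "minv (rat_cm (WJ m w J)) * (rat_pm H @\<^sub>r - (kron (transpose_mat Q) (1\<^sub>m m) * rat_pm mB * rat_pm H))"
  have "rat_pm (row_block H' 0 n) @\<^sub>r rat_pm (row_block H' n (k * m)) = ?X1 @\<^sub>r ?X2"
    using H' unfolding split_rows[OF d(1)] right_lift_mult_mat[OF poly_basis_carrier[OF b]] .
  moreover have "rat_pm (row_block H' 0 n) \<in> carrier_mat n ?l" "?X1 \<in> carrier_mat n ?l"
    "rat_pm (row_block H' n (k * m)) \<in> carrier_mat (k * m) ?l" "?X2 \<in> carrier_mat (k * m) ?l"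
    using d minv_rat_cm[OF WJ_carrier WJ] minv_det(1)[OF WJ_carrier WJ, THEN carrier_matD(1)]
    by (intro carrier_matI, simp_all)+
  ultimately have "rat_pm (row_block H' 0 n) = ?X1 \<and> rat_pm (row_block H' n (k * m)) = ?X2"
    using append_rows_eq by metis
  moreover have "right_minimal_basis L (row_block H' 0 n @\<^sub>r row_block H' n (k * m))"
    unfolding row_block_append[OF d(1)] using right.lift_minimal[OF min H'] unfolding minimal_basis_iff .
  ultimately show ?thesis by blast
qed

lemma right_indices_lift:
  assumes "right_minimal_indices G es" shows "right_minimal_indices L es"
proof -
  from assms obtain H where H: "minimal_basis_of m (right_null G) H" "sort (col_degrees H) = es"
    unfolding right_minimal_indices_def minimal_basis_iff by blast
  then have b: "poly_basis_of m (right_null G) H" unfolding minimal_basis_of_def by blast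
  from right.lift_basis[OF b] obtain H' where H': "rat_pm H' = right_lift * rat_pm H" by blast
  have "sort (col_degrees H') = es" using right.lift_degrees[OF b H'] H(2) by simp
  then show ?thesis using right.lift_minimal[OF H(1) H']
    unfolding right_minimal_indices_def minimal_basis_iff by blast
qed

lemma left_indices_lift:
  assumes "left_minimal_indices G es" shows "left_minimal_indices L (map (\<lambda>e. e + k - 1) es)"
proof -
  from assms obtain H where H: "minimal_basis_of m (right_null (transpose_mat G)) H" "sort (col_degrees H) = es"
    unfolding left_minimal_indices_def minimal_basis_iff by blast
  then have b: "poly_basis_of m (right_null (transpose_mat G)) H" unfolding minimal_basis_of_def by blast
  from left.lift_basis[OF b] obtain H' where H': "rat_pm H' = left_lift * rat_pm H" by blast
  \<comment> \<open>The subtraction is truncated and applies to \<open>e + k\<close>; as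
    \<open>k\<close> is positive it is a shift by \<open>k - 1\<close>.\<close>
  have "(\<lambda>e. e + k - 1) = (\<lambda>e. e + (k - 1))" using k2 by auto
  then have "sort (col_degrees H') = map (\<lambda>e. e + k - 1) es"
    using left.lift_degrees[OF b H'] H(2) by (simp add: sort_map_add)
  then show ?thesis using left.lift_minimal[OF H(1) H']
    unfolding left_minimal_indices_def minimal_basis_iff by blast
qed

lemma Pm_mult_index:
  assumes X: "X \<in> carrier_mat m l" and "r < k * m" "c < l"
  shows "(Pm * X) $$ (r,c) = phi al be ga (k - 1 - r div m) * X $$ (r mod m, c)"
proof -
  have "r mod m < m" using assms(2) by (cases m) auto
  moreover have "(Pm * X) $$ (r,c) = (Pm *\<^sub>v col X c) $ r"
    using assms carrier_matD[OF Pm_carrier] by simp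
  ultimately show ?thesis
    using Pm_mult_vec_index[of "col X c" r] assms by (auto intro: carrier_vecI)
qed

text \<open>Translates between zero-based blocks of the product and the numbering of the theorem,
  where block 1 is the state: block \<open>i\<close> has position \<open>i - 2\<close> and factor
  phi_{k-i+1}.\<close>

lemma Pm_blocks:
  assumes d: "dim_row H = n + k * m"
  defines "Hl \<equiv> row_block H (n + (k - 1) * m) m"
  shows "row_block H n (k * m) = Pm * Hl \<longleftrightarrow>
    (\<forall>i \<in> {2..k}. row_block H (n + (i - 2) * m) m = map_mat (\<lambda>p. phi al be ga (k - i + 1) * p) Hl)"
proof -
  let ?l = "dim_col H"
  have Hl: "Hl \<in> carrier_mat m ?l" unfolding Hl_def by (intro carrier_matI) simp_all
  have blk: "row_block H n (k * m) $$ (p * m + r, c) = H $$ (n + p * m + r, c)" if "p < k" "r < m" "c < ?l" for p r c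
    using that block_index_less[OF that(1,2)] by (simp add: row_block_def add.assoc)
  have prod: "(Pm * Hl) $$ (p * m + r, c) = phi al be ga (k - 1 - p) * Hl $$ (r, c)" if "p < k" "r < m" "c < ?l" for p r c
    using Pm_mult_index[OF Hl block_index_less[OF that(1,2)] that(3)] that by simp
  show ?thesis
  proof
    assume eq: "row_block H n (k * m) = Pm * Hl"
    show "\<forall>i \<in> {2..k}. row_block H (n + (i - 2) * m) m = map_mat (\<lambda>p. phi al be ga (k - i + 1) * p) Hl"
    proof
      fix i assume i: "i \<in> {2..k}"
      then have p: "i - 2 < k" "k - 1 - (i - 2) = k - i + 1" by auto
      show "row_block H (n + (i - 2) * m) m = map_mat (\<lambda>p. phi al be ga (k - i + 1) * p) Hl"
      proof (rule eq_matI)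
        fix r c assume "r < dim_row (map_mat (\<lambda>p. phi al be ga (k - i + 1) * p) Hl)"
          "c < dim_col (map_mat (\<lambda>p. phi al be ga (k - i + 1) * p) Hl)"
        then have rc: "r < m" "c < ?l" using Hl by auto
        have "row_block H (n + (i - 2) * m) m $$ (r,c) = phi al be ga (k - i + 1) * Hl $$ (r,c)"
          using blk[OF p(1) rc] prod[OF p(1) rc] rc unfolding eq p(2) by (simp add: row_block_def)
        then show "row_block H (n + (i - 2) * m) m $$ (r,c) = map_mat (\<lambda>p. phi al be ga (k - i + 1) * p) Hl $$ (r,c)"
          using rc carrier_matD[OF Hl] by simp
      qed (simp_all add: Hl_def)
    qed
  next
    assume all: "\<forall>i \<in> {2..k}. row_block H (n + (i - 2) * m) m = map_mat (\<lambda>p. phi al be ga (k - i + 1) * p) Hl"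
    show "row_block H n (k * m) = Pm * Hl"
    proof (rule eq_matI)
      fix r' c assume "r' < dim_row (Pm * Hl)" "c < dim_col (Pm * Hl)"
      then have rc': "r' < k * m" "c < ?l" using carrier_matD[OF Pm_carrier] carrier_matD[OF Hl] by simp_all
      define p r where "p = r' div m" and "r = r' mod m"
      have m: "m > 0" using rc' by (cases m) auto
      have p: "p < k" "r < m" and r': "r' = p * m + r"
        using rc' m by (auto simp: p_def r_def less_mult_imp_div_less)
      show "row_block H n (k * m) $$ (r',c) = (Pm * Hl) $$ (r',c)"
        unfolding r' blk[OF p rc'(2)] prod[OF p rc'(2)]
      \<comment> \<open>The last block is number k + 1, outside \<open>{2..k}\<close>; there the
        factor is phi_0 = 1 and the claim is the definition of \<open>Hl\<close>.\<close>
      proof (cases "p = k - 1")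
        case True
        then show "H $$ (n + p * m + r, c) = phi al be ga (k - 1 - p) * Hl $$ (r, c)"
          using p rc' by (simp add: Hl_def row_block_def)
      next
        case False
        then have i: "p + 2 \<in> {2..k}" "k - (p + 2) + 1 = k - 1 - p" using p by auto
        have "row_block H (n + (p + 2 - 2) * m) m $$ (r,c) = map_mat (\<lambda>x. phi al be ga (k - (p + 2) + 1) * x) Hl $$ (r,c)"
          by (subst bspec[OF all i(1)]) (rule refl)
        then show "H $$ (n + p * m + r, c) = phi al be ga (k - 1 - p) * Hl $$ (r, c)"
          unfolding i(2) using p rc' carrier_matD[OF Hl] by (simp add: row_block_def)
      qed
    qed (use carrier_matD[OF Pm_carrier] in \<open>simp_all add: Hl_def\<close>)
  qed
qed

lemma left_lift_mult_mat:
  assumes X: "X \<in> carrier_mat m l"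
  shows "left_lift * rat_pm X = transpose_mat (rat_cm C * minv F * rat_cm (minv T)) * rat_pm X @\<^sub>r rat_pm (Pm * X)"
proof -
  have "transpose_mat (rat_cm C * minv F * rat_cm (minv T)) \<in> carrier_mat n m"
    by (intro carrier_matI) simp_all
  from append_rows_mult[OF this rat_pm_carrier[THEN iffD2, OF Pm_carrier] rat_pm_carrier[THEN iffD2, OF X]]
  show ?thesis unfolding left_lift_def rat_pm_mult[OF Pm_carrier X] by simp
qed

lemma left_drop_mult_mat:
  assumes d: "dim_row H = n + k * m"
  shows "left_drop * rat_pm H = rat_pm (row_block H (n + (k - 1) * m) m)"
proof -
  let ?l = "dim_col H" and ?q = "(k - 1) * m"
  let ?U = "row_block H 0 n" and ?V = "row_block H n ?q" and ?W = "row_block H (n + ?q) m"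
  have c: "rat_pm ?U \<in> carrier_mat n ?l" "rat_pm ?V \<in> carrier_mat ?q ?l" "rat_pm ?W \<in> carrier_mat m ?l"
    by (intro carrier_matI, simp_all)+
  have k': "k * m = ?q + m" using km by simp
  have rV: "rat_pm (row_block H n (k * m)) = rat_pm ?V @\<^sub>r rat_pm ?W"
    unfolding k' row_block_add by (rule rat_pm_append_rows[of _ ?q ?l]) (intro carrier_matI, simp_all)+
  have E: "transpose_mat (kron (transpose_mat (ekT k)) (1\<^sub>m m)) = beside (0\<^sub>m m ?q) (1\<^sub>m m :: 'a poly fract mat)"
    unfolding kron_ekT[OF k1] by (rule eq_matI) (auto simp: append_rows_def beside_def)
  have "beside (0\<^sub>m m ?q) (1\<^sub>m m) * (rat_pm ?V @\<^sub>r rat_pm ?W) = 0\<^sub>m m ?q * rat_pm ?V + 1\<^sub>m m * rat_pm ?W"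
    by (rule beside_mult_append_rows[OF zero_carrier_mat one_carrier_mat c(2,3)])
  also have "\<dots> = rat_pm ?W"
    unfolding left_mult_zero_mat[OF c(2)] left_mult_one_mat[OF c(3)] by (rule left_add_zero_mat[OF c(3)])
  finally have EW: "beside (0\<^sub>m m ?q) (1\<^sub>m m) * (rat_pm ?V @\<^sub>r rat_pm ?W) = rat_pm ?W" .
  have VW: "rat_pm ?V @\<^sub>r rat_pm ?W \<in> carrier_mat (k * m) ?l"
    unfolding k' by (rule carrier_append_rows[OF c(2,3)])
  have Ec: "beside (0\<^sub>m m ?q) (1\<^sub>m m :: 'a poly fract mat) \<in> carrier_mat m (k * m)"
    unfolding k' by (intro carrier_matI) simp_all
  have "left_drop * rat_pm H = 0\<^sub>m m n * rat_pm ?U + rat_pm ?W"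
    unfolding left_drop_def split_rows[OF d] E rV beside_mult_append_rows[OF zero_carrier_mat Ec c(1) VW] EW ..
  then show ?thesis unfolding left_mult_zero_mat[OF c(1)] left_add_zero_mat[OF c(3)] .
qed

lemma left_lift_eq_iff:
  assumes d: "dim_row H = n + k * m"
  defines "Hl \<equiv> row_block H (n + (k - 1) * m) m"
  shows "rat_pm H = left_lift * rat_pm Hl \<longleftrightarrow>
    rat_pm (row_block H 0 n) = transpose_mat (rat_cm C * minv F * rat_cm (minv T)) * rat_pm Hl \<and>
    (\<forall>i \<in> {2..k}. row_block H (n + (i - 2) * m) m = map_mat (\<lambda>p. phi al be ga (k - i + 1) * p) Hl)"
proof -
  let ?l = "dim_col H"
  have Hl: "Hl \<in> carrier_mat m ?l" unfolding Hl_def by (intro carrier_matI) simp_all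
  have c: "rat_pm (row_block H 0 n) \<in> carrier_mat n ?l"
    "transpose_mat (rat_cm C * minv F * rat_cm (minv T)) * rat_pm Hl \<in> carrier_mat n ?l"
    "rat_pm (row_block H n (k * m)) \<in> carrier_mat (k * m) ?l" "rat_pm (Pm * Hl) \<in> carrier_mat (k * m) ?l"
    using carrier_matD[OF Pm_carrier] carrier_matD[OF Hl] by (intro carrier_matI, simp_all)+
  show ?thesis
    unfolding split_rows[OF d] left_lift_mult_mat[OF Hl] append_rows_eq[OF c] rat_pm_inj[of "row_block H n (k * m)"]
      Pm_blocks[OF d, folded Hl_def] ..
qed

text \<open>The block conditions say precisely that \<open>H\<close> is the lift of its last block,
  which is also its drop. The two directions are then the lowering and the lifting of
  minimality.\<close>

lemma left_minimal_basis_iff: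
  assumes d: "dim_row H = n + k * m"
  defines "Hl \<equiv> row_block H (n + (k - 1) * m) m"
  shows "left_minimal_basis L H \<longleftrightarrow> left_minimal_basis G Hl \<and>
    rat_pm (row_block H 0 n) = transpose_mat (rat_cm C * minv F * rat_cm (minv T)) * rat_pm Hl \<and>
    (\<forall>i \<in> {2..k}. row_block H (n + (i - 2) * m) m = map_mat (\<lambda>p. phi al be ga (k - i + 1) * p) Hl)"
proof -
  show ?thesis
    unfolding minimal_basis_iff
      left_lift_eq_iff[OF d, folded Hl_def, symmetric]
    using left.lower_minimal[of H Hl] left.lift_minimal[of Hl H] left_drop_mult_mat[OF d, folded Hl_def] by metis
qed

end

theorem theorem7p4:
  fixes al be ga :: "nat \<Rightarrow> 'a::field"
    and m n k :: nat
    and D :: "nat \<Rightarrow> 'a mat"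
    and A B C T S J :: "'a mat"
    and w :: "'a vec"
  assumes alpha_nz: "\<forall>j. al j \<noteq> 0"
    and k2: "2 \<le> k"
    and D_dim: "\<forall>j \<le> k. D j \<in> carrier_mat m m"
    and Dk_nz: "D k \<noteq> 0\<^sub>m m m"
    and minreal: "is_minimal_realization m n A B C"
    and T: "T \<in> carrier_mat n n" "invertible_mat T"
    and S: "S \<in> carrier_mat n n" "invertible_mat S"
    and w: "w \<in> carrier_vec k"
    and J: "J \<in> carrier_mat (k * m) ((k - 1) * m)"
    and WJ_nonsing: "invertible_mat (WJ m w J)"
  defines "G \<equiv> Gmat al be ga m k D A B C"
    and "L \<equiv> rat_pm (L2 al be ga m n k D A B C T S w J)"
    and "Q \<equiv> minv (rat_pm (M_Phi al be ga k @\<^sub>r ekT k)) * rat_cm (1\<^sub>m (k - 1) @\<^sub>r 0\<^sub>m 1 (k - 1))"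
  defines "Nhat \<equiv> kron (transpose_mat Q) (1\<^sub>m m)"
  shows
    \<comment> \<open>(a)\<close>
    "(\<forall>H. right_minimal_basis L H \<longrightarrow>
        right_minimal_basis G (const_pm (wI m w) * row_block H n (k * m)) \<and>
        rat_pm (row_block H 0 n) =
          - (rat_cm (minv S) * minv (rat_pm (lamI_minus A)) * rat_cm B
             * rat_pm (const_pm (wI m w) * row_block H n (k * m))))
   \<and> \<comment> \<open>(b)\<close>
    (\<forall>H. right_minimal_basis G H \<longrightarrow>
        (\<exists>H1 H2.
          rat_pm H1 = - (rat_cm (minv S) * minv (rat_pm (lamI_minus A)) * rat_cm B * rat_pm H) \<and>
          rat_pm H2 = minv (rat_cm (WJ m w J)) *
             (rat_pm H @\<^sub>r (- (Nhat * rat_pm (block_transpose m (mD_Phi al be ga m k D)) * rat_pm H))) \<and>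
          right_minimal_basis L (H1 @\<^sub>r H2)))
   \<and> \<comment> \<open>(c)\<close>
    (\<forall>H. dim_row H = n + k * m \<longrightarrow>
        (left_minimal_basis L H \<longleftrightarrow>
          left_minimal_basis G (row_block H (n + (k - 1) * m) m) \<and>
          rat_pm (row_block H 0 n) =
            transpose_mat (rat_cm C * minv (rat_pm (lamI_minus A)) * rat_cm (minv T))
            * rat_pm (row_block H (n + (k - 1) * m) m) \<and>
          (\<forall>i \<in> {2..k}. row_block H (n + (i - 2) * m) m =
             map_mat (\<lambda>p. phi al be ga (k - i + 1) * p) (row_block H (n + (k - 1) * m) m))))
   \<and> \<comment> \<open>(d)\<close>
    (\<forall>es. right_minimal_indices G es \<longrightarrow> right_minimal_indices L es)
   \<and> \<comment> \<open>(e)\<close>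
    (\<forall>es. left_minimal_indices G es \<longrightarrow> left_minimal_indices L (map (\<lambda>e. e + k - 1) es))"
proof -
  \<comment> \<open>Invertibility turns into a nonzero determinant only for a matrix known to be
    square: w^T \<otimes> I supplies m rows and the block transpose of J the other (k - 1)
    m.\<close>
  have "block_transpose m J \<in> carrier_mat ((k - 1) * m) (k * m)" by (rule block_transpose_carrier[OF J])
  moreover have "wI m w \<in> carrier_mat m (k * m)"
    using w by (intro carrier_matI) (auto simp: wI_def row_of_vec_def)
  ultimately have "WJ m w J \<in> carrier_mat (m + (k - 1) * m) (k * m)"
    unfolding WJ_def by (intro carrier_append_rows)
  moreover have "m + (k - 1) * m = k * m" using k2 by (cases k) auto
  ultimately have "det (WJ m w J) \<noteq> 0" using invertible_det WJ_nonsing by metis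
  then interpret m2: m2_linearization al be ga m n k D A B C T S J w
    using alpha_nz k2 minreal T(1) S(1) w J invertible_det[OF T] invertible_det[OF S] by unfold_locales
  have G: "G = m2.G" unfolding G_def by (rule m2.G_eq[symmetric])
  have L: "L = m2.L" unfolding L_def by (rule m2.L_eq[symmetric])
  have N: "Nhat = kron (transpose_mat (Q_mat al be ga k)) (1\<^sub>m m)" by (simp add: Nhat_def Q_def Q_mat_def)
  show ?thesis
    unfolding G L N
    using m2.right_minimal_basis_drop m2.right_minimal_basis_lift m2.left_minimal_basis_iff
      m2.right_indices_lift m2.left_indices_lift by blast
qed

end
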